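(* Let $X$ be a finite-dimensional real vector space. Let $A=\wedge(X)=\mathrm S(X[-1])$ be the graded associative algebra with generators of degree $1$, and let $B=\mathrm S(X^* )$, concentrated in degree $0$. View $A$ and $B$ as $A_\infty$-algebras whose only non-zero structure map is $\mathrm d^2$ (the product). Then there exists an $A_\infty$-$A$-$B$-bimodule structure on $K=\mathbb R$ whose structure maps $$\mathrm d_K^{j,l}\colon A[1]^{\otimes j}\otimes K[1]\otimes B[1]^{\otimes l}\to K[1]$$ satisfy $\mathrm d_K^{1,1}(v\otimes \kappa\otimes u)=\langle u,v\rangle \kappa$ for all $\kappa\in K$, $v\in X\subset\wedge(X)$ and $u\in X^*\subset \mathrm S(X^* )$, where $\langle\ ,\ \rangle$ is the canonical pairing. More generally, let $U,V\subset X$ be linear subspaces, and let $A=\mathrm S(U^* )\otimes\wedge(X/U)$, $B=\mathrm S(V^* )\otimes\wedge(X/V)$, $K=\mathrm S((U\cap V)^* )\otimes\wedge(X/(U+V))$, where $A$ is generated by $W_A=U^*\oplus (X/U)[-1]$, $B$ is generated by $W_B=V^*\oplus (X/V)[-1]$, and $A$, $B$ are again viewed as $A_\infty$-algebras with the product as only non-zero structure map. Then there exists an $A_\infty$-$A$-$B$-bimodule structure on $K$ whose structure maps satisfy $\mathrm d_K^{1,1}(v\otimes \kappa\otimes u)=\langle v,u\rangle \kappa$ for all $\kappa\in K$, $v\in (U/(U\cap V))^*\oplus (V/(U\cap V))[-1]\subset W_A$ and $u\in (V/(U\cap V))^*\oplus (U/(U\cap V))[-1]\subset W_B$.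
   Context: For a graded vector space $M$, $M[1]$ is the shift, $M[1]^i=M^{i+1}$, and $\mathrm T(M)=\bigoplus_{n\ge0}M^{\otimes n}$ is the counital tensor coalgebra. The algebras $A,B$ and the space $K$ are graded by exterior degree (polynomial generators have degree $0$, exterior generators have degree $1$). An $A_\infty$-algebra structure on $A$ is a degree $1$ coderivation $\mathrm d_A$ of $\mathrm T(A[1])$ with $\mathrm d_A^2=0$ and vanishing composition with the counit; it is determined by its Taylor components $\mathrm d_A^n\colon A[1]^{\otimes n}\to A[1]$, $n\ge0$. A graded associative algebra is an $A_\infty$-algebra with only non-zero component $\mathrm d_A^2$ given by the (suspended) product. If $A,B$ are $A_\infty$-algebras, an $A_\infty$-$A$-$B$-bimodule structure on a graded vector space $K$ is a degree $1$ codifferential $\mathrm d_K$ (i.e. a coderivation compatible with $\mathrm d_A$, $\mathrm d_B$, with $\mathrm d_K^2=0$) on the cofree bicomodule $\mathrm T(A[1])\otimes K[1]\otimes \mathrm T(B[1])$; it is determined by its Taylor components (structure maps) $\mathrm d_K^{j,l}\colon A[1]^{\otimes j}\otimes K[1]\otimes B[1]^{\otimes l}\to K[1]$, $j,l\ge0$. Elements of $A,B,K$ are identified with their suspensions. The inclusions used are: $(U/(U\cap V))^*\subset U^*$ (functionals on $U$ vanishing on $U\cap V$), $V/(U\cap V)\cong (U+V)/U\subset X/U$, and similarly with $U$ and $V$ exchanged; $\langle\ ,\ \rangle$ pairs $(U/(U\cap V))^*$ with $U/(U\cap V)$ and $V/(U\cap V)$ with $(V/(U\cap V))^*$. *)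

theory Defs
  imports "HOL-Analysis.Analysis" "HOL-Analysis.Finite_Function_Topology"
    "HOL-Library.Function_Algebras"
begin

section \<open>Linear algebra\<close>

instantiation "fun" :: (type, real_vector) real_vector
begin

definition "scaleR c f = (\<lambda>x. c *\<^sub>R f x)"

instance
  by standard (auto simp: scaleR_fun_def plus_fun_def algebra_simps)

end

text \<open>A functional on the subspace \<^term>\<open>U\<close> is a function that is linear on \<^term>\<open>U\<close>; outside
  \<^term>\<open>U\<close> it takes the dummy value 0, so that each functional is represented exactly once.\<close>

definition dual :: "'v::real_vector set \<Rightarrow> ('v \<Rightarrow> real) set" where
  "dual U = {f. (\<forall>x\<in>U. \<forall>y\<in>U. f (x + y) = f x + f y) \<and> (\<forall>c. \<forall>x\<in>U. f (c *\<^sub>R x) = c * f x)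
                \<and> (\<forall>x. x \<notin> U \<longrightarrow> f x = 0)}"

text \<open>Quotients: for a subspace \<^term>\<open>N\<close> we fix a linear idempotent \<^term>\<open>p\<close> with kernel exactly
  \<^term>\<open>N\<close>. The quotient of a subspace \<open>C \<supseteq> N\<close> by \<^term>\<open>N\<close> is the image \<open>p ` C\<close>, with \<^term>\<open>p\<close> as the
  quotient map: \<open>x + N\<close> is represented by \<open>p x\<close>.\<close>

definition quot :: "'v::real_vector set \<Rightarrow> 'v \<Rightarrow> 'v" where
  "quot N = (SOME p. linear p \<and> (\<forall>x. p (p x) = p x) \<and> (\<forall>x. p x = 0 \<longleftrightarrow> x \<in> N))"

lemma quot_exists:
  fixes N :: "'v::real_vector set"
  assumes "subspace N"
  shows "\<exists>p. linear p \<and> (\<forall>x. p (p x) = p x) \<and> (\<forall>x. p x = 0 \<longleftrightarrow> x \<in> N)"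
proof -
  obtain B where B: "B \<subseteq> N" "independent B" "N \<subseteq> span B"
    using maximal_independent_subset by metis
  have sB: "span B = N"
    using B assms by (simp add: span_subspace)
  define C where "C = extend_basis B"
  have C: "B \<subseteq> C" "independent C" "span C = UNIV"
    using extend_basis_superset[OF B(2)] independent_extend_basis[OF B(2)] span_extend_basis[OF B(2)]
    unfolding C_def by auto
  obtain p where p: "linear p" "\<And>x. x \<in> C \<Longrightarrow> p x = (if x \<in> B then 0 else x)"
    using linear_independent_extend[OF C(2), of "\<lambda>x. if x \<in> B then 0 else x"] by auto
  have pN: "p x = 0" if "x \<in> N" for x
  proof -
    have "x \<in> span B" using that sB by simp
    then show ?thesis
      by (rule linear_eq_0_on_span[OF p(1), rotated]) (use p(2) C(1) in auto)
  qed
  have dN: "x - p x \<in> N" for x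
  proof -
    have "x \<in> span C" using C by simp
    then show ?thesis
    proof (induction rule: span_induct)
      case base
      have "linear (\<lambda>x. x - p x)"
        using p(1) by (intro linear_compose_sub) (auto simp: linear_iff)
      then show ?case
        using linear_subspace_vimage[of "\<lambda>x. x - p x" N] assms by (auto simp: vimage_def)
    next
      case (step x)
      then show ?case using p(2)[of x] B(1) assms by (auto simp: subspace_0)
    qed
  qed
  have idem: "p (p x) = p x" for x
    using pN[OF dN[of x]] linear_diff[OF p(1), of x "p x"] by simp
  show ?thesis
  proof (intro exI[of _ p] conjI allI)
    fix x show "p x = 0 \<longleftrightarrow> x \<in> N" using pN dN[of x] by auto
  qed (use p(1) idem in auto)
qed

lemma quot:
  assumes "subspace N"
  shows "linear (quot N)" "quot N (quot N x) = quot N x" "quot N x = 0 \<longleftrightarrow> x \<in> N"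
  using someI_ex[OF quot_exists[OF assms]] unfolding quot_def[symmetric] by auto

text \<open>Linear extension from the basis of a free vector space.\<close>

definition free_lift :: "('b \<Rightarrow> 'v::real_vector) \<Rightarrow> ('b \<Rightarrow>\<^sub>0 real) \<Rightarrow> 'v" where
  "free_lift h p = (\<Sum>b\<in>Poly_Mapping.keys p. Poly_Mapping.lookup p b *\<^sub>R h b)"

abbreviation basis_elt :: "'b \<Rightarrow> 'b \<Rightarrow>\<^sub>0 real" where
  "basis_elt b \<equiv> Poly_Mapping.single b 1"

lemma lookup_scaleR: "Poly_Mapping.lookup (c *\<^sub>R p) b = c *\<^sub>R Poly_Mapping.lookup p b"
  for p :: "'b \<Rightarrow>\<^sub>0 'v::real_vector"
proof -
  have "finite {i. c *\<^sub>R Poly_Mapping.lookup p i \<noteq> 0}"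
    by (rule finite_subset[OF _ finite_keys[of p]]) (auto simp: in_keys_iff)
  then show ?thesis by (simp add: scaleR_poly_mapping_def)
qed

lemma free_lift_superset:
  assumes "finite S" "Poly_Mapping.keys p \<subseteq> S"
  shows "free_lift h p = (\<Sum>b\<in>S. Poly_Mapping.lookup p b *\<^sub>R h b)"
  unfolding free_lift_def by (rule sum.mono_neutral_left) (use assms in \<open>auto simp: in_keys_iff\<close>)

lemma linear_free_lift:
  fixes h :: "'b \<Rightarrow> 'v::real_vector"
  shows "linear (free_lift h)"
proof
  fix p q :: "'b \<Rightarrow>\<^sub>0 real" and c :: real
  let ?S = "Poly_Mapping.keys p \<union> Poly_Mapping.keys q"
  have *: "finite ?S" "Poly_Mapping.keys (p + q) \<subseteq> ?S" "Poly_Mapping.keys p \<subseteq> ?S"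
    "Poly_Mapping.keys q \<subseteq> ?S"
    using keys_add[of p q] by auto
  show "free_lift h (p + q) = free_lift h p + free_lift h q"
    by (simp add: free_lift_superset[OF *(1,2)] free_lift_superset[OF *(1,3)]
        free_lift_superset[OF *(1,4)] lookup_add scaleR_left_distrib sum.distrib)
  have "Poly_Mapping.keys (c *\<^sub>R p) \<subseteq> Poly_Mapping.keys p"
    by (auto simp: in_keys_iff lookup_scaleR)
  then have "free_lift h (c *\<^sub>R p) = (\<Sum>b\<in>Poly_Mapping.keys p. Poly_Mapping.lookup (c *\<^sub>R p) b *\<^sub>R h b)"
    by (intro free_lift_superset) auto
  then show "free_lift h (c *\<^sub>R p) = c *\<^sub>R free_lift h p"
    by (simp add: lookup_scaleR scaleR_sum_right free_lift_def)
qed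

lemma free_lift_basis [simp]: "free_lift h (basis_elt b) = h b"
  by (simp add: free_lift_def)

lemma span_basis_elt: "p \<in> span (range basis_elt)"
proof -
  have "p = (\<Sum>b\<in>Poly_Mapping.keys p. Poly_Mapping.lookup p b *\<^sub>R basis_elt b)"
  proof (rule poly_mapping_eqI)
    fix k
    have "(\<Sum>b\<in>Poly_Mapping.keys p. Poly_Mapping.lookup p b *\<^sub>R (1 when b = k))
        = (\<Sum>b\<in>Poly_Mapping.keys p. if b = k then Poly_Mapping.lookup p b else 0)"
      by (intro sum.cong) (auto simp: when_def)
    then show "Poly_Mapping.lookup p k =
      Poly_Mapping.lookup (\<Sum>b\<in>Poly_Mapping.keys p. Poly_Mapping.lookup p b *\<^sub>R basis_elt b) k"
      by (auto simp: lookup_sum lookup_scaleR lookup_single in_keys_iff)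
  qed
  also have "\<dots> \<in> span (range basis_elt)"
    by (intro span_sum span_scale span_base) auto
  finally show ?thesis .
qed

section \<open>Tensor products\<close>

text \<open>For subspaces \<^term>\<open>P\<close>, \<^term>\<open>Q\<close> of two real vector spaces, the tensor product of \<^term>\<open>P\<close> and
  \<^term>\<open>Q\<close> is identified with the span of the tensors \<open>x \<otimes> y\<close> with \<open>x \<in> P\<close>, \<open>y \<in> Q\<close> inside the tensor
  product of the ambient spaces. The same convention is used for the tensor coalgebra below.\<close>

definition tensor_relators :: "('a::real_vector \<times> 'b::real_vector \<Rightarrow>\<^sub>0 real) set" where
  "tensor_relators =
     {basis_elt (x + x', y) - basis_elt (x, y) - basis_elt (x', y) | x x' y. True}
   \<union> {basis_elt (x, y + y') - basis_elt (x, y) - basis_elt (x, y') | x y y'. True}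
   \<union> {basis_elt (c *\<^sub>R x, y) - c *\<^sub>R basis_elt (x, y) | c x y. True}
   \<union> {basis_elt (x, c *\<^sub>R y) - c *\<^sub>R basis_elt (x, y) | c x y. True}"

lemma equivp_mod_span: "equivp (\<lambda>p q. p - q \<in> span R)"
proof (rule equivpI)
  show "reflp (\<lambda>p q. p - q \<in> span R)" by (auto simp: reflp_def span_zero)
  show "symp (\<lambda>p q. p - q \<in> span R)"
    by (auto simp: symp_def) (metis minus_diff_eq span_neg)
  show "transp (\<lambda>p q. p - q \<in> span R)"
    by (auto simp: transp_def) (metis (no_types) diff_add_cancel add_diff_eq span_add)
qed

quotient_type (overloaded) ('a, 'b) tensor =
  "('a::real_vector \<times> 'b::real_vector) \<Rightarrow>\<^sub>0 real" / "\<lambda>p q. p - q \<in> span tensor_relators"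
  by (rule equivp_mod_span)

lemma span_mod_arith:
  "p - q \<in> span R \<Longrightarrow> p' - q' \<in> span R \<Longrightarrow> (p + p') - (q + q') \<in> span R"
  "p - q \<in> span R \<Longrightarrow> p' - q' \<in> span R \<Longrightarrow> (p - p') - (q - q') \<in> span R"
  "p - q \<in> span R \<Longrightarrow> - p - - q \<in> span R"
  "p - q \<in> span R \<Longrightarrow> c *\<^sub>R p - c *\<^sub>R q \<in> span R"
proof -
  show "(p + p') - (q + q') \<in> span R" if "p - q \<in> span R" "p' - q' \<in> span R"
    using span_add[OF that] by (simp add: algebra_simps)
  show "(p - p') - (q - q') \<in> span R" if "p - q \<in> span R" "p' - q' \<in> span R"
    using span_diff[OF that] by (simp add: algebra_simps)
  show "- p - - q \<in> span R" if "p - q \<in> span R"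
    using span_neg[OF that] by (simp add: algebra_simps)
  show "c *\<^sub>R p - c *\<^sub>R q \<in> span R" if "p - q \<in> span R"
    using span_scale[OF that, of c] by (simp add: algebra_simps)
qed

instantiation tensor :: (real_vector, real_vector) real_vector
begin

lift_definition zero_tensor :: "('a, 'b) tensor" is 0 .
lift_definition plus_tensor :: "('a, 'b) tensor \<Rightarrow> ('a, 'b) tensor \<Rightarrow> ('a, 'b) tensor" is "(+)"
  by (rule span_mod_arith)
lift_definition minus_tensor :: "('a, 'b) tensor \<Rightarrow> ('a, 'b) tensor \<Rightarrow> ('a, 'b) tensor" is "(-)"
  by (rule span_mod_arith)
lift_definition uminus_tensor :: "('a, 'b) tensor \<Rightarrow> ('a, 'b) tensor" is uminus
  by (rule span_mod_arith)
lift_definition scaleR_tensor :: "real \<Rightarrow> ('a, 'b) tensor \<Rightarrow> ('a, 'b) tensor" is "(*\<^sub>R)"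
  by (rule span_mod_arith)

instance
  by standard (transfer; simp add: algebra_simps span_zero)+

end

lift_definition pure_tensor :: "'a::real_vector \<Rightarrow> 'b::real_vector \<Rightarrow> ('a, 'b) tensor" (infixr "\<otimes>" 70)
  is "\<lambda>x y. basis_elt (x, y)" .

text \<open>For bilinear \<^term>\<open>h\<close>, \<open>tensor_lift h\<close> is the linear map with \<open>x \<otimes> y \<mapsto> h x y\<close>; for other
  \<^term>\<open>h\<close> its value depends on the chosen representative and is irrelevant.\<close>

definition tensor_lift ::
    "('a::real_vector \<Rightarrow> 'b::real_vector \<Rightarrow> 'c::real_vector) \<Rightarrow> ('a, 'b) tensor \<Rightarrow> 'c" where
  "tensor_lift h t = free_lift (\<lambda>(x, y). h x y) (rep_tensor t)"

lemma bilinear_tensor: "bilinear (\<otimes>)"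
proof -
  have 1: "(x + x') \<otimes> y = x \<otimes> y + x' \<otimes> y" for x x' :: 'a and y :: 'b
    by transfer (force simp: tensor_relators_def diff_diff_eq intro!: span_base)
  have 2: "x \<otimes> (y + y') = x \<otimes> y + x \<otimes> y'" for x :: 'a and y y' :: 'b
    by transfer (force simp: tensor_relators_def diff_diff_eq intro!: span_base)
  have 3: "(c *\<^sub>R x) \<otimes> y = c *\<^sub>R (x \<otimes> y)" for c and x :: 'a and y :: 'b
    by transfer (force simp: tensor_relators_def intro!: span_base)
  have 4: "x \<otimes> (c *\<^sub>R y) = c *\<^sub>R (x \<otimes> y)" for c and x :: 'a and y :: 'b
    by transfer (force simp: tensor_relators_def intro!: span_base)
  show ?thesis
    by (simp add: bilinear_def linear_iff 1 2 3 4)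
qed

lemma tensor_lift_abs:
  assumes "bilinear h"
  shows "tensor_lift h (abs_tensor p) = free_lift (\<lambda>(x, y). h x y) p"
proof -
  let ?H = "free_lift (\<lambda>(x, y). h x y)"
  have L: "linear ?H" by (rule linear_free_lift)
  have "?H r = 0" if "r \<in> span tensor_relators" for r
    by (rule linear_eq_0_on_span[OF L _ that])
      (auto simp: tensor_relators_def linear_diff[OF L] linear_cmul[OF L] bilinear_ladd[OF assms]
        bilinear_radd[OF assms] bilinear_lmul[OF assms] bilinear_rmul[OF assms])
  moreover have "rep_tensor (abs_tensor p) - p \<in> span tensor_relators"
    using Quotient3_rep_abs[OF Quotient3_tensor, of p] by (simp add: span_zero)
  ultimately show ?thesis
    unfolding tensor_lift_def by (metis L eq_iff_diff_eq_0 linear_diff)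
qed

lemma tensor_lift_pure [simp]: "bilinear h \<Longrightarrow> tensor_lift h (x \<otimes> y) = h x y"
  by (simp add: tensor_lift_abs pure_tensor.abs_eq)

lemma linear_tensor_lift: "bilinear h \<Longrightarrow> linear (tensor_lift h)"
proof (rule linearI)
  assume h: "bilinear h"
  note L = linear_free_lift[of "\<lambda>(x, y). h x y"]
  fix s t :: "('a, 'b) tensor" and c :: real
  obtain p q where pq: "s = abs_tensor p" "t = abs_tensor q"
    using Quotient3_abs_rep[OF Quotient3_tensor] by metis
  show "tensor_lift h (s + t) = tensor_lift h s + tensor_lift h t"
    by (simp add: pq plus_tensor.abs_eq tensor_lift_abs[OF h] linear_add[OF L])
  show "tensor_lift h (c *\<^sub>R s) = c *\<^sub>R tensor_lift h s"
    by (simp add: pq scaleR_tensor.abs_eq tensor_lift_abs[OF h] linear_cmul[OF L])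
qed

lemma span_pure_tensors: "t \<in> span {x \<otimes> y | x y. True}"
proof -
  obtain p where t: "t = abs_tensor p" using Quotient3_abs_rep[OF Quotient3_tensor] by metis
  have L: "linear abs_tensor"
    by (rule linearI) (simp_all add: plus_tensor.abs_eq scaleR_tensor.abs_eq)
  have "abs_tensor p \<in> abs_tensor ` span (range basis_elt)"
    using span_basis_elt by blast
  also have "\<dots> = span (abs_tensor ` range basis_elt)"
    by (rule linear_span_image[OF L, symmetric])
  also have "abs_tensor ` range basis_elt = {x \<otimes> y | x y. True}"
    by (auto simp: pure_tensor.abs_eq image_iff)
  finally show ?thesis by (simp add: t)
qed

definition tensor_map where
  "tensor_map f g = tensor_lift (\<lambda>x y. f x \<otimes> g y)"

definition assoc_right where
  "assoc_right = tensor_lift (\<lambda>t z. tensor_lift (\<lambda>x y. x \<otimes> (y \<otimes> z)) t)"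

definition assoc_left where
  "assoc_left = tensor_lift (\<lambda>x t. tensor_lift (\<lambda>y z. (x \<otimes> y) \<otimes> z) t)"

lemma tensor_simps:
  "(x + x') \<otimes> y = x \<otimes> y + x' \<otimes> y" "x \<otimes> (y + y') = x \<otimes> y + x \<otimes> y'"
  "(c *\<^sub>R x) \<otimes> y = c *\<^sub>R (x \<otimes> y)" "x \<otimes> (c *\<^sub>R y) = c *\<^sub>R (x \<otimes> y)"
  by (rule bilinear_ladd[OF bilinear_tensor] bilinear_radd[OF bilinear_tensor]
      bilinear_lmul[OF bilinear_tensor] bilinear_rmul[OF bilinear_tensor])+

lemma bilinear_pure: "linear f \<Longrightarrow> linear g \<Longrightarrow> bilinear (\<lambda>x y. f x \<otimes> g y)"
  by (simp add: bilinear_def linear_iff tensor_simps)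

lemma tensor_map_pure [simp]: "linear f \<Longrightarrow> linear g \<Longrightarrow> tensor_map f g (x \<otimes> y) = f x \<otimes> g y"
  by (simp add: tensor_map_def bilinear_pure)

lemma tensor_eqI:
  assumes "linear f" "linear g" "\<And>x y. f (x \<otimes> y) = g (x \<otimes> y)"
  shows "f t = g t"
  by (rule linear_eq_on_span[OF assms(1,2) _ span_pure_tensors]) (use assms(3) in auto)

lemma assoc_right_pure [simp]:
  fixes x :: "'a::real_vector" and y :: "'b::real_vector" and z :: "'c::real_vector"
  shows "assoc_right ((x \<otimes> y) \<otimes> z) = x \<otimes> (y \<otimes> z)"
proof -
  have B: "bilinear (\<lambda>(x::'a) (y::'b). x \<otimes> (y \<otimes> z))" for z :: 'c
    by (simp add: bilinear_def linear_iff tensor_simps)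
  have "bilinear (\<lambda>t (z::'c). tensor_lift (\<lambda>(x::'a) (y::'b). x \<otimes> (y \<otimes> z)) t)"
    unfolding bilinear_def
  proof (intro conjI allI)
    fix t :: "('a, 'b) tensor" and z :: 'c
    show "linear (\<lambda>t. tensor_lift (\<lambda>(x::'a) (y::'b). x \<otimes> (y \<otimes> z)) t)"
      by (rule linear_tensor_lift[OF B])
    note L = linear_tensor_lift[OF B]
    show "linear (\<lambda>z::'c. tensor_lift (\<lambda>(x::'a) (y::'b). x \<otimes> (y \<otimes> z)) t)"
    proof (rule linearI)
      fix z z' :: 'c and c :: real
      show "tensor_lift (\<lambda>(x::'a) (y::'b). x \<otimes> (y \<otimes> (z + z'))) t =
          tensor_lift (\<lambda>(x::'a) (y::'b). x \<otimes> (y \<otimes> z)) t + tensor_lift (\<lambda>(x::'a) (y::'b). x \<otimes> (y \<otimes> z')) t"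
        by (rule tensor_eqI[of _ "\<lambda>t. tensor_lift (\<lambda>(x::'a) (y::'b). x \<otimes> (y \<otimes> z)) t + tensor_lift (\<lambda>(x::'a) (y::'b). x \<otimes> (y \<otimes> z')) t"])
          (rule L, intro linear_compose_add L, unfold tensor_lift_pure[OF B], simp add: tensor_simps)
      show "tensor_lift (\<lambda>(x::'a) (y::'b). x \<otimes> (y \<otimes> (c *\<^sub>R z))) t = c *\<^sub>R tensor_lift (\<lambda>(x::'a) (y::'b). x \<otimes> (y \<otimes> z)) t"
        by (rule tensor_eqI[of _ "\<lambda>t. c *\<^sub>R tensor_lift (\<lambda>(x::'a) (y::'b). x \<otimes> (y \<otimes> z)) t"])
          (rule L, intro linear_compose_scale_right L, unfold tensor_lift_pure[OF B], simp add: tensor_simps)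
    qed
  qed
  then show ?thesis by (simp add: assoc_right_def B)
qed

lemma assoc_left_pure [simp]:
  fixes x :: "'a::real_vector" and y :: "'b::real_vector" and z :: "'c::real_vector"
  shows "assoc_left (x \<otimes> (y \<otimes> z)) = (x \<otimes> y) \<otimes> z"
proof -
  have B: "bilinear (\<lambda>(y::'b) (z::'c). (x \<otimes> y) \<otimes> z)" for x :: 'a
    by (simp add: bilinear_def linear_iff tensor_simps)
  have "bilinear (\<lambda>(x::'a) t. tensor_lift (\<lambda>(y::'b) (z::'c). (x \<otimes> y) \<otimes> z) t)"
    unfolding bilinear_def
  proof (intro conjI allI)
    fix t :: "('b, 'c) tensor" and x :: 'a
    show "linear (\<lambda>t. tensor_lift (\<lambda>(y::'b) (z::'c). (x \<otimes> y) \<otimes> z) t)"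
      by (rule linear_tensor_lift[OF B])
    note L = linear_tensor_lift[OF B]
    show "linear (\<lambda>x::'a. tensor_lift (\<lambda>(y::'b) (z::'c). (x \<otimes> y) \<otimes> z) t)"
    proof (rule linearI)
      fix x x' :: 'a and c :: real
      show "tensor_lift (\<lambda>(y::'b) (z::'c). ((x + x') \<otimes> y) \<otimes> z) t =
          tensor_lift (\<lambda>(y::'b) (z::'c). (x \<otimes> y) \<otimes> z) t + tensor_lift (\<lambda>(y::'b) (z::'c). (x' \<otimes> y) \<otimes> z) t"
        by (rule tensor_eqI[of _ "\<lambda>t. tensor_lift (\<lambda>(y::'b) (z::'c). (x \<otimes> y) \<otimes> z) t + tensor_lift (\<lambda>(y::'b) (z::'c). (x' \<otimes> y) \<otimes> z) t"])
          (rule L, intro linear_compose_add L, unfold tensor_lift_pure[OF B], simp add: tensor_simps)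
      show "tensor_lift (\<lambda>(y::'b) (z::'c). ((c *\<^sub>R x) \<otimes> y) \<otimes> z) t = c *\<^sub>R tensor_lift (\<lambda>(y::'b) (z::'c). (x \<otimes> y) \<otimes> z) t"
        by (rule tensor_eqI[of _ "\<lambda>t. c *\<^sub>R tensor_lift (\<lambda>(y::'b) (z::'c). (x \<otimes> y) \<otimes> z) t"])
          (rule L, intro linear_compose_scale_right L, unfold tensor_lift_pure[OF B], simp add: tensor_simps)
    qed
  qed
  then show ?thesis by (simp add: assoc_left_def B)
qed

section \<open>The tensor (co)algebra\<close>

definition tens_relators :: "('a::real_vector list \<Rightarrow>\<^sub>0 real) set" where
  "tens_relators =
     {basis_elt (us @ (x + y) # vs) - basis_elt (us @ x # vs) - basis_elt (us @ y # vs) | us x y vs. True}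
   \<union> {basis_elt (us @ (c *\<^sub>R x) # vs) - c *\<^sub>R basis_elt (us @ x # vs) | us c x vs. True}"

quotient_type (overloaded) 'a tens = "'a::real_vector list \<Rightarrow>\<^sub>0 real" / "\<lambda>p q. p - q \<in> span tens_relators"
  by (rule equivp_mod_span)

instantiation tens :: (real_vector) real_vector
begin

lift_definition zero_tens :: "'a tens" is 0 .
lift_definition plus_tens :: "'a tens \<Rightarrow> 'a tens \<Rightarrow> 'a tens" is "(+)" by (rule span_mod_arith)
lift_definition minus_tens :: "'a tens \<Rightarrow> 'a tens \<Rightarrow> 'a tens" is "(-)" by (rule span_mod_arith)
lift_definition uminus_tens :: "'a tens \<Rightarrow> 'a tens" is uminus by (rule span_mod_arith)
lift_definition scaleR_tens :: "real \<Rightarrow> 'a tens \<Rightarrow> 'a tens" is "(*\<^sub>R)" by (rule span_mod_arith)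

instance
  by standard (transfer; simp add: algebra_simps span_zero)+

end

text \<open>\<open>word [x1, \<dots>, xn]\<close> is the tensor \<open>x1 \<otimes> \<dots> \<otimes> xn\<close>.\<close>

lift_definition word :: "'a::real_vector list \<Rightarrow> 'a tens" is basis_elt .

definition multilinear :: "('a::real_vector list \<Rightarrow> 'b::real_vector) \<Rightarrow> bool" where
  "multilinear h \<longleftrightarrow> (\<forall>us vs. linear (\<lambda>x. h (us @ x # vs)))"

text \<open>For multilinear \<^term>\<open>h\<close>, \<open>tens_lift h\<close> is the linear map with \<open>word xs \<mapsto> h xs\<close>.\<close>

definition tens_lift :: "('a::real_vector list \<Rightarrow> 'b::real_vector) \<Rightarrow> 'a tens \<Rightarrow> 'b" where
  "tens_lift h t = free_lift h (rep_tens t)"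

lemma word_multilinear: "multilinear word"
proof -
  have "word (us @ (x + y) # vs) = word (us @ x # vs) + word (us @ y # vs)" for us vs and x y :: 'a
    by transfer (force simp: tens_relators_def diff_diff_eq intro!: span_base)
  moreover have "word (us @ (c *\<^sub>R x) # vs) = c *\<^sub>R word (us @ x # vs)" for us vs c and x :: 'a
    by transfer (force simp: tens_relators_def intro!: span_base)
  ultimately show ?thesis
    by (simp add: multilinear_def linear_iff)
qed

lemma tens_lift_abs:
  assumes "multilinear h"
  shows "tens_lift h (abs_tens p) = free_lift h p"
proof -
  have L: "linear (free_lift h)" by (rule linear_free_lift)
  have h: "h (us @ (x + y) # vs) = h (us @ x # vs) + h (us @ y # vs)"
    "h (us @ (c *\<^sub>R x) # vs) = c *\<^sub>R h (us @ x # vs)" for us x y vs c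
    using assms by (simp_all add: multilinear_def linear_iff)
  have "free_lift h r = 0" if "r \<in> span tens_relators" for r
    by (rule linear_eq_0_on_span[OF L _ that])
      (auto simp: tens_relators_def linear_diff[OF L] linear_cmul[OF L] h)
  moreover have "rep_tens (abs_tens p) - p \<in> span tens_relators"
    using Quotient3_rep_abs[OF Quotient3_tens, of p] by (simp add: span_zero)
  ultimately show ?thesis
    unfolding tens_lift_def by (metis L eq_iff_diff_eq_0 linear_diff)
qed

lemma tens_lift_word [simp]: "multilinear h \<Longrightarrow> tens_lift h (word xs) = h xs"
  by (simp add: tens_lift_abs word.abs_eq)

lemma linear_tens_lift: "multilinear h \<Longrightarrow> linear (tens_lift h)"
proof (rule linearI)
  assume h: "multilinear h"
  note L = linear_free_lift[of h]
  fix s t :: "'a tens" and c :: real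
  obtain p q where pq: "s = abs_tens p" "t = abs_tens q"
    using Quotient3_abs_rep[OF Quotient3_tens] by metis
  show "tens_lift h (s + t) = tens_lift h s + tens_lift h t"
    by (simp add: pq plus_tens.abs_eq tens_lift_abs[OF h] linear_add[OF L])
  show "tens_lift h (c *\<^sub>R s) = c *\<^sub>R tens_lift h s"
    by (simp add: pq scaleR_tens.abs_eq tens_lift_abs[OF h] linear_cmul[OF L])
qed

lemma span_words: "t \<in> span (range word)"
proof -
  obtain p where t: "t = abs_tens p" using Quotient3_abs_rep[OF Quotient3_tens] by metis
  have L: "linear abs_tens"
    by (rule linearI) (simp_all add: plus_tens.abs_eq scaleR_tens.abs_eq)
  have "abs_tens p \<in> abs_tens ` span (range basis_elt)"
    using span_basis_elt by blast
  also have "\<dots> = span (abs_tens ` range basis_elt)"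
    by (rule linear_span_image[OF L, symmetric])
  also have "abs_tens ` range basis_elt = range word"
    by (auto simp: word.abs_eq image_iff)
  finally show ?thesis by (simp add: t)
qed

lemma tens_eqI:
  assumes "linear f" "linear g" "\<And>xs. f (word xs) = g (word xs)"
  shows "f t = g t"
  by (rule linear_eq_on_span[OF assms(1,2) _ span_words]) (use assms(3) in auto)

definition counit :: "'a::real_vector tens \<Rightarrow> real" where
  "counit = tens_lift (\<lambda>xs. if xs = [] then 1 else 0)"

definition proj1 :: "'a::real_vector tens \<Rightarrow> 'a" where
  "proj1 = tens_lift (\<lambda>xs. case xs of [x] \<Rightarrow> x | _ \<Rightarrow> 0)"

definition comult :: "'a::real_vector tens \<Rightarrow> ('a tens, 'a tens) tensor" where
  "comult = tens_lift (\<lambda>xs. \<Sum>i\<le>length xs. word (take i xs) \<otimes> word (drop i xs))"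

lemma counit_word [simp]: "counit (word xs) = (if xs = [] then 1 else 0)"
  unfolding counit_def by (rule tens_lift_word) (simp add: multilinear_def linear_iff)

lemma proj1_word: "proj1 (word xs) = (case xs of [x] \<Rightarrow> x | _ \<Rightarrow> 0)"
  unfolding proj1_def
  by (rule tens_lift_word) (auto simp: multilinear_def linear_iff split: list.splits simp: append_eq_Cons_conv)

lemma comult_word: "comult (word xs) = (\<Sum>i\<le>length xs. word (take i xs) \<otimes> word (drop i xs))"
proof -
  have W: "word (us @ (x + y) # vs) = word (us @ x # vs) + word (us @ y # vs)"
    "word (us @ (c *\<^sub>R x) # vs) = c *\<^sub>R word (us @ x # vs)" for us vs c and x y :: 'a
    using word_multilinear unfolding multilinear_def linear_iff by blast+
  note W0 = W[of "[]", simplified]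
  have "linear (\<lambda>x. word (take i (us @ x # vs)) \<otimes> word (drop i (us @ x # vs)))"
    for us vs :: "'a list" and i
    by (cases "i - length us") (auto simp: linear_iff W W0 tensor_simps)
  then show ?thesis
    unfolding comult_def
    by (intro tens_lift_word) (simp del: sum.atMost_Suc take_append drop_append add: multilinear_def linear_compose_sum)
qed

text \<open>The concatenation product, used for the construction of symmetric algebras.\<close>

instantiation tens :: (real_vector) real_algebra_1
begin

definition one_tens :: "'a tens" where "1 = word []"

definition times_tens :: "'a tens \<Rightarrow> 'a tens \<Rightarrow> 'a tens" where
  "s * t = tens_lift (\<lambda>xs. tens_lift (\<lambda>ys. word (xs @ ys)) t) s"

lemma mult_aux:
  fixes s t :: "'a tens"
  shows "multilinear (\<lambda>ys. word (xs @ ys) :: 'a tens)"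
    and "multilinear (\<lambda>xs. tens_lift (\<lambda>ys. word (xs @ ys)) t :: 'a tens)"
proof -
  have W: "word (us @ (x + y) # vs) = word (us @ x # vs) + word (us @ y # vs)"
    "word (us @ (c *\<^sub>R x) # vs) = c *\<^sub>R word (us @ x # vs)" for us vs c and x y :: 'a
    using word_multilinear unfolding multilinear_def linear_iff by blast+
  show 1: "multilinear (\<lambda>ys. word (xs @ ys) :: 'a tens)" for xs
    using W[of "xs @ us" for us] by (simp add: multilinear_def linear_iff)
  note L = linear_tens_lift[OF 1]
  have T: "tens_lift (\<lambda>ys. word (xs @ ys)) (word zs) = word (xs @ zs)" for xs zs :: "'a list"
    by (rule tens_lift_word[OF 1])
  have "tens_lift (\<lambda>ys. word ((us @ (x + y) # vs) @ ys)) t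
      = tens_lift (\<lambda>ys. word ((us @ x # vs) @ ys)) t + tens_lift (\<lambda>ys. word ((us @ y # vs) @ ys)) t"
    for us vs and x y :: 'a
    by (rule tens_eqI[of _ "\<lambda>t. tens_lift (\<lambda>ys. word ((us @ x # vs) @ ys)) t
          + tens_lift (\<lambda>ys. word ((us @ y # vs) @ ys)) t"])
      (rule L, intro linear_compose_add L, unfold T, simp add: W)
  moreover have "tens_lift (\<lambda>ys. word ((us @ (c *\<^sub>R x) # vs) @ ys)) t
      = c *\<^sub>R tens_lift (\<lambda>ys. word ((us @ x # vs) @ ys)) t" for us vs c and x :: 'a
    by (rule tens_eqI[of _ "\<lambda>t. c *\<^sub>R tens_lift (\<lambda>ys. word ((us @ x # vs) @ ys)) t"])
      (rule L, intro linear_compose_scale_right L, unfold T, simp add: W)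
  ultimately show "multilinear (\<lambda>xs. tens_lift (\<lambda>ys. word (xs @ ys)) t :: 'a tens)"
    by (simp add: multilinear_def linear_iff)
qed

lemma word_mult_left: "word xs * t = (tens_lift (\<lambda>ys. word (xs @ ys)) t :: 'a tens)"
  unfolding times_tens_def by (rule tens_lift_word[OF mult_aux(2)])

lemma word_mult: "word xs * word ys = (word (xs @ ys) :: 'a tens)"
  unfolding word_mult_left by (rule tens_lift_word[OF mult_aux(1)])

lemma linear_mult_left: "linear (\<lambda>s :: 'a tens. s * t)"
  unfolding times_tens_def by (rule linear_tens_lift[OF mult_aux(2)])

lemma linear_mult_right: "linear (\<lambda>t :: 'a tens. s * t)"
proof -
  note L = linear_tens_lift[OF mult_aux(1)]
  have "s * (t + u) = s * t + s * u" for t u :: "'a tens"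
    by (rule tens_eqI[of "\<lambda>s. s * (t + u)" "\<lambda>s. s * t + s * u"])
      (intro linear_compose_add linear_mult_left, intro linear_compose_add linear_mult_left,
        simp only: word_mult_left linear_add[OF L])
  moreover have "s * (c *\<^sub>R t) = c *\<^sub>R (s * t)" for c and t :: "'a tens"
    by (rule tens_eqI[of "\<lambda>s. s * (c *\<^sub>R t)" "\<lambda>s. c *\<^sub>R (s * t)"])
      (intro linear_mult_left, intro linear_compose_scale_right linear_mult_left,
        simp only: word_mult_left linear_cmul[OF L])
  ultimately show ?thesis by (simp add: linear_iff)
qed

instance
proof
  fix a b c :: "'a tens" and r :: real
  note lin = linear_mult_left linear_mult_right
    linear_compose[OF linear_mult_left linear_mult_left, unfolded o_def]
    linear_compose[OF linear_mult_left linear_mult_right, unfolded o_def]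
    linear_compose[OF linear_mult_right linear_mult_left, unfolded o_def]
    linear_compose[OF linear_mult_right linear_mult_right, unfolded o_def]
  have 1: "word xs * word ys * word zs = word xs * (word ys * word zs)" for xs ys zs :: "'a list"
    by (simp add: word_mult)
  have 2: "word xs * word ys * c = word xs * (word ys * c)" for xs ys
    by (rule tens_eqI[of "\<lambda>c. word xs * word ys * c" "\<lambda>c. word xs * (word ys * c)"])
      (rule lin lin(6) 1)+
  have 3: "word xs * b * c = word xs * (b * c)" for xs
    by (rule tens_eqI[of "\<lambda>b. word xs * b * c" "\<lambda>b. word xs * (b * c)"]) (rule lin 2)+
  show "a * b * c = a * (b * c)"
    by (rule tens_eqI[of "\<lambda>a. a * b * c" "\<lambda>a. a * (b * c)"]) (rule lin 3)+
  show "1 * a = a"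
    by (rule tens_eqI[of "\<lambda>a. 1 * a" "\<lambda>a. a"]) (simp_all add: linear_mult_right linear_ident one_tens_def word_mult)
  show "a * 1 = a"
    by (rule tens_eqI[of "\<lambda>a. a * 1" "\<lambda>a. a"]) (simp_all add: linear_mult_left linear_ident one_tens_def word_mult)
  show "(a + b) * c = a * c + b * c" by (rule linear_add[OF linear_mult_left])
  show "a * (b + c) = a * b + a * c" by (rule linear_add[OF linear_mult_right])
  show "r *\<^sub>R a * b = r *\<^sub>R (a * b)" by (rule linear_cmul[OF linear_mult_left])
  show "a * r *\<^sub>R b = r *\<^sub>R (a * b)" by (rule linear_cmul[OF linear_mult_right])
  have M: "multilinear (\<lambda>xs :: 'a list. if xs = [] then 1 else 0 :: real)"
    by (simp add: multilinear_def linear_iff)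
  have "counit (1 :: 'a tens) = 1" "counit (0 :: 'a tens) = 0"
    unfolding counit_def one_tens_def tens_lift_word[OF M] linear_0[OF linear_tens_lift[OF M]] by auto
  then show "(0 :: 'a tens) \<noteq> 1" by auto
qed

end

section \<open>Graded vector spaces and graded algebras\<close>

text \<open>A graded vector space is the internal direct sum of a family of subspaces.\<close>

definition graded_space :: "(int \<Rightarrow> 'v::real_vector set) \<Rightarrow> bool" where
  "graded_space G \<longleftrightarrow> (\<forall>i. subspace (G i)) \<and>
     (\<forall>I x. finite I \<longrightarrow> (\<forall>i\<in>I. x i \<in> G i) \<longrightarrow> (\<Sum>i\<in>I. x i) = 0 \<longrightarrow> (\<forall>i\<in>I. x i = 0))"

definition total :: "(int \<Rightarrow> 'v::real_vector set) \<Rightarrow> 'v set" where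
  "total G = span (\<Union>i. G i)"

definition in_degree :: "int \<Rightarrow> 'v::real_vector set \<Rightarrow> int \<Rightarrow> 'v set" where
  "in_degree d C = (\<lambda>i. if i = d then C else {0})"

definition shift1 :: "(int \<Rightarrow> 'v set) \<Rightarrow> int \<Rightarrow> 'v set" where
  "shift1 G = (\<lambda>i. G (i + 1))"

definition tensor_grading ::
    "(int \<Rightarrow> 'a::real_vector set) \<Rightarrow> (int \<Rightarrow> 'b::real_vector set) \<Rightarrow> int \<Rightarrow> ('a, 'b) tensor set" where
  "tensor_grading G H n = span {x \<otimes> y | x y i j. x \<in> G i \<and> y \<in> H j \<and> i + j = n}"

definition tens_grading :: "(int \<Rightarrow> 'a::real_vector set) \<Rightarrow> int \<Rightarrow> 'a tens set" where
  "tens_grading G n = span {word xs | xs ds. list_all2 (\<lambda>x d. x \<in> G d) xs ds \<and> sum_list ds = n}"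

definition sign :: "int \<Rightarrow> real" where
  "sign n = (if even n then 1 else -1)"

text \<open>The linear map acting on degree \<open>i\<close> as the scalar \<open>(-1)^i\<close>; for a graded space it exists and is
  determined on the total space. By the Koszul rule the tensor product
  of the identity with a map \<open>d\<close> of odd degree is \<open>tensor_map (koszul G) d\<close>.\<close>

definition koszul :: "(int \<Rightarrow> 'v::real_vector set) \<Rightarrow> 'v \<Rightarrow> 'v" where
  "koszul G = (SOME f. linear f \<and> (\<forall>i. \<forall>x\<in>G i. f x = sign i *\<^sub>R x))"

record 'a galg =
  homog :: "int \<Rightarrow> 'a set"
  gmult :: "'a \<Rightarrow> 'a \<Rightarrow> 'a"
  gone :: 'a

text \<open>The graded symmetric algebra: the tensor algebra modulo the two-sided ideal generated by the
  graded commutators.\<close>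

definition sym_ideal :: "(int \<Rightarrow> 'v::real_vector set) \<Rightarrow> 'v tens set" where
  "sym_ideal G = span {s * (word [v, w] - sign (i * j) *\<^sub>R word [w, v]) * t | s t v w i j.
     s \<in> total (tens_grading G) \<and> t \<in> total (tens_grading G) \<and> v \<in> G i \<and> w \<in> G j}"

definition Sym :: "(int \<Rightarrow> 'v::real_vector set) \<Rightarrow> 'v tens galg" where
  "Sym G = \<lparr>homog = (\<lambda>n. quot (sym_ideal G) ` tens_grading G n),
            gmult = (\<lambda>a b. quot (sym_ideal G) (a * b)),
            gone = quot (sym_ideal G) 1\<rparr>"

definition sym_gen :: "(int \<Rightarrow> 'v::real_vector set) \<Rightarrow> 'v \<Rightarrow> 'v tens" where
  "sym_gen G v = quot (sym_ideal G) (word [v])"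

text \<open>\<open>SymAlg C\<close> is \<open>S(C)\<close> with generators of degree 0, \<open>ExtAlg C\<close> is the exterior algebra \<open>S(C[-1])\<close>.\<close>

abbreviation "SymAlg C \<equiv> Sym (in_degree 0 C)"
abbreviation "ExtAlg C \<equiv> Sym (in_degree 1 C)"

text \<open>Tensor product of graded algebras. The Koszul sign \<open>(-1)^(|b||a'|)\<close> in
  \<open>(a \<otimes> b)(a' \<otimes> b')\<close> is omitted: here the first factor is always concentrated in degree 0.\<close>

definition galg_tensor ::
    "'a::real_vector galg \<Rightarrow> 'b::real_vector galg \<Rightarrow> ('a, 'b) tensor galg" where
  "galg_tensor P Q = \<lparr>homog = tensor_grading (homog P) (homog Q),
     gmult = (\<lambda>s t. tensor_lift (\<lambda>a b. tensor_lift (\<lambda>a' b'. gmult P a a' \<otimes> gmult Q b b') t) s),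
     gone = gone P \<otimes> gone Q\<rparr>"

section \<open>A-infinity algebras and bimodules\<close>

text \<open>Codifferentials are linear maps on the ambient tensor (co)algebras, but only their restrictions
  to \<open>T(A[1])\<close> and \<open>T(A[1]) \<otimes> K[1] \<otimes> T(B[1])\<close> are constrained or used; every linear map on these
  subspaces is such a restriction. Elements of \<open>A\<close>, \<open>B\<close>, \<open>K\<close> are identified with their
  suspensions.\<close>

definition ainf_structure :: "(int \<Rightarrow> 'a::real_vector set) \<Rightarrow> ('a tens \<Rightarrow> 'a tens) \<Rightarrow> bool" where
  "ainf_structure A d \<longleftrightarrow>
     (let T = tens_grading (shift1 A) in
        graded_space A \<and> linear d
      \<and> (\<forall>n. d ` T n \<subseteq> T (n + 1))
      \<and> (\<forall>x\<in>total T. comult (d x) = tensor_map d id (comult x) + tensor_map (koszul T) d (comult x))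
      \<and> (\<forall>x\<in>total T. d (d x) = 0)
      \<and> (\<forall>x\<in>total T. counit (d x) = 0))"

definition taylor :: "('a::real_vector tens \<Rightarrow> 'a tens) \<Rightarrow> 'a list \<Rightarrow> 'a" where
  "taylor d as = proj1 (d (word as))"

text \<open>A graded associative algebra viewed as an A-infinity algebra. With \<open>s: A \<rightarrow> A[1]\<close> the
  suspension and \<open>\<mu>\<close> the product, the component \<open>d\<^sup>2\<close> is \<open>s \<circ> \<mu> \<circ> (s\<^sup>-\<^sup>1 \<otimes> s\<^sup>-\<^sup>1)\<close>; the Koszul rule gives the
  sign \<open>(-1)^(|a| - 1)\<close>. These conditions determine \<open>d\<close> on \<open>T(A[1])\<close>.\<close>

definition ainf_of_algebra :: "'a::real_vector galg \<Rightarrow> ('a tens \<Rightarrow> 'a tens) \<Rightarrow> bool" where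
  "ainf_of_algebra A d \<longleftrightarrow> ainf_structure (homog A) d
     \<and> (\<forall>as. set as \<subseteq> total (homog A) \<longrightarrow> length as \<noteq> 2 \<longrightarrow> taylor d as = 0)
     \<and> (\<forall>i. \<forall>a\<in>homog A i. \<forall>b\<in>total (homog A). taylor d [a, b] = sign (i - 1) *\<^sub>R gmult A a b)"

type_synonym ('a, 'k, 'b) bitens = "('a tens, ('k, 'b tens) tensor) tensor"

definition left_coaction ::
    "('a::real_vector, 'k::real_vector, 'b::real_vector) bitens \<Rightarrow> ('a tens, ('a, 'k, 'b) bitens) tensor"
  where "left_coaction x = assoc_right (tensor_map comult id x)"

definition right_coaction ::
    "('a::real_vector, 'k::real_vector, 'b::real_vector) bitens \<Rightarrow> (('a, 'k, 'b) bitens, 'b tens) tensor"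
  where "right_coaction x = assoc_left (tensor_map id (\<lambda>m. assoc_left (tensor_map id comult m)) x)"

definition ainf_bimodule_structure ::
    "(int \<Rightarrow> 'a::real_vector set) \<Rightarrow> ('a tens \<Rightarrow> 'a tens) \<Rightarrow>
     (int \<Rightarrow> 'b::real_vector set) \<Rightarrow> ('b tens \<Rightarrow> 'b tens) \<Rightarrow>
     (int \<Rightarrow> 'k::real_vector set) \<Rightarrow> (('a, 'k, 'b) bitens \<Rightarrow> ('a, 'k, 'b) bitens) \<Rightarrow> bool" where
  "ainf_bimodule_structure A dA B dB K d \<longleftrightarrow>
     (let TA = tens_grading (shift1 A); TB = tens_grading (shift1 B);
          M = tensor_grading TA (tensor_grading (shift1 K) TB) in
        ainf_structure A dA \<and> ainf_structure B dB \<and> graded_space K \<and> linear d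
      \<and> (\<forall>n. d ` M n \<subseteq> M (n + 1))
      \<and> (\<forall>x\<in>total M. left_coaction (d x) =
            tensor_map dA id (left_coaction x) + tensor_map (koszul TA) d (left_coaction x))
      \<and> (\<forall>x\<in>total M. right_coaction (d x) =
            tensor_map d id (right_coaction x) + tensor_map (koszul M) dB (right_coaction x))
      \<and> (\<forall>x\<in>total M. d (d x) = 0))"

text \<open>The structure maps \<open>d\<^sup>j\<^sup>,\<^sup>l\<close>, with \<open>j = length as\<close> and \<open>l = length bs\<close>.\<close>

definition bitaylor ::
    "(('a::real_vector, 'k::real_vector, 'b::real_vector) bitens \<Rightarrow> ('a, 'k, 'b) bitens) \<Rightarrow>
     'a list \<Rightarrow> 'k \<Rightarrow> 'b list \<Rightarrow> 'k" where
  "bitaylor d as k bs =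
     tensor_lift (\<lambda>x m. counit x *\<^sub>R tensor_lift (\<lambda>k y. counit y *\<^sub>R k) m) (d (word as \<otimes> (k \<otimes> word bs)))"

section \<open>The algebras attached to a linear subspace\<close>

text \<open>Here \<open>X\<close> is the whole type. \<open>brane_alg U\<close> is \<open>S(U\<^sup>*) \<otimes> \<Lambda>(X/U)\<close>, \<open>brane_space U V\<close> is
  \<open>S((U \<inter> V)\<^sup>*) \<otimes> \<Lambda>(X/(U + V))\<close>, and \<open>brane_gen U\<close> is the inclusion of the generators
  \<open>U\<^sup>* \<oplus> (X/U)[-1]\<close> into \<open>brane_alg U\<close>.\<close>

definition brane_alg :: "'x::real_vector set \<Rightarrow> (('x \<Rightarrow> real) tens, 'x tens) tensor galg" where
  "brane_alg U = galg_tensor (SymAlg (dual U)) (ExtAlg (range (quot U)))"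

definition brane_space ::
    "'x::real_vector set \<Rightarrow> 'x set \<Rightarrow> int \<Rightarrow> (('x \<Rightarrow> real) tens, 'x tens) tensor set" where
  "brane_space U V = homog (galg_tensor (SymAlg (dual (U \<inter> V)))
                                        (ExtAlg (range (quot {x + y | x y. x \<in> U \<and> y \<in> V}))))"

definition brane_gen ::
    "'x::real_vector set \<Rightarrow> ('x \<Rightarrow> real) \<times> 'x \<Rightarrow> (('x \<Rightarrow> real) tens, 'x tens) tensor" where
  "brane_gen U = (\<lambda>(f, q). sym_gen (in_degree 0 (dual U)) f \<otimes> gone (ExtAlg (range (quot U)))
                         + gone (SymAlg (dual U)) \<otimes> sym_gen (in_degree 1 (range (quot U))) q)"

end

theory Submission
  imports Defs
begin

text \<open>
  Let \<open>(M, d)\<close> be a dg \<open>A\<close>-\<open>B\<close>-bimodule with strictly associative, commuting actions, and let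
  \<open>i : K \<rightarrow> M\<close>, \<open>p : M \<rightarrow> K\<close>, \<open>h : M \<rightarrow> M\<close> satisfy \<open>d h + h d = i p - 1\<close>, \<open>d i = 0\<close>, \<open>p d = 0\<close>. Homotopy transfer
  yields an \<open>A\<^sub>\<infinity>\<close>-structure on \<open>K\<close>: put \<open>\<psi> = i\<close> on the empty words, \<open>\<psi> = h \<theta>\<close> otherwise, where
  \<open>\<theta>(a\<^sub>1\<dots>a\<^sub>j | \<kappa> | b\<^sub>1\<dots>b\<^sub>l) = a\<^sub>1 \<psi>(a\<^sub>2\<dots>a\<^sub>j | \<kappa> | b\<^sub>1\<dots>b\<^sub>l) \<plusminus> \<psi>(a\<^sub>1\<dots>a\<^sub>j | \<kappa> | b\<^sub>1\<dots>b\<^sub>l\<^sub>-\<^sub>1) b\<^sub>l\<close>. The structure maps are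
  \<open>p \<theta>\<close>, and \<open>\<psi>\<close> is a morphism of \<open>A\<^sub>\<infinity>\<close>-bimodules from \<open>K\<close> to \<open>M\<close>.

  Choose \<open>w\<^sub>1, \<dots>, w\<^sub>n\<close> representing bases of \<open>U/(U \<inter> V)\<close> and \<open>V/(U \<inter> V)\<close>. For \<open>M\<close> take the Koszul complex
  \<open>\<real>[[x\<^sub>1, \<dots>, x\<^sub>n]] \<otimes> \<Lambda>(\<eta>\<^sub>1, \<dots>, \<eta>\<^sub>n) \<otimes> K\<close> with \<open>d = \<Sum> x\<^sub>i \<partial>/\<partial>\<eta>\<^sub>i\<close>; the operator \<open>s = \<Sum> \<eta>\<^sub>i \<partial>/\<partial>x\<^sub>i\<close> has
  \<open>d s + s d = N\<close>, the total weight, so \<open>h = - N\<^sup>-\<^sup>1 s\<close> contracts \<open>M\<close> to \<open>K\<close>. In \<open>A\<close> and in \<open>B\<close>, functionals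
  act by multiplication with the \<open>x\<^sub>i\<close> and exterior generators by the \<open>\<partial>/\<partial>\<eta>\<^sub>i\<close>; then \<open>d\<^sup>1\<^sup>,\<^sup>1\<close> reduces to
  \<open>\<partial>/\<partial>\<eta>\<^sub>i (\<eta>\<^sub>j \<kappa>) = \<delta>\<^sub>i\<^sub>j \<kappa>\<close>. Only this component is prescribed, so \<open>K\<close> may serve as a mere multiplicity space, on
  which \<open>(U \<inter> V)\<^sup>*\<close> and \<open>X/(U + V)\<close> act by zero.
\<close>

section \<open>Linear maps on tensor products\<close>

text \<open>In a strict bimodule only one letter acts at a time, so
  \<open>d\<^sup>1\<^sup>,\<^sup>1\<close> vanishes; the pairing has to come from a homotopy placed
  between an action of A and one of B. In the Koszul complex it does: \<open>h\<close> turns x_j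
  into -\<eta>_j, and a derivative by \<eta>_i then returns a scalar. The actions use only x_i and
  the derivatives by \<eta>_i, since these commute or anticommute with \<open>d\<close>, while
  multiplication by \<eta>_i does not. Power series need no finiteness condition: N acts on each
  coefficient by a number, and is inverted there. The definitions constrain maps only on graded
  subspaces and use a sign operator chosen by \<open>SOME\<close>, whereas inductions over words run
  through the whole type. Explicit sign operators and a linear projection onto the total space make
  the identities of the bar construction hold everywhere; they are compared with the chosen
  operators only on homogeneous words. The codifferential is not squared directly: its square is a
  twisted morphism of cofree bicomodules, hence determined by its component in K, where
  \<open>p d = 0\<close> ends the computation.\<close>

lemma linear_free_lift_param:
  assumes "\<And>b. linear (\<lambda>z. h z b)"
  shows "linear (\<lambda>z. free_lift (h z) p)"
  unfolding free_lift_def by (intro linear_compose_sum linear_compose_scale_right assms ballI)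

text \<open>\<open>tensor_lift\<close> evaluates on one chosen representative of \<open>t\<close>,
  which is the same for all \<open>z\<close>; linearity in the parameter is thus that of a fixed
  finite sum.\<close>

lemma linear_tensor_lift_param:
  assumes "\<And>x y. linear (\<lambda>z. h z x y)"
  shows "linear (\<lambda>z. tensor_lift (h z) t)"
  unfolding tensor_lift_def by (intro linear_free_lift_param) (use assms in \<open>auto split: prod.splits\<close>)

lemma linear_tens_lift_param:
  assumes "\<And>xs. linear (\<lambda>z. h z xs)"
  shows "linear (\<lambda>z. tens_lift (h z) t)"
  unfolding tens_lift_def by (intro linear_free_lift_param assms)

lemma linear_id_map: "linear (id :: 'a::real_vector \<Rightarrow> 'a)"
  by (rule linear_id)

lemma linear_tensor_map: "linear f \<Longrightarrow> linear g \<Longrightarrow> linear (tensor_map f g)"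
  unfolding tensor_map_def by (intro linear_tensor_lift bilinear_pure)

lemma linear_pure_left: "linear (\<lambda>x. x \<otimes> y)"
  and linear_pure_right: "linear (\<lambda>y. x \<otimes> y)"
  by (simp_all add: linear_iff tensor_simps)

lemma tensor_zero [simp]: "0 \<otimes> y = 0" "x \<otimes> 0 = 0"
  using linear_0[OF linear_pure_left] linear_0[OF linear_pure_right] by auto

lemma tensor_neg: "(- x) \<otimes> y = - (x \<otimes> y)" "x \<otimes> (- y) = - (x \<otimes> y)"
  using linear_neg[OF linear_pure_left] linear_neg[OF linear_pure_right] by auto

lemma tensor_sum:
  "sum f I \<otimes> y = (\<Sum>i\<in>I. f i \<otimes> y)" "x \<otimes> sum g I = (\<Sum>i\<in>I. x \<otimes> g i)"
  using linear_sum[OF linear_pure_left] linear_sum[OF linear_pure_right] by auto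

lemma linear_assoc_right: "linear assoc_right"
  unfolding assoc_right_def
proof (rule linear_tensor_lift)
  show "bilinear (\<lambda>t z. tensor_lift (\<lambda>x y. x \<otimes> y \<otimes> z) t)"
    unfolding bilinear_def
    by (intro conjI allI linear_tensor_lift linear_tensor_lift_param)
      (simp_all add: bilinear_def linear_iff tensor_simps)
qed

lemma linear_assoc_left: "linear assoc_left"
  unfolding assoc_left_def
proof (rule linear_tensor_lift)
  show "bilinear (\<lambda>x t. tensor_lift (\<lambda>y z. (x \<otimes> y) \<otimes> z) t)"
    unfolding bilinear_def
    by (intro conjI allI linear_tensor_lift linear_tensor_lift_param)
      (simp_all add: bilinear_def linear_iff tensor_simps)
qed

lemma linear_comp: "linear f \<Longrightarrow> linear g \<Longrightarrow> linear (\<lambda>x. g (f x))"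
  by (rule linear_compose[unfolded o_def])

lemma tensor_map_comp:
  assumes "linear f" "linear g" "linear f'" "linear g'"
  shows "tensor_map f' g' (tensor_map f g t) = tensor_map (\<lambda>x. f' (f x)) (\<lambda>y. g' (g y)) t"
  by (rule tensor_eqI[of "\<lambda>t. tensor_map f' g' (tensor_map f g t)"])
    (use assms in \<open>simp_all add: linear_comp linear_tensor_map\<close>)

lemma tensor_map_add_left:
  assumes "linear f" "linear f'" "linear g"
  shows "tensor_map (\<lambda>x. f x + f' x) g t = tensor_map f g t + tensor_map f' g t"
  by (rule tensor_eqI[of _ "\<lambda>t. tensor_map f g t + tensor_map f' g t"])
    (use assms in \<open>simp_all add: linear_compose_add linear_tensor_map tensor_simps\<close>)

lemma tensor_map_add_right:
  assumes "linear f" "linear g" "linear g'"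
  shows "tensor_map f (\<lambda>x. g x + g' x) t = tensor_map f g t + tensor_map f g' t"
  by (rule tensor_eqI[of _ "\<lambda>t. tensor_map f g t + tensor_map f g' t"])
    (use assms in \<open>simp_all add: linear_compose_add linear_tensor_map tensor_simps\<close>)

lemma tensor_map_zero: "linear f \<Longrightarrow> tensor_map f (\<lambda>_. 0) t = 0" "linear g \<Longrightarrow> tensor_map (\<lambda>_. 0) g u = 0"
  by (rule tensor_eqI[of _ "\<lambda>_. 0"]; simp add: linear_tensor_map linear_zero)+

section \<open>The tensor coalgebra\<close>

lemma multilinear_Cons:
  assumes "\<And>vs. linear (\<lambda>x. h (x # vs))" "\<And>u. multilinear (\<lambda>xs. h (u # xs))"
  shows "multilinear h"
  unfolding multilinear_def
proof (intro allI)
  fix us vs show "linear (\<lambda>x. h (us @ x # vs))"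
    by (cases us) (use assms in \<open>auto simp: multilinear_def\<close>)
qed

lemma multilinear_snoc:
  assumes "\<And>us. linear (\<lambda>x. h (us @ [x]))" "\<And>v. multilinear (\<lambda>xs. h (xs @ [v]))"
  shows "multilinear h"
  unfolding multilinear_def
proof (intro allI)
  fix us vs show "linear (\<lambda>x. h (us @ x # vs))"
    by (cases vs rule: rev_cases) (use assms in \<open>auto simp: multilinear_def\<close>)
qed

lemma linear_word: "linear (\<lambda>x. word (us @ x # vs))"
  using word_multilinear unfolding multilinear_def by blast

lemma linear_word_Cons: "linear (\<lambda>x. word (x # vs))"
  using linear_word[of "[]"] by simp

lemma word_Cons: "word (a # xs) = word [a] * word xs"
  by (simp add: word_mult)

lemma word_snoc: "word (xs @ [a]) = word xs * word [a]"
  by (simp add: word_mult)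

text \<open>\<open>comult\<close> and \<open>bar\<close> are both recursive in the first letter, so
  identities between them are proved by prepending letters to the unit.\<close>

lemma tens_induct_linear:
  assumes "linear f" "linear g" "f 1 = g 1" "\<And>a xs. f (word xs) = g (word xs) \<Longrightarrow> f (word [a] * word xs) = g (word [a] * word xs)"
  shows "f t = g t"
proof (rule tens_eqI[OF assms(1,2)])
  fix xs show "f (word xs) = g (word xs)"
    by (induction xs) (use assms(3,4) in \<open>auto simp: one_tens_def word_mult\<close>)
qed

lemma linear_counit: "linear counit"
  unfolding counit_def by (rule linear_tens_lift) (simp add: multilinear_def linear_zero)

lemma linear_proj1: "linear proj1"
  unfolding proj1_def
  by (rule linear_tens_lift) (auto simp: multilinear_def linear_iff split: list.splits simp: append_eq_Cons_conv)

lemma linear_take_drop: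
  "linear (\<lambda>x. word (take i (us @ x # vs)) \<otimes> word (drop i (us @ x # vs)))"
proof (cases "i \<le> length us")
  case True
  then show ?thesis
    using linear_comp[OF linear_word linear_pure_right] by simp
next
  case False
  then obtain k where "i - length us = Suc k" by (metis Suc_diff_Suc not_le)
  then show ?thesis
    using linear_comp[OF linear_word linear_pure_left, of us "take k vs"] by simp
qed

lemma linear_comult: "linear comult"
  unfolding comult_def
  by (rule linear_tens_lift)
    (simp del: sum.atMost_Suc take_append drop_append add: multilinear_def linear_compose_sum linear_take_drop)

lemma comult_one: "comult 1 = 1 \<otimes> 1"
  by (simp add: one_tens_def comult_word)

text \<open>A cut of a word falls before its first letter, or after it, in which case the letter
  joins the left part. The coalgebra identities below rest on this recursion and its mirror
  image.\<close>

lemma comult_Cons: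
  "comult (word [a] * x) = 1 \<otimes> (word [a] * x) + tensor_map (\<lambda>y. word [a] * y) id (comult x)"
proof (rule tens_eqI[of "\<lambda>x. comult (word [a] * x)"])
  fix xs
  show "comult (word [a] * word xs) = 1 \<otimes> (word [a] * word xs) + tensor_map (\<lambda>y. word [a] * y) id (comult (word xs))"
    by (simp add: word_mult comult_word sum.atMost_Suc_shift one_tens_def linear_mult_right
        linear_sum[OF linear_tensor_map] linear_id_map del: sum.atMost_Suc)
qed (intro linear_comp[OF linear_mult_right] linear_comult linear_compose_add linear_pure_right linear_tensor_map
    linear_mult_right linear_id_map linear_comp[OF linear_comult])+

lemma comult_snoc:
  "comult (x * word [b]) = (x * word [b]) \<otimes> 1 + tensor_map id (\<lambda>y. y * word [b]) (comult x)"
proof (rule tens_eqI[of "\<lambda>x. comult (x * word [b])"])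
  fix xs
  show "comult (word xs * word [b]) = (word xs * word [b]) \<otimes> 1 + tensor_map id (\<lambda>y. y * word [b]) (comult (word xs))"
    by (simp add: word_mult comult_word one_tens_def linear_mult_left
        linear_sum[OF linear_tensor_map] linear_id_map)
qed (intro linear_comp[OF linear_mult_left] linear_comult linear_compose_add linear_pure_left linear_tensor_map
    linear_mult_left linear_id_map linear_comp[OF linear_comult])+

lemma counit_Cons: "counit (word [a] * x) = 0"
  by (rule tens_eqI[of "\<lambda>x. counit (word [a] * x)" "\<lambda>_. 0"])
    (simp_all add: word_mult linear_comp linear_mult_right linear_counit linear_zero)

lemma counit_snoc: "counit (x * word [a]) = 0"
  by (rule tens_eqI[of "\<lambda>x. counit (x * word [a])" "\<lambda>_. 0"])
    (simp_all add: word_mult linear_comp[OF linear_mult_left] linear_counit linear_zero)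

lemma linear_scaleR_counit: "linear (\<lambda>x. counit x *\<^sub>R a)"
  by (simp add: linear_iff linear_add[OF linear_counit] linear_cmul[OF linear_counit] scaleR_add_left)

lemma proj1_Cons: "proj1 (word [a] * x) = counit x *\<^sub>R a"
  by (rule tens_eqI[of "\<lambda>x. proj1 (word [a] * x)" "\<lambda>x. counit x *\<^sub>R a"])
    (auto simp: word_mult proj1_word linear_comp[OF linear_mult_right] linear_proj1 split: list.split
      intro!: linear_scaleR_counit)

section \<open>The bar differential of a suspended product\<close>

definition map_word :: "('a::real_vector \<Rightarrow> 'a) \<Rightarrow> 'a tens \<Rightarrow> 'a tens" where
  "map_word s = tens_lift (\<lambda>xs. word (map s xs))"

definition mult_head :: "('a::real_vector \<Rightarrow> 'a \<Rightarrow> 'a) \<Rightarrow> 'a \<Rightarrow> 'a tens \<Rightarrow> 'a tens" where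
  "mult_head m a = tens_lift (\<lambda>xs. case xs of [] \<Rightarrow> 0 | b # bs \<Rightarrow> word (m a b # bs))"

text \<open>The term by which \<open>bar\<close> changes when a letter \<open>a\<close> is appended:
  the odd product passes all earlier letters, hence \<open>map s\<close>.\<close>

definition mult_last ::
    "('a::real_vector \<Rightarrow> 'a) \<Rightarrow> ('a \<Rightarrow> 'a \<Rightarrow> 'a) \<Rightarrow> 'a \<Rightarrow> 'a tens \<Rightarrow> 'a tens" where
  "mult_last s m a = tens_lift (\<lambda>xs. if xs = [] then 0 else word (map s (butlast xs) @ [m (last xs) a]))"

text \<open>The bar differential: each pair of neighbours is multiplied once, with \<open>s\<close>
  applied to the letters before the pair.\<close>

fun bar_word :: "('a::real_vector \<Rightarrow> 'a) \<Rightarrow> ('a \<Rightarrow> 'a \<Rightarrow> 'a) \<Rightarrow> 'a list \<Rightarrow> 'a tens" where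
  "bar_word s m [] = 0"
| "bar_word s m (a # as) = word [s a] * bar_word s m as + mult_head m a (word as)"

definition bar :: "('a::real_vector \<Rightarrow> 'a) \<Rightarrow> ('a \<Rightarrow> 'a \<Rightarrow> 'a) \<Rightarrow> 'a tens \<Rightarrow> 'a tens" where
  "bar s m = tens_lift (bar_word s m)"

text \<open>\<open>s\<close> models the sign operator of the shifted grading and \<open>m\<close>
  the suspended product. \<open>s_m\<close> says that \<open>m\<close> is odd;
  \<open>m_assoc\<close> is associativity after suspension, that is, the vanishing of the square of
  \<open>bar s m\<close> on words of length three.\<close>

locale bar_algebra =
  fixes s :: "'a::real_vector \<Rightarrow> 'a" and m :: "'a \<Rightarrow> 'a \<Rightarrow> 'a"
  assumes linear_s: "linear s" and bilinear_m: "bilinear m"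
    and s_m: "s (m a b) = - m (s a) (s b)"
    and m_assoc: "m (m a b) c + m (s a) (m b c) = 0"
begin

lemma multilinear_map_word: "multilinear (\<lambda>xs. word (map s xs))"
  by (auto simp: multilinear_def intro!: linear_comp[OF linear_s linear_word])

lemma linear_map_word: "linear (map_word s)"
  unfolding map_word_def by (rule linear_tens_lift[OF multilinear_map_word])

lemma map_word_word [simp]: "map_word s (word xs) = word (map s xs)"
  unfolding map_word_def by (rule tens_lift_word[OF multilinear_map_word])

lemma map_word_one [simp]: "map_word s 1 = 1"
  by (simp add: one_tens_def)

lemma map_word_mult: "map_word s (x * y) = map_word s x * map_word s y"
proof -
  have 1: "map_word s (word xs * y) = word (map s xs) * map_word s y" for xs
    by (rule tens_eqI[of "\<lambda>y. map_word s (word xs * y)"])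
      (simp_all add: word_mult linear_comp[OF linear_mult_right] linear_comp[OF _ linear_mult_right] linear_map_word)
  show ?thesis
    by (rule tens_eqI[of "\<lambda>x. map_word s (x * y)"])
      (simp_all add: 1 linear_comp[OF linear_mult_left] linear_comp[OF _ linear_mult_left] linear_map_word)
qed

lemma linear_m: "linear (m a)" "linear (\<lambda>a. m a b)"
  using bilinear_m by (auto simp: bilinear_def)

lemma multilinear_mult_head: "multilinear (\<lambda>xs. case xs of [] \<Rightarrow> 0 | b # bs \<Rightarrow> word (m a b # bs))"
proof (rule multilinear_Cons)
  show "multilinear (\<lambda>xs. case u # xs of [] \<Rightarrow> 0 | b # bs \<Rightarrow> word (m a b # bs))" for u
    using linear_word[of "m a u # us" for us] by (simp add: multilinear_def)
qed (simp add: linear_comp[OF linear_m(1) linear_word_Cons])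

lemma multilinear_mult_last:
  "multilinear (\<lambda>xs. if xs = [] then 0 else word (map s (butlast xs) @ [m (last xs) a]))"
proof (rule multilinear_snoc)
  show "multilinear (\<lambda>xs. if xs @ [v] = [] then 0 else word (map s (butlast (xs @ [v])) @ [m (last (xs @ [v])) a]))" for v
    using linear_comp[OF linear_s linear_word[of _ "vs @ [m v a]" for vs]] by (simp add: multilinear_def)
qed (simp add: linear_comp[OF linear_m(2) linear_word])

lemma linear_mult_head: "linear (mult_head m a)"
  unfolding mult_head_def by (rule linear_tens_lift[OF multilinear_mult_head])

lemma linear_mult_head_left: "linear (\<lambda>a. mult_head m a t)"
  unfolding mult_head_def
proof (rule linear_tens_lift_param)
  show "linear (\<lambda>a. case xs of [] \<Rightarrow> 0 | b # bs \<Rightarrow> word (m a b # bs))" for xs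
    by (cases xs) (simp_all add: linear_zero linear_comp[OF linear_m(2) linear_word_Cons])
qed

lemma linear_mult_last: "linear (mult_last s m a)"
  unfolding mult_last_def by (rule linear_tens_lift[OF multilinear_mult_last])

lemma mult_head_word: "mult_head m a (word xs) = (case xs of [] \<Rightarrow> 0 | b # bs \<Rightarrow> word (m a b # bs))"
  unfolding mult_head_def by (rule tens_lift_word[OF multilinear_mult_head])

lemma mult_last_word:
  "mult_last s m a (word xs) = (if xs = [] then 0 else word (map s (butlast xs) @ [m (last xs) a]))"
  unfolding mult_last_def by (rule tens_lift_word[OF multilinear_mult_last])

lemma mult_head_one [simp]: "mult_head m a 1 = 0" and mult_last_one [simp]: "mult_last s m a 1 = 0"
  by (simp_all add: one_tens_def mult_head_word mult_last_word)

lemma mult_head_Cons: "mult_head m a (word [b] * x) = word [m a b] * x"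
  by (rule tens_eqI[of "\<lambda>x. mult_head m a (word [b] * x)"])
    (simp_all add: word_mult mult_head_word linear_comp[OF linear_mult_right] linear_mult_head linear_mult_right)

lemma mult_last_snoc: "mult_last s m a (x * word [b]) = map_word s x * word [m b a]"
  by (rule tens_eqI[of "\<lambda>x. mult_last s m a (x * word [b])"])
    (simp_all add: word_mult mult_last_word linear_comp[OF linear_mult_left] linear_comp[OF _ linear_mult_left]
      linear_mult_last linear_map_word)

lemma multilinear_bar_word: "multilinear (bar_word s m)"
proof -
  have "linear (\<lambda>x. bar_word s m (us @ x # vs))" for us vs
  proof (induction us)
    case Nil
    show ?case
      by (auto intro!: linear_compose_add linear_mult_head_left linear_comp[OF linear_s]
          linear_comp[OF linear_word_Cons linear_mult_left])
  next
    case (Cons u us)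
    then show ?case
      by (auto intro!: linear_compose_add linear_comp[OF linear_word linear_mult_head]
          linear_comp[OF _ linear_mult_right])
  qed
  then show ?thesis by (simp add: multilinear_def)
qed

lemma linear_bar: "linear (bar s m)"
  unfolding bar_def by (rule linear_tens_lift[OF multilinear_bar_word])

lemma bar_word: "bar s m (word xs) = bar_word s m xs"
  unfolding bar_def by (rule tens_lift_word[OF multilinear_bar_word])

lemma bar_one [simp]: "bar s m 1 = 0"
  by (simp add: one_tens_def bar_word)

lemma bar_Cons: "bar s m (word [a] * x) = word [s a] * bar s m x + mult_head m a x"
  by (rule tens_eqI[of "\<lambda>x. bar s m (word [a] * x)"])
    (simp_all add: word_mult bar_word linear_comp[OF linear_mult_right] linear_comp[OF _ linear_mult_right]
      linear_mult_head linear_bar linear_compose_add)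

lemma map_word_bar: "map_word s (bar s m x) = - bar s m (map_word s x)"
proof (rule tens_eqI[of "\<lambda>x. map_word s (bar s m x)"])
  fix xs
  show "map_word s (bar s m (word xs)) = - bar s m (map_word s (word xs))"
  proof (induction xs)
    case Nil
    show ?case by (simp add: bar_word linear_0[OF linear_map_word])
  next
    case (Cons a xs)
    have "map_word s (mult_head m a (word xs)) = - mult_head m (s a) (word (map s xs))"
      by (auto simp: mult_head_word linear_0[OF linear_map_word] s_m linear_neg[OF linear_word_Cons] split: list.split)
    with Cons show ?case
      by (simp add: bar_word linear_add[OF linear_map_word] map_word_mult)
  qed
qed (intro linear_comp[OF linear_bar linear_map_word] linear_compose_neg linear_comp[OF linear_map_word linear_bar])+

lemma bar_bar: "bar s m (bar s m x) = 0"
proof (rule tens_eqI[of "\<lambda>x. bar s m (bar s m x)" "\<lambda>_. 0"])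
  fix xs
  show "bar s m (bar s m (word xs)) = 0"
  proof (induction xs rule: induct_list012)
    case 1
    show ?case by (simp add: bar_word linear_0[OF linear_bar])
  next
    case (2 a)
    show ?case by (simp add: bar_word mult_head_word linear_0[OF linear_bar])
  next
    case (3 a b xs)
    let ?d = "bar s m" and ?w = "word xs"
    \<comment> \<open>Both products fall on the first three letters; these terms cancel by
      associativity.\<close>
    have h: "mult_head m (s a) (mult_head m b ?w) + mult_head m (m a b) ?w = 0"
    proof (cases xs)
      case (Cons c ys)
      then show ?thesis
        using linear_add[OF linear_word_Cons[of ys], of "m (s a) (m b c)" "m (m a b) c"] m_assoc[of a b c]
        by (simp add: mult_head_word add.commute linear_0[OF linear_word_Cons])
    qed (simp add: mult_head_word linear_0[OF linear_mult_head])
    \<comment> \<open>One product falls on the first two letters and one further right; these terms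
      cancel because \<open>s\<close> passes the product with a minus sign.\<close>
    have c: "word [s (m a b)] = - word [m (s a) (s b)]"
      by (simp add: s_m linear_neg[OF linear_word_Cons])
    have w: "word (a # b # xs) = word [a] * (word [b] * ?w)" "word (b # xs) = word [b] * ?w"
      by (simp_all add: word_mult)
    have "?d (?d (word [a] * (word [b] * ?w))) =
       word [s (s a)] * ?d (?d (word [b] * ?w)) + mult_head m (s a) (word [s b] * ?d ?w + mult_head m b ?w)
       + (word [s (m a b)] * ?d ?w + mult_head m (m a b) ?w)"
      by (simp add: bar_Cons linear_add[OF linear_bar] mult_head_Cons)
    also have "?d (?d (word [b] * ?w)) = 0" using 3 w by simp
    finally show ?case
      using h by (simp add: w linear_add[OF linear_mult_head] mult_head_Cons c add.assoc)
  qed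
qed (intro linear_comp[OF linear_bar linear_bar] linear_zero)+

lemma comult_mult_head:
  "comult (mult_head m a x) = 1 \<otimes> mult_head m a x + tensor_map (mult_head m a) id (comult x)"
proof (rule tens_eqI[of "\<lambda>x. comult (mult_head m a x)"])
  fix xs :: "'a list"
  show "comult (mult_head m a (word xs)) =
     1 \<otimes> mult_head m a (word xs) + tensor_map (mult_head m a) id (comult (word xs))"
  proof (cases xs)
    case Nil
    then show ?thesis
      by (simp add: one_tens_def[symmetric] linear_0[OF linear_comult] comult_one linear_mult_head linear_id_map)
  next
    case (Cons b ys)
    then show ?thesis
      by (simp add: word_Cons[of _ ys] mult_head_Cons comult_Cons linear_add[OF linear_tensor_map]
          linear_mult_head linear_id_map tensor_map_comp linear_mult_right id_def[symmetric])
  qed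
qed (intro linear_comp[OF linear_mult_head linear_comult] linear_compose_add linear_comp[OF linear_mult_head linear_pure_right]
    linear_tensor_map linear_mult_head linear_id_map linear_comp[OF linear_comult])+

text \<open>Both sides obey the same recursion in the first letter. The Koszul sign appears as the
  explicit \<open>map_word s\<close>, so that the identity holds on the whole type.\<close>

lemma comult_bar:
  "comult (bar s m x) = tensor_map (bar s m) id (comult x) + tensor_map (map_word s) (bar s m) (comult x)"
proof (rule tens_induct_linear[of "\<lambda>x. comult (bar s m x)"])
  let ?d = "bar s m"
  fix a and xs :: "'a list"
  define x where "x = word xs"
  assume "comult (?d (word xs)) = tensor_map ?d id (comult (word xs)) + tensor_map (map_word s) ?d (comult (word xs))"
  then have IH: "comult (?d x) = tensor_map ?d id (comult x) + tensor_map (map_word s) ?d (comult x)"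
    by (simp add: x_def)
  note lin = linear_bar linear_mult_right linear_id_map linear_map_word linear_mult_head
  have "comult (?d (word [a] * x)) = 1 \<otimes> ?d (word [a] * x)
      + tensor_map (\<lambda>y. word [s a] * y) id (tensor_map ?d id (comult x) + tensor_map (map_word s) ?d (comult x))
      + tensor_map (mult_head m a) id (comult x)"
    by (simp add: bar_Cons linear_add[OF linear_comult] comult_Cons comult_mult_head IH tensor_simps)
  also have "\<dots> = tensor_map ?d id (comult (word [a] * x)) + tensor_map (map_word s) ?d (comult (word [a] * x))"
    by (simp add: comult_Cons linear_add[OF linear_tensor_map] lin tensor_map_comp bar_Cons map_word_mult
       tensor_map_add_left linear_comp[OF _ linear_mult_right] id_def[symmetric])
  finally show "comult (?d (word [a] * word xs)) =
     tensor_map ?d id (comult (word [a] * word xs)) + tensor_map (map_word s) ?d (comult (word [a] * word xs))"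
    by (simp add: x_def)
next
  show "comult (bar s m 1) = tensor_map (bar s m) id (comult 1) + tensor_map (map_word s) (bar s m) (comult 1)"
    by (simp add: comult_one linear_0[OF linear_comult] linear_bar linear_id_map linear_map_word)
qed (intro linear_comp[OF linear_bar linear_comult] linear_compose_add linear_comp[OF linear_comult]
    linear_tensor_map linear_id_map linear_bar linear_map_word)+

text \<open>Letters of B are split off at the right end, where this recursion takes the place of
  \<open>bar_Cons\<close>.\<close>

lemma bar_snoc: "bar s m (x * word [b]) = bar s m x * word [b] + mult_last s m b x"
proof (rule tens_induct_linear[of "\<lambda>x. bar s m (x * word [b])"])
  have "word [b] = word [b] * 1" by simp
  then have "bar s m (word [b]) = 0" by (metis bar_Cons bar_one mult_head_one mult_zero_right add_0)
  then show "bar s m (1 * word [b]) = bar s m 1 * word [b] + mult_last s m b 1"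
    by simp
next
  fix a and xs :: "'a list"
  assume IH: "bar s m (word xs * word [b]) = bar s m (word xs) * word [b] + mult_last s m b (word xs)"
  have "word [s a] * mult_last s m b (word xs) + mult_head m a (word xs * word [b])
     = mult_head m a (word xs) * word [b] + mult_last s m b (word [a] * word xs)"
    by (cases xs) (simp_all add: mult_head_word mult_last_word word_mult)
  then show "bar s m (word [a] * word xs * word [b]) =
     bar s m (word [a] * word xs) * word [b] + mult_last s m b (word [a] * word xs)"
    by (simp add: mult.assoc bar_Cons IH distrib_left distrib_right map_word_mult add.assoc)
qed (intro linear_comp[OF linear_mult_left linear_bar] linear_compose_add linear_comp[OF linear_bar linear_mult_left]
    linear_mult_last)+

lemma counit_mult_head: "counit (mult_head m a x) = 0"
  by (rule tens_eqI[of "\<lambda>x. counit (mult_head m a x)" "\<lambda>_. 0"])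
    (auto simp: mult_head_word linear_comp[OF linear_mult_head] linear_counit linear_zero
       linear_0[OF linear_counit] split: list.split)

lemma counit_bar: "counit (bar s m x) = 0"
  by (rule tens_induct_linear[of "\<lambda>x. counit (bar s m x)" "\<lambda>_. 0"])
    (simp_all add: bar_Cons linear_add[OF linear_counit] counit_Cons counit_mult_head linear_comp[OF linear_bar]
       linear_counit linear_zero linear_0[OF linear_counit])

lemma taylor_bar: "taylor (bar s m) xs = (case xs of [a, b] \<Rightarrow> m a b | _ \<Rightarrow> 0)"
proof (cases xs)
  case (Cons a ys)
  then show ?thesis
    by (auto simp: taylor_def word_Cons[of a ys] bar_Cons linear_add[OF linear_proj1] proj1_Cons counit_bar
       mult_head_word proj1_word linear_0[OF linear_proj1] split: list.split)
qed (simp add: taylor_def bar_word linear_0[OF linear_proj1])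

end

section \<open>Bicomodules over tensor coalgebras\<close>

lemma linear_compositions:
  "linear f \<Longrightarrow> linear g \<Longrightarrow> linear u \<Longrightarrow> linear (\<lambda>x. tensor_map f g (u x))"
  "linear u1 \<Longrightarrow> linear (\<lambda>x. u1 x \<otimes> y1)"
  "linear u2 \<Longrightarrow> linear (\<lambda>x. y2 \<otimes> u2 x)"
  "linear v \<Longrightarrow> linear (\<lambda>x. assoc_right (v x))"
  "linear w \<Longrightarrow> linear (\<lambda>x. assoc_left (w x))"
  "linear t \<Longrightarrow> linear (\<lambda>x. comult (t x))"
  "linear t1 \<Longrightarrow> linear (\<lambda>x. t1 x * (r1 :: 'r::real_vector tens))"
  "linear t2 \<Longrightarrow> linear (\<lambda>x. (r2 :: 'r tens) * t2 x)"
  by (rule linear_comp, assumption, intro linear_tensor_map linear_pure_left linear_pure_right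
      linear_assoc_right linear_assoc_left linear_comult linear_mult_left linear_mult_right; assumption)+

lemmas linear_intros = linear_compositions linear_compose_add linear_compose_neg linear_compose_scale_right
  linear_ident linear_id_map linear_zero

lemma bitens_eqI:
  fixes f g :: "('a::real_vector, 'k::real_vector, 'b::real_vector) bitens \<Rightarrow> 'c::real_vector"
  assumes "linear f" "linear g"
    and "\<And>as \<kappa> bs. f (word as \<otimes> (\<kappa> \<otimes> word bs)) = g (word as \<otimes> (\<kappa> \<otimes> word bs))"
  shows "f t = g t"
proof (rule tensor_eqI[OF assms(1,2)])
  fix x and y :: "('k, 'b tens) tensor"
  have 1: "f (word as \<otimes> (\<kappa> \<otimes> z)) = g (word as \<otimes> (\<kappa> \<otimes> z))" for as \<kappa> z
    by (rule tens_eqI[of "\<lambda>z. f (word as \<otimes> (\<kappa> \<otimes> z))"])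
      (intro linear_comp[OF linear_comp[OF linear_pure_right linear_pure_right]] assms)+
  have 2: "f (word as \<otimes> y) = g (word as \<otimes> y)" for as
    by (rule tensor_eqI[of "\<lambda>z. f (word as \<otimes> z)"]) (intro linear_comp[OF linear_pure_right] assms 1)+
  show "f (x \<otimes> y) = g (x \<otimes> y)"
    by (rule tens_eqI[of "\<lambda>z. f (z \<otimes> y)"]) (intro linear_comp[OF linear_pure_left] assms 2)+
qed

definition trilinear :: "('a::real_vector list \<Rightarrow> 'k::real_vector \<Rightarrow> 'b::real_vector list \<Rightarrow> 'c::real_vector) \<Rightarrow> bool" where
  "trilinear h \<longleftrightarrow> (\<forall>\<kappa> bs. multilinear (\<lambda>as. h as \<kappa> bs)) \<and> (\<forall>as bs. linear (\<lambda>\<kappa>. h as \<kappa> bs))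
     \<and> (\<forall>as \<kappa>. multilinear (h as \<kappa>))"

definition tri_lift :: "('a::real_vector list \<Rightarrow> 'k::real_vector \<Rightarrow> 'b::real_vector list \<Rightarrow> 'c::real_vector) \<Rightarrow>
    ('a, 'k, 'b) bitens \<Rightarrow> 'c" where
  "tri_lift h = tensor_lift (\<lambda>x y. tens_lift (\<lambda>as. tensor_lift (\<lambda>\<kappa> z. tens_lift (h as \<kappa>) z) y) x)"

lemma
  assumes "trilinear h"
  shows linear_tri_lift: "linear (tri_lift h)"
    and tri_lift_word: "tri_lift h (word as \<otimes> (\<kappa> \<otimes> word bs)) = h as \<kappa> bs"
proof -
  have h: "\<And>\<kappa> bs. multilinear (\<lambda>as. h as \<kappa> bs)" "\<And>as bs. linear (\<lambda>\<kappa>. h as \<kappa> bs)"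
    "\<And>as \<kappa>. multilinear (h as \<kappa>)"
    using assms by (auto simp: trilinear_def)
  have 1: "bilinear (\<lambda>\<kappa> z. tens_lift (h as \<kappa>) z)" for as
    unfolding bilinear_def by (intro conjI allI linear_tens_lift linear_tens_lift_param h)
  have 2: "multilinear (\<lambda>as. tensor_lift (\<lambda>\<kappa> z. tens_lift (h as \<kappa>) z) y)" for y
    unfolding multilinear_def
    by (intro allI linear_tensor_lift_param linear_tens_lift_param) (use h(1) in \<open>simp add: multilinear_def\<close>)
  have 3: "bilinear (\<lambda>x y. tens_lift (\<lambda>as. tensor_lift (\<lambda>\<kappa> z. tens_lift (h as \<kappa>) z) y) x)"
    unfolding bilinear_def by (intro conjI allI linear_tens_lift linear_tens_lift_param 2 linear_tensor_lift 1)
  show "linear (tri_lift h)"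
    unfolding tri_lift_def by (rule linear_tensor_lift[OF 3])
  show "tri_lift h (word as \<otimes> (\<kappa> \<otimes> word bs)) = h as \<kappa> bs"
    by (simp add: tri_lift_def 1 2 3 h)
qed

lemma multilinear_rev: "multilinear h \<Longrightarrow> multilinear (\<lambda>xs. h (rev xs))"
  by (simp add: multilinear_def)

section \<open>Coactions and the projection onto the cogenerators\<close>

definition co_proj :: "('a::real_vector, 'k::real_vector, 'b::real_vector) bitens \<Rightarrow> 'k" where
  "co_proj = tensor_lift (\<lambda>x m. counit x *\<^sub>R tensor_lift (\<lambda>k y. counit y *\<^sub>R k) m)"

lemma bilinear_counit_right: "bilinear (\<lambda>k y. counit y *\<^sub>R k)"
  by (auto simp: bilinear_def linear_scaleR_counit linear_compose_scale_right linear_ident)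

lemma bilinear_counit_left: "linear f \<Longrightarrow> bilinear (\<lambda>x m. counit x *\<^sub>R f m)"
  by (auto simp: bilinear_def linear_scaleR_counit linear_compose_scale_right linear_ident)

lemma linear_co_proj: "linear co_proj"
  unfolding co_proj_def
  by (intro linear_tensor_lift bilinear_counit_left bilinear_counit_right)

lemma co_proj_pure [simp]: "co_proj (x \<otimes> (k \<otimes> y)) = counit x *\<^sub>R counit y *\<^sub>R k"
  by (simp add: co_proj_def bilinear_counit_left linear_tensor_lift bilinear_counit_right)

lemma bitaylor_eq: "bitaylor d as k bs = co_proj (d (word as \<otimes> (k \<otimes> word bs)))"
  by (simp add: bitaylor_def co_proj_def)

lemma linear_left_coaction: "linear left_coaction"
  unfolding left_coaction_def
  by (intro linear_comp[OF linear_tensor_map linear_assoc_right] linear_comult linear_id_map)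

lemma left_coaction_pure: "left_coaction (x \<otimes> y) = assoc_right (comult x \<otimes> y)"
  by (simp add: left_coaction_def linear_comult linear_id_map)

lemma assoc_right_map_left:
  "linear f \<Longrightarrow> assoc_right (tensor_map f id t \<otimes> y) = tensor_map f id (assoc_right (t \<otimes> y))"
  by (rule tensor_eqI[of "\<lambda>t. assoc_right (tensor_map f id t \<otimes> y)"])
    (intro linear_intros, assumption, intro linear_intros, assumption, simp add: id_def linear_ident)

lemma left_coaction_one: "left_coaction (1 \<otimes> y) = 1 \<otimes> (1 \<otimes> y)"
  by (simp add: left_coaction_pure comult_one)

lemma linear_right_aux: "linear (\<lambda>m. assoc_left (tensor_map id comult m))"
  by (intro linear_comp[OF linear_tensor_map linear_assoc_left] linear_comult linear_id_map)

lemma linear_right_coaction: "linear right_coaction"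
  unfolding right_coaction_def
  by (intro linear_comp[OF linear_tensor_map linear_assoc_left] linear_right_aux linear_id_map)

lemma linear_compositions':
  "linear u \<Longrightarrow> linear (\<lambda>x. left_coaction (u x))"
  "linear v \<Longrightarrow> linear (\<lambda>x. right_coaction (v x))"
  "linear w \<Longrightarrow> linear (\<lambda>x. co_proj (w x))"
  by (rule linear_comp, assumption, rule linear_left_coaction linear_right_coaction linear_co_proj)+

text \<open>Prepending a letter and multiplying into the first letter obey the same rule under
  \<open>comult\<close>; this lifts both to the bicomodule at once.\<close>

lemma left_coaction_map:
  assumes f: "linear f" and "\<And>x. comult (f x) = 1 \<otimes> f x + tensor_map f id (comult x)"
  shows "left_coaction (tensor_map f id x) = 1 \<otimes> tensor_map f id x + tensor_map f id (left_coaction x)"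
  by (rule tensor_eqI[of "\<lambda>x. left_coaction (tensor_map f id x)"])
    (intro linear_intros linear_compositions' f, intro linear_intros linear_compositions' f, simp add: f linear_ident left_coaction_pure
       assms(2)[unfolded id_def] tensor_simps linear_add[OF linear_assoc_right]
       assoc_right_map_left[unfolded id_def] id_def)

lemma right_coaction_pure: "right_coaction (x \<otimes> (k \<otimes> y)) = assoc_left (x \<otimes> assoc_left (k \<otimes> comult y))"
  by (simp add: right_coaction_def linear_comult linear_id_map linear_right_aux)

lemma linear_rassoc: "linear (\<lambda>t. assoc_left (x \<otimes> assoc_left (k \<otimes> t)))"
  by (intro linear_comp[OF linear_comp[OF linear_comp[OF linear_pure_right linear_assoc_left]
    linear_pure_right] linear_assoc_left])

lemma rassoc_map:
  assumes "linear f" "linear g" "linear e" "linear u"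
  shows "assoc_left (f x \<otimes> assoc_left (g k \<otimes> tensor_map e u t)) =
     tensor_map (tensor_map f (tensor_map g e)) u (assoc_left (x \<otimes> assoc_left (k \<otimes> t)))"
  by (rule tensor_eqI[of "\<lambda>t. assoc_left (f x \<otimes> assoc_left (g k \<otimes> tensor_map e u t))"])
    (simp_all add: assms linear_tensor_map linear_comp[OF linear_tensor_map linear_rassoc]
     linear_comp[OF linear_rassoc linear_tensor_map])

text \<open>Meant for \<open>u\<close> appending a letter, with \<open>e\<close> the identity, and
  for \<open>u\<close> the map \<open>mult_last\<close>, with \<open>e\<close> the sign picked up by
  the letters that stay in the left part of the cut.\<close>

lemma right_coaction_map:
  assumes f: "linear f" "linear g" "linear e" "linear u"
    and "\<And>y. comult (u y) = u y \<otimes> 1 + tensor_map e u (comult y)"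
  shows "right_coaction (tensor_map f (tensor_map g u) x) =
     tensor_map f (tensor_map g u) x \<otimes> 1 + tensor_map (tensor_map f (tensor_map g e)) u (right_coaction x)"
  by (rule bitens_eqI[of "\<lambda>x. right_coaction (tensor_map f (tensor_map g u) x)"])
    (intro linear_intros linear_compositions' f, intro linear_intros linear_compositions' f, simp add: f linear_tensor_map
      right_coaction_pure assms(5) linear_add[OF linear_rassoc] rassoc_map)

lemma right_coaction_one: "right_coaction (assoc_right (t \<otimes> 1)) = assoc_right (t \<otimes> 1) \<otimes> 1"
  by (rule tensor_eqI[of "\<lambda>t. right_coaction (assoc_right (t \<otimes> 1))"])
    (intro linear_intros linear_compositions', intro linear_intros, simp add: right_coaction_pure comult_one)

text \<open>Both coactions split off the projection onto the cogenerators, so a twisted morphism of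
  bicomodules is determined by its composition with that projection.\<close>

lemma bicomodule_morphism_zero:
  fixes F :: "('a::real_vector, 'k::real_vector, 'b::real_vector) bitens \<Rightarrow> ('a, 'k, 'b) bitens"
  assumes F: "linear F" and s: "linear s"
    and l: "\<And>x. left_coaction (F x) = tensor_map s F (left_coaction x)"
    and r: "\<And>x. right_coaction (F x) = tensor_map F id (right_coaction x)"
    and p: "\<And>x. co_proj (F x) = 0"
  shows "F x = 0"
proof -
  \<comment> \<open>\<open>eL\<close> is the counit on the left tensor factor. The right coaction
    recovers \<open>eL (F y)\<close> from \<open>co_proj\<close>, and the left coaction then
    recovers \<open>F x\<close> from \<open>eL\<close>.\<close>
  define eL :: "('a, 'k, 'b) bitens \<Rightarrow> ('k, 'b tens) tensor" where
    "eL = tensor_lift (\<lambda>x m. counit x *\<^sub>R m)"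
  have BL: "bilinear (\<lambda>(x :: 'a tens) (m :: ('k, 'b tens) tensor). counit x *\<^sub>R m)"
    by (intro bilinear_counit_left linear_ident)
  have eL: "linear eL" "eL (y \<otimes> m) = counit y *\<^sub>R m" for y m
    using linear_tensor_lift[OF BL] by (simp_all add: eL_def BL)
  have L: "tensor_map id eL (left_coaction y) = y" for y
  proof (rule bitens_eqI[of "\<lambda>y. tensor_map id eL (left_coaction y)" "\<lambda>y. y"])
    fix as \<kappa> bs
    show "tensor_map id eL (left_coaction (word as \<otimes> (\<kappa> \<otimes> word bs))) = word as \<otimes> (\<kappa> \<otimes> word bs)"
      by (simp add: left_coaction_pure comult_word tensor_sum linear_sum[OF linear_assoc_right]
         linear_sum[OF linear_tensor_map] eL linear_id_map tensor_simps if_distrib[of "\<lambda>c. c *\<^sub>R _"] if_distrib[of "\<lambda>y. _ \<otimes> y"] cong: if_cong)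
  qed (intro linear_comp[OF linear_left_coaction] linear_tensor_map linear_id_map eL linear_ident)+
  define R :: "(('a, 'k, 'b) bitens, 'b tens) tensor \<Rightarrow> ('k, 'b tens) tensor" where
    "R = tensor_map co_proj id"
  have R: "R (right_coaction y) = eL y" for y
  proof (rule bitens_eqI[of "\<lambda>y. R (right_coaction y)"])
    fix as :: "'a list" and \<kappa> :: 'k and bs :: "'b list"
    have D: "(\<Sum>a\<le>length bs. if a = 0 \<or> bs = [] then \<kappa> \<otimes> word (drop a bs) else 0) = \<kappa> \<otimes> word bs"
    proof -
      have "(\<Sum>a\<le>length bs. if a = 0 \<or> bs = [] then \<kappa> \<otimes> word (drop a bs) else 0)
          = (\<Sum>a\<le>length bs. if a = 0 then \<kappa> \<otimes> word (drop a bs) else 0)"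
        by (intro sum.cong) auto
      then show ?thesis by simp
    qed
    show "R (right_coaction (word as \<otimes> (\<kappa> \<otimes> word bs))) = eL (word as \<otimes> (\<kappa> \<otimes> word bs))"
      by (simp add: R_def right_coaction_pure comult_word linear_sum[OF linear_rassoc]
         linear_sum[OF linear_tensor_map] eL linear_id_map linear_co_proj
         if_distrib[of "\<lambda>c. c *\<^sub>R _"] if_distrib[of "\<lambda>y. y \<otimes> _"] D cong: if_cong)
  qed (simp_all add: R_def eL linear_comp[OF linear_right_coaction] linear_tensor_map linear_co_proj linear_id_map)
  have "eL (F y) = 0" for y
  proof -
    have "eL (F y) = tensor_map (\<lambda>z. co_proj (F z)) id (right_coaction y)"
      by (simp add: R[symmetric] r R_def tensor_map_comp F linear_id_map linear_co_proj id_def[symmetric])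
    then show ?thesis by (simp add: p tensor_map_zero linear_id_map)
  qed
  moreover have "F x = tensor_map id eL (left_coaction (F x))"
    by (simp only: L)
  then have "F x = tensor_map s (\<lambda>z. eL (F z)) (left_coaction x)"
    by (simp add: l tensor_map_comp F s linear_id_map eL(1))
  ultimately show ?thesis by (simp add: tensor_map_zero s)
qed

section \<open>Homotopy transfer of a bimodule structure\<close>

text \<open>All signs are absorbed into \<open>lam\<close>, \<open>rho\<close> and the sign
  operators, so that the actions are odd and every rule is an anticommutation. The argument
  \<open>sM x\<close> in \<open>rho_rho\<close> is the sign of the suspended product passing the
  module element. The homotopy identity alone is restricted to \<open>S\<close>.\<close>

locale bimodule_transfer = A: bar_algebra sA mA + B: bar_algebra sB mB
  for sA :: "'a::real_vector \<Rightarrow> 'a" and mA and sB :: "'b::real_vector \<Rightarrow> 'b" and mB +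
  fixes sK :: "'k::real_vector \<Rightarrow> 'k" and sM :: "'m::real_vector \<Rightarrow> 'm"
    and lam :: "'a \<Rightarrow> 'm \<Rightarrow> 'm" and rho :: "'b \<Rightarrow> 'm \<Rightarrow> 'm"
    and d h :: "'m \<Rightarrow> 'm" and i :: "'k \<Rightarrow> 'm" and p :: "'m \<Rightarrow> 'k" and S :: "'m set"
  assumes linear_maps: "linear sK" "linear sM" "linear d" "linear h" "linear i" "linear p"
    and bilinear_actions: "bilinear lam" "bilinear rho"
    and carrier: "subspace S" "\<And>a x. x \<in> S \<Longrightarrow> lam a x \<in> S" "\<And>b x. x \<in> S \<Longrightarrow> rho b x \<in> S"
      "\<And>x. x \<in> S \<Longrightarrow> h x \<in> S" "\<And>\<kappa>. i \<kappa> \<in> S"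
    and d_i: "d (i \<kappa>) = 0" and p_d: "p (d x) = 0"
    and homotopy: "x \<in> S \<Longrightarrow> d (h x) + h (d x) = i (p x) - x"
    and d_lam: "d (lam a x) + lam (sA a) (d x) = 0"
    and d_rho: "d (rho b x) + rho b (d x) = 0"
    and lam_lam: "lam (mA a a') x + lam (sA a) (lam a' x) = 0"
    and rho_rho: "rho b' (rho b x) + rho (mB b b') (sM x) = 0"
    and rho_lam: "rho b (lam a x) + lam (sA a) (rho b x) = 0"
    and sM_lam: "sM (lam a x) = - lam (sA a) (sM x)"
    and sM_rho: "sM (rho b x) = - rho (sB b) (sM x)"
    and sM_h: "sM (h x) = - h (sM x)"
    and sM_i: "sM (i \<kappa>) = i (sK \<kappa>)"
    and p_sM: "p (sM x) = sK (p x)"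
begin

lemmas lin = linear_maps A.linear_s B.linear_s A.linear_bar B.linear_bar A.linear_map_word B.linear_map_word
  A.linear_mult_head B.linear_mult_last

lemma linear_actions: "linear (lam a)" "linear (\<lambda>a. lam a x)" "linear (rho b)" "linear (\<lambda>b. rho b x)"
  using bilinear_actions by (auto simp: bilinear_def)

lemma linear_lin: "linear u \<Longrightarrow> linear (\<lambda>x. d (u x))" "linear u \<Longrightarrow> linear (\<lambda>x. h (u x))"
  "linear u \<Longrightarrow> linear (\<lambda>x. p (u x))" "linear u \<Longrightarrow> linear (\<lambda>x. lam a (u x))" "linear u \<Longrightarrow> linear (\<lambda>x. rho b (u x))"
  by (rule linear_comp, assumption, rule lin linear_actions)+

text \<open>Words over \<open>B\<close> are listed from the right, so that the letter next to be split off comes first.\<close>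

fun psi :: "'a list \<Rightarrow> 'k \<Rightarrow> 'b list \<Rightarrow> 'm" where
  "psi [] \<kappa> [] = i \<kappa>"
| "psi (a # as) \<kappa> [] = h (lam a (psi as \<kappa> []))"
| "psi [] \<kappa> (b # bs) = h (rho b (psi [] \<kappa> bs))"
| "psi (a # as) \<kappa> (b # bs) = h (lam a (psi as \<kappa> (b # bs)) + rho b (psi (a # as) \<kappa> bs))"

definition theta_left :: "'a list \<Rightarrow> 'k \<Rightarrow> 'b list \<Rightarrow> 'm" where
  "theta_left as \<kappa> bs = (case as of [] \<Rightarrow> 0 | a # as' \<Rightarrow> lam a (psi as' \<kappa> bs))"

definition theta_right :: "'a list \<Rightarrow> 'k \<Rightarrow> 'b list \<Rightarrow> 'm" where
  "theta_right as \<kappa> bs = (case bs of [] \<Rightarrow> 0 | b # bs' \<Rightarrow> rho b (psi as \<kappa> bs'))"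

definition phi :: "'a list \<Rightarrow> 'k \<Rightarrow> 'b list \<Rightarrow> 'k" where
  "phi as \<kappa> bs = p (theta_left as \<kappa> bs + theta_right as \<kappa> bs)"

lemma theta_simps [simp]:
  "theta_left [] \<kappa> bs = 0" "theta_left (a # as) \<kappa> bs = lam a (psi as \<kappa> bs)"
  "theta_right as \<kappa> [] = 0" "theta_right as \<kappa> (b # bs) = rho b (psi as \<kappa> bs)"
  by (simp_all add: theta_left_def theta_right_def)

lemma psi_theta:
  "as \<noteq> [] \<or> bs \<noteq> [] \<Longrightarrow> psi as \<kappa> bs = h (theta_left as \<kappa> bs + theta_right as \<kappa> bs)"
  by (cases as; cases bs) auto

lemma psi_carrier: "psi as \<kappa> bs \<in> S"
  by (induction as \<kappa> bs rule: psi.induct) (auto intro: carrier subspace_add)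

lemma trilinear_psi: "trilinear psi"
proof -
  have K: "linear (\<lambda>\<kappa>. psi as \<kappa> bs)" for as bs
  proof (induction "length as + length bs" arbitrary: as bs rule: less_induct)
    case less
    show ?case
    proof (cases "as = [] \<and> bs = []")
      case False
      have "linear (\<lambda>\<kappa>. theta_left as \<kappa> bs + theta_right as \<kappa> bs)"
        using less by (cases as; cases bs) (auto intro!: linear_compose_add linear_lin linear_zero)
      with False show ?thesis by (auto simp: psi_theta linear_lin)
    qed (simp add: linear_maps)
  qed
  have A: "linear (\<lambda>x. psi (us @ x # vs) \<kappa> bs)" for us vs bs \<kappa>
  proof (induction "length us + length bs" arbitrary: us bs rule: less_induct)
    case less
    have "linear (\<lambda>x. theta_left (us @ x # vs) \<kappa> bs + theta_right (us @ x # vs) \<kappa> bs)"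
      using less[of us "tl bs"] less[of "tl us" bs]
      by (cases us; cases bs) (auto intro!: linear_compose_add linear_lin linear_actions linear_zero)
    then show ?case by (simp add: psi_theta linear_lin)
  qed
  have B: "linear (\<lambda>x. psi as \<kappa> (us @ x # vs))" for us vs as \<kappa>
  proof (induction "length us + length as" arbitrary: us as rule: less_induct)
    case less
    have "linear (\<lambda>x. theta_left as \<kappa> (us @ x # vs) + theta_right as \<kappa> (us @ x # vs))"
      using less[of us "tl as"] less[of "tl us" as]
      by (cases us; cases as) (auto intro!: linear_compose_add linear_lin linear_actions linear_zero)
    then show ?case by (simp add: psi_theta linear_lin)
  qed
  show ?thesis
    using K A B by (simp add: trilinear_def multilinear_def)
qed

lemma trilinear_theta_left: "trilinear theta_left"
proof -
  have "linear (\<lambda>\<kappa>. theta_left as \<kappa> bs)" "linear (\<lambda>x. theta_left as \<kappa> (us @ x # vs))" for as \<kappa> bs us vs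
    using trilinear_psi by (cases as; auto simp: trilinear_def multilinear_def linear_zero intro: linear_lin)+
  moreover have "linear (\<lambda>x. theta_left (us @ x # vs) \<kappa> bs)" for us vs \<kappa> bs
    using trilinear_psi by (cases us) (auto simp: trilinear_def multilinear_def linear_actions intro: linear_lin)
  ultimately show ?thesis by (simp add: trilinear_def multilinear_def)
qed

lemma trilinear_theta_right: "trilinear theta_right"
proof -
  have "linear (\<lambda>\<kappa>. theta_right as \<kappa> bs)" "linear (\<lambda>x. theta_right (us @ x # vs) \<kappa> bs)" for as \<kappa> bs us vs
    using trilinear_psi by (cases bs; auto simp: trilinear_def multilinear_def linear_zero intro: linear_lin)+
  moreover have "linear (\<lambda>x. theta_right as \<kappa> (us @ x # vs))" for us vs \<kappa> as
    using trilinear_psi by (cases us) (auto simp: trilinear_def multilinear_def linear_actions intro: linear_lin)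
  ultimately show ?thesis by (simp add: trilinear_def multilinear_def)
qed

lemma trilinear_phi: "trilinear phi"
  using trilinear_theta_left trilinear_theta_right
  by (auto simp: trilinear_def multilinear_def phi_def intro!: linear_lin linear_compose_add)

section \<open>The transferred codifferential and its recursions\<close>

fun row_word :: "'a list \<Rightarrow> 'k \<Rightarrow> 'b list \<Rightarrow> ('k, 'b tens) tensor" where
  "row_word as \<kappa> [] = phi as \<kappa> [] \<otimes> 1"
| "row_word as \<kappa> (b # bs) = tensor_map id (\<lambda>y. y * word [b]) (row_word as \<kappa> bs) + phi as \<kappa> (b # bs) \<otimes> 1"

fun col_word :: "'a list \<Rightarrow> 'k \<Rightarrow> 'b list \<Rightarrow> ('a tens, 'k) tensor" where
  "col_word [] \<kappa> bs = 1 \<otimes> phi [] \<kappa> bs"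
| "col_word (a # as) \<kappa> bs = tensor_map (\<lambda>x. word [sA a] * x) id (col_word as \<kappa> bs) + 1 \<otimes> phi (a # as) \<kappa> bs"

definition cons_left :: "'a \<Rightarrow> ('a, 'k, 'b) bitens \<Rightarrow> ('a, 'k, 'b) bitens" where
  "cons_left a = tensor_map (\<lambda>x. word [a] * x) id"

definition snoc_right :: "'b \<Rightarrow> ('a, 'k, 'b) bitens \<Rightarrow> ('a, 'k, 'b) bitens" where
  "snoc_right b = tensor_map id (tensor_map id (\<lambda>y. y * word [b]))"

definition head_left :: "'a \<Rightarrow> ('a, 'k, 'b) bitens \<Rightarrow> ('a, 'k, 'b) bitens" where
  "head_left a = tensor_map (mult_head mA a) id"

definition last_right :: "'b \<Rightarrow> ('a, 'k, 'b) bitens \<Rightarrow> ('a, 'k, 'b) bitens" where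
  "last_right b = tensor_map (map_word sA) (tensor_map sK (mult_last sB mB b))"

definition koszul_bi :: "('a, 'k, 'b) bitens \<Rightarrow> ('a, 'k, 'b) bitens" where
  "koszul_bi = tensor_map (map_word sA) (tensor_map sK (map_word sB))"

definition bar_left :: "('a, 'k, 'b) bitens \<Rightarrow> ('a, 'k, 'b) bitens" where
  "bar_left = tensor_map (bar sA mA) id"

definition bar_right :: "('a, 'k, 'b) bitens \<Rightarrow> ('a, 'k, 'b) bitens" where
  "bar_right = tensor_map (map_word sA) (tensor_map sK (bar sB mB))"

text \<open>The coderivation extending \<open>phi\<close>: a sum over all stretches of letters
  around \<kappa> that \<open>phi\<close> may consume. \<open>row_word\<close> holds the terms that
  consume all of \<open>as\<close>, \<open>col_word\<close> those that consume all of
  \<open>bs\<close>. Letters of A left over get the sign \<open>sA\<close>, since the odd map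
  \<open>phi\<close> acts to their right; letters of B get none.\<close>

fun inner_word :: "'a list \<Rightarrow> 'k \<Rightarrow> 'b list \<Rightarrow> ('a, 'k, 'b) bitens" where
  "inner_word [] \<kappa> bs = 1 \<otimes> row_word [] \<kappa> bs"
| "inner_word (a # as) \<kappa> bs = cons_left (sA a) (inner_word as \<kappa> bs) + 1 \<otimes> row_word (a # as) \<kappa> bs"

definition col :: "'a list \<Rightarrow> 'k \<Rightarrow> 'b list \<Rightarrow> ('a, 'k, 'b) bitens" where
  "col as \<kappa> bs = assoc_right (col_word as \<kappa> bs \<otimes> 1)"

lemmas operator_defs = cons_left_def snoc_right_def head_left_def last_right_def koszul_bi_def
  bar_left_def bar_right_def

lemma linear_operators: "linear (cons_left a)" "linear (snoc_right b)" "linear (head_left a)"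
  "linear (last_right b)" "linear koszul_bi" "linear bar_left" "linear bar_right"
  unfolding operator_defs
  by (intro linear_tensor_map lin linear_id_map linear_mult_left linear_mult_right)+

lemma linear_operators_comp:
  "linear u \<Longrightarrow> linear (\<lambda>x. cons_left a (u x))" "linear u \<Longrightarrow> linear (\<lambda>x. snoc_right b (u x))"
  "linear u \<Longrightarrow> linear (\<lambda>x. head_left a (u x))" "linear u \<Longrightarrow> linear (\<lambda>x. last_right b (u x))"
  "linear u \<Longrightarrow> linear (\<lambda>x. koszul_bi (u x))" "linear u \<Longrightarrow> linear (\<lambda>x. bar_left (u x))"
  "linear u \<Longrightarrow> linear (\<lambda>x. bar_right (u x))"
  by (rule linear_comp, assumption, rule linear_operators)+

lemma linear_cons_left_letter: "linear (\<lambda>a. cons_left (sA a) t)"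
  unfolding cons_left_def tensor_map_def
  by (intro linear_tensor_lift_param linear_intros linear_comp[OF A.linear_s linear_word_Cons])

lemma linear_snoc_letter: "linear (\<lambda>b. tensor_map id (\<lambda>y. y * word [b]) t)"
  unfolding tensor_map_def
  by (intro linear_tensor_lift_param linear_intros linear_word_Cons)

lemma trilinear_row_word: "trilinear row_word"
proof -
  have phi: "linear (\<lambda>\<kappa>. phi as \<kappa> bs)" "linear (\<lambda>x. phi (us @ x # vs) \<kappa> bs)" "linear (\<lambda>y. phi as \<kappa> (us' @ y # vs'))"
    for as \<kappa> bs us vs us' vs'
    using trilinear_phi by (auto simp: trilinear_def multilinear_def)
  have "linear (\<lambda>\<kappa>. row_word as \<kappa> bs)" for as bs
    by (induction bs) (auto intro!: linear_intros phi)
  moreover have "linear (\<lambda>x. row_word (us @ x # vs) \<kappa> bs)" for us vs \<kappa> bs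
    by (induction bs) (auto intro!: linear_intros phi)
  moreover have "linear (\<lambda>x. row_word as \<kappa> (us @ x # vs))" for us vs \<kappa> as
    using phi(3)[of as \<kappa> "[]"]
    by (induction us) (auto intro!: linear_intros linear_snoc_letter phi(3)[of as \<kappa> "a # us" for a us, simplified])
  ultimately show ?thesis by (simp add: trilinear_def multilinear_def)
qed

lemma trilinear_inner_word: "trilinear inner_word"
proof -
  have row: "linear (\<lambda>\<kappa>. row_word as \<kappa> bs)" "linear (\<lambda>x. row_word (us @ x # vs) \<kappa> bs)"
      "linear (\<lambda>y. row_word as \<kappa> (us' @ y # vs'))"
    for as \<kappa> bs us vs us' vs'
    using trilinear_row_word by (auto simp: trilinear_def multilinear_def)
  have "linear (\<lambda>\<kappa>. inner_word as \<kappa> bs)" for as bs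
    by (induction as) (auto intro!: linear_intros linear_operators_comp row simp del: row_word.simps)
  moreover have "linear (\<lambda>x. inner_word as \<kappa> (us @ x # vs))" for us vs \<kappa> as
    by (induction as) (auto intro!: linear_intros linear_operators_comp row simp del: row_word.simps)
  moreover have "linear (\<lambda>x. inner_word (us @ x # vs) \<kappa> bs)" for us vs \<kappa> bs
    using row(2)[of "[]" _ \<kappa> bs]
    by (induction us) (auto intro!: linear_intros linear_operators_comp linear_cons_left_letter
      row(2)[of "a # us" for a us, simplified])
  ultimately show ?thesis by (simp add: trilinear_def multilinear_def)
qed

lemma trilinear_rev: "trilinear F \<Longrightarrow> trilinear (\<lambda>as \<kappa> bs. F as \<kappa> (rev bs))"
  by (simp add: trilinear_def multilinear_rev)

definition Psi :: "('a, 'k, 'b) bitens \<Rightarrow> 'm" where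
  "Psi = tri_lift (\<lambda>as \<kappa> bs. psi as \<kappa> (rev bs))"

definition Theta_left :: "('a, 'k, 'b) bitens \<Rightarrow> 'm" where
  "Theta_left = tri_lift (\<lambda>as \<kappa> bs. theta_left as \<kappa> (rev bs))"

definition Theta_right :: "('a, 'k, 'b) bitens \<Rightarrow> 'm" where
  "Theta_right = tri_lift (\<lambda>as \<kappa> bs. theta_right as \<kappa> (rev bs))"

definition inner :: "('a, 'k, 'b) bitens \<Rightarrow> ('a, 'k, 'b) bitens" where
  "inner = tri_lift (\<lambda>as \<kappa> bs. inner_word as \<kappa> (rev bs))"

text \<open>The general shape of a coderivation over the two bar differentials: \<open>phi\<close>
  is its only free part and enters through \<open>inner\<close>.\<close>

definition D :: "('a, 'k, 'b) bitens \<Rightarrow> ('a, 'k, 'b) bitens" where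
  "D x = bar_left x + bar_right x + inner x"

definition bword :: "'a list \<Rightarrow> 'k \<Rightarrow> 'b list \<Rightarrow> ('a, 'k, 'b) bitens" where
  "bword as \<kappa> bs = word as \<otimes> (\<kappa> \<otimes> word (rev bs))"

lemma lifts_bword [simp]:
  "Psi (bword as \<kappa> bs) = psi as \<kappa> bs"
  "Theta_left (bword as \<kappa> bs) = theta_left as \<kappa> bs"
  "Theta_right (bword as \<kappa> bs) = theta_right as \<kappa> bs"
  "inner (bword as \<kappa> bs) = inner_word as \<kappa> bs"
  by (simp_all add: Psi_def Theta_left_def Theta_right_def inner_def bword_def tri_lift_word trilinear_rev
      trilinear_psi trilinear_theta_left trilinear_theta_right trilinear_inner_word)

lemma linear_lifts: "linear Psi" "linear Theta_left" "linear Theta_right" "linear inner" "linear D"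
proof -
  show *: "linear Psi" "linear Theta_left" "linear Theta_right" "linear inner"
    unfolding Psi_def Theta_left_def Theta_right_def inner_def
    by (intro linear_tri_lift trilinear_rev trilinear_psi trilinear_theta_left trilinear_theta_right trilinear_inner_word)+
  then show "linear D"
    unfolding D_def by (intro linear_compose_add linear_operators)
qed

lemma linear_lifts_comp:
  "linear u \<Longrightarrow> linear (\<lambda>x. Psi (u x))" "linear u \<Longrightarrow> linear (\<lambda>x. Theta_left (u x))"
  "linear u \<Longrightarrow> linear (\<lambda>x. Theta_right (u x))" "linear u \<Longrightarrow> linear (\<lambda>x. inner (u x))"
  "linear u \<Longrightarrow> linear (\<lambda>x. D (u x))"
  by (rule linear_comp, assumption, rule linear_lifts)+

lemma bword_eqI:
  assumes "linear f" "linear g" "\<And>as \<kappa> bs. f (bword as \<kappa> bs) = g (bword as \<kappa> bs)"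
  shows "f t = g t"
  by (rule bitens_eqI[OF assms(1,2)]) (use assms(3)[of _ _ "rev bs" for bs] in \<open>simp add: bword_def\<close>)

lemma bword_Cons: "bword (a # as) \<kappa> bs = cons_left a (bword as \<kappa> bs)"
  by (simp add: bword_def cons_left_def word_Cons[of a as] linear_mult_right linear_id_map)

lemma bword_snoc: "bword as \<kappa> (b # bs) = snoc_right b (bword as \<kappa> bs)"
  by (simp add: bword_def snoc_right_def word_snoc linear_mult_left linear_id_map linear_tensor_map)

lemma cons_snoc: "cons_left a (snoc_right b x) = snoc_right b (cons_left a x)"
  by (simp add: cons_left_def snoc_right_def tensor_map_comp linear_mult_left linear_mult_right linear_id_map linear_tensor_map)

lemma bar_left_cons: "bar_left (cons_left a x) = cons_left (sA a) (bar_left x) + head_left a x"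
  by (simp add: bar_left_def cons_left_def head_left_def tensor_map_comp lin linear_mult_right linear_id_map
     A.bar_Cons tensor_map_add_left linear_comp[OF _ linear_mult_right] id_def[symmetric])

lemma bar_left_snoc: "bar_left (snoc_right b x) = snoc_right b (bar_left x)"
  by (simp add: bar_left_def snoc_right_def tensor_map_comp lin linear_mult_left linear_id_map linear_tensor_map)

lemma bar_right_cons: "bar_right (cons_left a x) = cons_left (sA a) (bar_right x)"
  by (simp add: bar_right_def cons_left_def tensor_map_comp lin linear_mult_right linear_id_map linear_tensor_map
     A.map_word_mult)

lemma bar_right_snoc: "bar_right (snoc_right b x) = snoc_right b (bar_right x) + last_right b x"
proof -
  have 1: "tensor_map sK (\<lambda>y. bar sB mB y * word [b] + mult_last sB mB b y) z =
     tensor_map sK (\<lambda>y. bar sB mB y * word [b]) z + tensor_map sK (mult_last sB mB b) z" for z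
    by (intro tensor_map_add_right lin linear_comp[OF _ linear_mult_left])
  show ?thesis
    by (simp add: bar_right_def snoc_right_def last_right_def tensor_map_comp lin linear_mult_left linear_id_map
      linear_tensor_map B.bar_snoc 1 tensor_map_add_right linear_comp[OF _ linear_mult_left])
qed

text \<open>\<open>inner_word\<close> is defined by peeling letters of A; this is the recursion in
  B. A term that consumes the new outermost letter must consume all of \<open>bs\<close>, because
  the consumed stretch is contiguous; these terms form the column.\<close>

lemma inner_word_snoc:
  "inner_word as \<kappa> (b # bs) = snoc_right b (inner_word as \<kappa> bs) + col as \<kappa> (b # bs)"
proof (induction as)
  case Nil
  show ?case
    by (simp add: snoc_right_def col_def linear_id_map linear_tensor_map linear_mult_left tensor_simps)
next
  case (Cons a as)
  have "col (a # as) \<kappa> (b # bs) = cons_left (sA a) (col as \<kappa> (b # bs)) + 1 \<otimes> (phi (a # as) \<kappa> (b # bs) \<otimes> 1)"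
    by (simp add: col_def tensor_simps linear_add[OF linear_assoc_right] assoc_right_map_left linear_mult_right cons_left_def)
  moreover have "snoc_right b (1 \<otimes> z) = 1 \<otimes> tensor_map id (\<lambda>y. y * word [b]) z" for z
    by (simp add: snoc_right_def linear_id_map linear_tensor_map linear_mult_left)
  ultimately show ?case
    using Cons by (simp add: linear_add[OF linear_operators(1)] linear_add[OF linear_operators(2)] cons_snoc tensor_simps)
qed

text \<open>Passing the outermost letter through \<open>D\<close> produces, besides a sign, the
  product of that letter with its neighbour and the terms in which every letter on its side is
  consumed. \<open>D_snoc\<close> is the counterpart for B.\<close>

lemma D_Cons:
  "D (bword (a # as) \<kappa> bs) =
     cons_left (sA a) (D (bword as \<kappa> bs)) + head_left a (bword as \<kappa> bs) + 1 \<otimes> row_word (a # as) \<kappa> bs"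
  by (simp add: D_def bword_Cons[of a as] bar_left_cons bar_right_cons linear_add[OF linear_operators(1)])
    (simp add: bword_Cons[symmetric])

lemma D_snoc:
  "D (bword as \<kappa> (b # bs)) =
     snoc_right b (D (bword as \<kappa> bs)) + last_right b (bword as \<kappa> bs) + col as \<kappa> (b # bs)"
  by (simp add: D_def bword_snoc[of as] bar_left_snoc bar_right_snoc linear_add[OF linear_operators(2)])
    (simp add: bword_snoc[symmetric] inner_word_snoc)

text \<open>A side without letters stays without letters. This form of the value is all that the
  base cases need: \<open>Theta_left\<close> vanishes on it and the left coaction is trivial
  there.\<close>

lemma D_Nil_left: "\<exists>z. D (bword [] \<kappa> bs) = 1 \<otimes> z"
proof -
  have "D (bword [] \<kappa> bs) = 1 \<otimes> (sK \<kappa> \<otimes> bar sB mB (word (rev bs)) + row_word [] \<kappa> bs)"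
    by (simp add: D_def) (simp add: bar_left_def bar_right_def bword_def one_tens_def[symmetric] lin linear_id_map
       linear_tensor_map tensor_simps)
  then show ?thesis by blast
qed

lemma D_Nil_right: "\<exists>z. D (bword as \<kappa> []) = assoc_right (z \<otimes> 1)"
proof -
  have "inner_word as \<kappa> [] = col as \<kappa> []"
    by (induction as) (simp_all add: col_def cons_left_def tensor_simps linear_add[OF linear_assoc_right]
       assoc_right_map_left linear_mult_right)
  then have "D (bword as \<kappa> []) = assoc_right ((bar sA mA (word as) \<otimes> \<kappa> + col_word as \<kappa> []) \<otimes> 1)"
    by (simp add: D_def) (simp add: bar_left_def bar_right_def bword_def one_tens_def[symmetric] lin linear_id_map linear_tensor_map
       tensor_simps linear_add[OF linear_assoc_right] col_def)
  then show ?thesis by blast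
qed

end

section \<open>The morphism equation\<close>

context bimodule_transfer
begin

lemma Psi_cons_snoc:
  "Theta_left (cons_left a x) = lam a (Psi x)"
  "Theta_right (snoc_right b x) = rho b (Psi x)"
  by (rule bword_eqI[of "\<lambda>x. Theta_left (cons_left a x)"];
      simp add: linear_lifts_comp linear_lin linear_operators linear_lifts flip: bword_Cons)
    (rule bword_eqI[of "\<lambda>x. Theta_right (snoc_right b x)"];
      simp add: linear_lifts_comp linear_lin linear_operators linear_lifts flip: bword_snoc)

lemma Theta_left_one: "Theta_left (1 \<otimes> z) = 0"
proof (rule tensor_eqI[of "\<lambda>z. Theta_left (1 \<otimes> z)" "\<lambda>_. 0"])
  fix \<kappa> :: 'k and y
  show "Theta_left (1 \<otimes> (\<kappa> \<otimes> y)) = 0"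
    by (rule tens_eqI[of "\<lambda>y. Theta_left (1 \<otimes> (\<kappa> \<otimes> y))" "\<lambda>_. 0"])
      (intro linear_lifts_comp linear_intros, intro linear_intros, simp add: Theta_left_def one_tens_def tri_lift_word
        trilinear_rev trilinear_theta_left)
qed (intro linear_lifts_comp linear_intros)+

lemma Theta_right_one: "Theta_right (assoc_right (t \<otimes> 1)) = 0"
proof (rule tensor_eqI[of "\<lambda>t. Theta_right (assoc_right (t \<otimes> 1))" "\<lambda>_. 0"])
  fix x and \<kappa> :: 'k
  show "Theta_right (assoc_right ((x \<otimes> \<kappa>) \<otimes> 1)) = 0"
    by (rule tens_eqI[of "\<lambda>x. Theta_right (assoc_right ((x \<otimes> \<kappa>) \<otimes> 1))" "\<lambda>_. 0"])
      (intro linear_lifts_comp linear_intros, intro linear_intros, simp add: Theta_right_def one_tens_def tri_lift_word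
        trilinear_rev trilinear_theta_right)
qed (intro linear_lifts_comp linear_intros)+

text \<open>Acting by a product is acting twice: this is \<open>lam_lam\<close> read on the first
  two letters, and both sides vanish when there is no letter to multiply with.\<close>

lemma Theta_left_head: "Theta_left (head_left a x) = - lam (sA a) (Theta_left x)"
proof (rule bword_eqI[of "\<lambda>x. Theta_left (head_left a x)"])
  fix as \<kappa> bs
  show "Theta_left (head_left a (bword as \<kappa> bs)) = - lam (sA a) (Theta_left (bword as \<kappa> bs))"
  proof (cases as)
    case Nil
    have "head_left a (bword [] \<kappa> bs) = 0"
      by (simp add: head_left_def bword_def A.mult_head_word lin linear_id_map)
    with Nil show ?thesis
      by (simp add: linear_0[OF linear_lifts(2)] linear_0[OF linear_actions(1)])
  next
    case (Cons a' as')
    have "head_left a (bword as \<kappa> bs) = bword (mA a a' # as') \<kappa> bs"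
      by (simp add: Cons head_left_def bword_def A.mult_head_word lin linear_id_map)
    then show ?thesis using lam_lam[of a a'] Cons by (simp add: eq_neg_iff_add_eq_0)
  qed
qed (intro linear_lifts_comp linear_operators linear_compose_neg linear_lin linear_lifts)+

lemma koszul_bi_bword: "koszul_bi (bword as \<kappa> bs) = bword (map sA as) (sK \<kappa>) (map sB bs)"
  by (simp add: koszul_bi_def bword_def lin linear_tensor_map rev_map)

text \<open>By the sign rules of the locale \<open>psi\<close> is even, as \<open>h\<close> and each
  action contribute one sign apiece, and the two thetas are odd. \<open>Theta_right_last\<close>
  needs this, since \<open>last_right\<close> puts signs on all the other letters.\<close>

lemma psi_koszul: "psi (map sA as) (sK \<kappa>) (map sB bs) = sM (psi as \<kappa> bs)"
  and theta_koszul: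
    "theta_left (map sA as) (sK \<kappa>) (map sB bs) = - sM (theta_left as \<kappa> bs)"
    "theta_right (map sA as) (sK \<kappa>) (map sB bs) = - sM (theta_right as \<kappa> bs)"
proof -
  show psi: "psi (map sA as) (sK \<kappa>) (map sB bs) = sM (psi as \<kappa> bs)" for as bs
    by (induction as \<kappa> bs rule: psi.induct)
      (simp_all add: sM_i sM_h sM_lam sM_rho linear_add[OF lin(2)] linear_add[OF lin(4)] linear_neg[OF lin(4)])
  show "theta_left (map sA as) (sK \<kappa>) (map sB bs) = - sM (theta_left as \<kappa> bs)"
    by (cases as) (simp_all add: psi sM_lam linear_0[OF lin(2)])
  show "theta_right (map sA as) (sK \<kappa>) (map sB bs) = - sM (theta_right as \<kappa> bs)"
    by (cases bs) (simp_all add: psi sM_rho linear_0[OF lin(2)])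
qed

lemma Theta_right_last:
  "Theta_right (last_right b x) = - rho b (Theta_right x)"
proof (rule bword_eqI[of "\<lambda>x. Theta_right (last_right b x)"])
  fix as \<kappa> bs
  show "Theta_right (last_right b (bword as \<kappa> bs)) = - rho b (Theta_right (bword as \<kappa> bs))"
  proof (cases bs)
    case Nil
    have "last_right b (bword as \<kappa> []) = 0"
      by (simp add: last_right_def bword_def B.mult_last_word lin linear_tensor_map)
    with Nil show ?thesis
      by (simp add: linear_0[OF linear_lifts(3)] linear_0[OF linear_actions(3)])
  next
    case (Cons b' bs')
    have "last_right b (bword as \<kappa> bs) = bword (map sA as) (sK \<kappa>) (mB b' b # map sB bs')"
      by (simp add: Cons last_right_def bword_def B.mult_last_word lin linear_tensor_map rev_map)
    then show ?thesis using rho_rho[of b b'] Cons by (simp add: eq_neg_iff_add_eq_0 psi_koszul add.commute)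
  qed
qed (intro linear_lifts_comp linear_operators linear_compose_neg linear_lin linear_lifts)+

lemma co_proj_cons: "co_proj (cons_left a x) = 0"
  by (rule bitens_eqI[of "\<lambda>x. co_proj (cons_left a x)" "\<lambda>_. 0"])
    (intro linear_compositions' linear_operators linear_zero, intro linear_zero,
      simp add: cons_left_def linear_mult_right linear_id_map counit_Cons)

lemma co_proj_bar_left: "co_proj (bar_left x) = 0"
  by (rule bitens_eqI[of "\<lambda>x. co_proj (bar_left x)" "\<lambda>_. 0"])
    (intro linear_compositions' linear_operators linear_zero, intro linear_zero,
      simp add: bar_left_def lin linear_id_map A.counit_bar)

lemma co_proj_bar_right: "co_proj (bar_right x) = 0"
  by (rule bitens_eqI[of "\<lambda>x. co_proj (bar_right x)" "\<lambda>_. 0"])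
    (intro linear_compositions' linear_operators linear_zero, intro linear_zero,
      simp add: bar_right_def lin linear_tensor_map B.counit_bar)

lemma co_proj_bword: "co_proj (bword as \<kappa> bs) = (if as = [] \<and> bs = [] then \<kappa> else 0)"
  by (simp add: bword_def)

lemma co_proj_row: "co_proj (1 \<otimes> row_word as \<kappa> bs) = phi as \<kappa> bs"
proof (cases bs)
  case (Cons b bs')
  have "co_proj (1 \<otimes> tensor_map id (\<lambda>y. y * word [b]) z) = 0" for z :: "('k, 'b tens) tensor"
    by (rule tensor_eqI[of "\<lambda>z. co_proj (1 \<otimes> tensor_map id (\<lambda>y. y * word [b]) z)" "\<lambda>_. 0"])
      (intro linear_compositions' linear_intros, intro linear_intros,
        simp add: linear_id_map linear_mult_left counit_snoc)
  with Cons show ?thesis by (simp add: tensor_simps linear_add[OF linear_co_proj] one_tens_def)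
qed (simp add: one_tens_def)

lemma co_proj_D: "co_proj (D (bword as \<kappa> bs)) = phi as \<kappa> bs"
  by (cases as) (simp_all add: D_def co_proj_bar_left co_proj_bar_right linear_add[OF linear_co_proj] co_proj_row co_proj_cons)

lemma co_proj_D': "co_proj (D x) = p (Theta_left x + Theta_right x)"
  by (rule bword_eqI[of "\<lambda>x. co_proj (D x)"])
    (intro linear_compositions' linear_lin linear_compose_add linear_lifts, intro linear_lin linear_compose_add linear_lifts,
     simp add: co_proj_D phi_def)

text \<open>The two cases in the definition of \<open>psi\<close> in one formula: on the empty words
  both thetas vanish, on all others \<open>co_proj\<close> does.\<close>

lemma Psi_decomp: "Psi x = h (Theta_left x + Theta_right x) + i (co_proj x)"
proof (rule bword_eqI[of Psi])
  fix as \<kappa> bs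
  show "Psi (bword as \<kappa> bs) = h (Theta_left (bword as \<kappa> bs) + Theta_right (bword as \<kappa> bs)) + i (co_proj (bword as \<kappa> bs))"
    by (cases "as = [] \<and> bs = []")
     (auto simp: psi_theta co_proj_bword linear_0[OF lin(4)] linear_0[OF lin(5)])
qed (intro linear_lin linear_compose_add linear_comp[OF linear_co_proj lin(5)] linear_lifts)+

text \<open>The maps \<open>Psi\<close> form a morphism of \<open>A\<^sub>\<infinity>\<close>-bimodules from the transferred structure to the
  original one; its first equation at a word follows from the second one, which in turn needs the first
  one only at shorter words.\<close>

lemma morphism_equation:
  "d (psi as \<kappa> bs) + (theta_left as \<kappa> bs + theta_right as \<kappa> bs) = Psi (D (bword as \<kappa> bs))
   \<and> d (theta_left as \<kappa> bs + theta_right as \<kappa> bs)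
     + (Theta_left (D (bword as \<kappa> bs)) + Theta_right (D (bword as \<kappa> bs))) = 0"
proof (induction "length as + length bs" arbitrary: as bs rule: less_induct)
  case less
  let ?x = "bword as \<kappa> bs"
  let ?th = "theta_left as \<kappa> bs + theta_right as \<kappa> bs"
  \<comment> \<open>The induction hypothesis rewrites \<open>Psi (D ...)\<close> as \<open>d\<close>
    of \<open>psi\<close> plus both thetas. The first summand cancels against \<open>d_lam\<close>,
    the left theta against the product term of \<open>D_Cons\<close>, and the mixed term is left.
    \<open>R\<close> is the same on the other side.\<close>
  have L: "d (theta_left as \<kappa> bs) + Theta_left (D ?x) =
     (case as of [] \<Rightarrow> 0 | a # as' \<Rightarrow> lam (sA a) (theta_right as' \<kappa> bs))"
  proof (cases as)
    case Nil
    obtain z where "D (bword [] \<kappa> bs) = 1 \<otimes> z" using D_Nil_left by blast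
    then show ?thesis using Nil by (simp add: linear_0[OF lin(3)] Theta_left_one)
  next
    case (Cons a as')
    have IH: "d (psi as' \<kappa> bs) + (theta_left as' \<kappa> bs + theta_right as' \<kappa> bs) = Psi (D (bword as' \<kappa> bs))"
      using less[of as' bs] Cons by simp
    have "Theta_left (D ?x) = lam (sA a) (Psi (D (bword as' \<kappa> bs))) - lam (sA a) (theta_left as' \<kappa> bs)"
      unfolding Cons D_Cons
      by (simp add: linear_add[OF linear_lifts(2)] Psi_cons_snoc Theta_left_head Theta_left_one)
    moreover have "d (lam a (psi as' \<kappa> bs)) = - lam (sA a) (d (psi as' \<kappa> bs))"
      using d_lam by (simp add: eq_neg_iff_add_eq_0)
    ultimately show ?thesis
      by (simp add: Cons IH[symmetric] linear_add[OF linear_actions(1)])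
  qed
  have R: "d (theta_right as \<kappa> bs) + Theta_right (D ?x) =
     (case bs of [] \<Rightarrow> 0 | b # bs' \<Rightarrow> rho b (theta_left as \<kappa> bs'))"
  proof (cases bs)
    case Nil
    obtain z where "D (bword as \<kappa> []) = assoc_right (z \<otimes> 1)" using D_Nil_right by blast
    then show ?thesis using Nil by (simp add: linear_0[OF lin(3)] Theta_right_one)
  next
    case (Cons b bs')
    have IH: "d (psi as \<kappa> bs') + (theta_left as \<kappa> bs' + theta_right as \<kappa> bs') = Psi (D (bword as \<kappa> bs'))"
      using less[of as bs'] Cons by simp
    have "Theta_right (D ?x) = rho b (Psi (D (bword as \<kappa> bs'))) - rho b (theta_right as \<kappa> bs')"
      unfolding Cons D_snoc
      by (simp add: linear_add[OF linear_lifts(3)] Psi_cons_snoc Theta_right_last Theta_right_one col_def)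
    moreover have "d (rho b (psi as \<kappa> bs')) = - rho b (d (psi as \<kappa> bs'))"
      using d_rho by (simp add: eq_neg_iff_add_eq_0)
    ultimately show ?thesis
      by (simp add: Cons IH[symmetric] linear_add[OF linear_actions(3)])
  qed
  \<comment> \<open>The mixed terms of the two sides cancel because the actions anticommute.\<close>
  have "(case as of [] \<Rightarrow> 0 | a # as' \<Rightarrow> lam (sA a) (theta_right as' \<kappa> bs))
      + (case bs of [] \<Rightarrow> 0 | b # bs' \<Rightarrow> rho b (theta_left as \<kappa> bs')) = 0"
    using rho_lam by (cases as; cases bs) (simp_all add: linear_0[OF linear_actions(1)] linear_0[OF linear_actions(3)] add.commute)
  then have Q: "d ?th + (Theta_left (D ?x) + Theta_right (D ?x)) = 0"
    unfolding L[symmetric] R[symmetric] by (simp add: linear_add[OF lin(3)] algebra_simps)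
  have P: "d (psi as \<kappa> bs) + ?th = Psi (D ?x)"
  proof (cases "as = [] \<and> bs = []")
    case True
    have "D (bword [] \<kappa> []) = 0"
      by (simp add: D_def) (simp add: phi_def linear_0[OF lin(6)] bar_left_def bar_right_def bword_def one_tens_def[symmetric]
          lin linear_id_map linear_tensor_map)
    with True show ?thesis by (simp add: d_i linear_0[OF linear_lifts(1)])
  next
    case False
    have S: "?th \<in> S"
      by (cases as; cases bs) (auto intro!: carrier subspace_add subspace_0 psi_carrier)
    have "Theta_left (D ?x) + Theta_right (D ?x) = - d ?th"
      using Q by (simp add: eq_neg_iff_add_eq_0 add.commute)
    then have "Psi (D ?x) = - h (d ?th) + i (p ?th)"
      by (simp add: Psi_decomp co_proj_D phi_def linear_neg[OF lin(4)])
    moreover have "d (h ?th) = i (p ?th) - ?th - h (d ?th)"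
      using homotopy[OF S] by (metis add_diff_cancel_right')
    ultimately show ?thesis
      using False by (simp add: psi_theta)
  qed
  show ?case using P Q by simp
qed

text \<open>The component of \<open>D\<close> is \<open>p\<close> of the thetas, and by the morphism
  equation the thetas of \<open>D x\<close> are a boundary, which \<open>p\<close> kills.\<close>

lemma co_proj_D_D: "co_proj (D (D x)) = 0"
proof (rule bword_eqI[of "\<lambda>x. co_proj (D (D x))" "\<lambda>_. 0"])
  fix as \<kappa> bs
  have "Theta_left (D (bword as \<kappa> bs)) + Theta_right (D (bword as \<kappa> bs)) = - d (theta_left as \<kappa> bs + theta_right as \<kappa> bs)"
    using morphism_equation[of as \<kappa> bs] by (simp add: eq_neg_iff_add_eq_0 add.commute)
  then show "co_proj (D (D (bword as \<kappa> bs))) = 0"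
    by (simp add: co_proj_D' linear_neg[OF lin(6)] p_d)
qed (intro linear_compositions' linear_lifts_comp linear_lifts linear_zero)+

lemma tensor_map_neg:
  "linear f \<Longrightarrow> linear g \<Longrightarrow> tensor_map (\<lambda>x. - f x) g t = - tensor_map f g t"
  "linear f \<Longrightarrow> linear g \<Longrightarrow> tensor_map f (\<lambda>x. - g x) t = - tensor_map f g t"
  by (rule tensor_eqI[of "tensor_map _ _"];
      simp add: linear_tensor_map linear_compose_neg tensor_neg)+

lemma phi_koszul: "phi (map sA as) (sK \<kappa>) (map sB bs) = - sK (phi as \<kappa> bs)"
  by (simp add: phi_def theta_koszul p_sM linear_add[OF lin(1)] linear_diff[OF lin(6)] linear_neg[OF lin(6)]
      linear_add[OF lin(6)])

lemma row_word_koszul: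
  "tensor_map sK (map_word sB) (row_word as \<kappa> bs) = - row_word (map sA as) (sK \<kappa>) (map sB bs)"
proof (induction bs)
  case Nil
  show ?case using phi_koszul[of as \<kappa> "[]"] by (simp add: lin tensor_neg)
next
  case (Cons b bs)
  have "tensor_map sK (map_word sB) (tensor_map id (\<lambda>y. y * word [b]) z) =
     tensor_map id (\<lambda>y. y * word [sB b]) (tensor_map sK (map_word sB) z)" for z
    by (simp add: tensor_map_comp lin linear_id_map linear_mult_left B.map_word_mult)
  then show ?case
    using Cons phi_koszul[of as \<kappa> "b # bs"]
    by (simp add: linear_add[OF linear_tensor_map] lin tensor_neg linear_neg[OF linear_tensor_map] linear_id_map linear_mult_left)
qed

lemma koszul_bi_cons: "koszul_bi (cons_left a x) = cons_left (sA a) (koszul_bi x)"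
  by (simp add: koszul_bi_def cons_left_def tensor_map_comp lin linear_mult_right linear_id_map linear_tensor_map
     A.map_word_mult)

lemma inner_word_koszul:
  "koszul_bi (inner_word as \<kappa> bs) = - inner_word (map sA as) (sK \<kappa>) (map sB bs)"
proof -
  have "koszul_bi (1 \<otimes> z) = 1 \<otimes> tensor_map sK (map_word sB) z" for z
    by (simp add: koszul_bi_def lin linear_tensor_map)
  then show ?thesis
    by (induction as)
      (simp_all add: row_word_koszul tensor_neg linear_add[OF linear_operators(5)] koszul_bi_cons
        linear_neg[OF linear_operators(1)] row_word_koszul[of "a # as" for a as, simplified])
qed

text \<open>Oddness of \<open>D\<close>, needed for the mixed terms of the right coaction in
  \<open>D_D\<close> to cancel.\<close>

lemma koszul_bi_D: "koszul_bi (D x) = - D (koszul_bi x)"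
proof -
  have "koszul_bi (bar_left x) = - bar_left (koszul_bi x)"
    by (simp add: koszul_bi_def bar_left_def tensor_map_comp lin linear_tensor_map linear_id_map A.map_word_bar
        tensor_map_neg linear_comp[OF A.linear_map_word])
  moreover have "koszul_bi (bar_right x) = - bar_right (koszul_bi x)"
    by (simp add: koszul_bi_def bar_right_def tensor_map_comp lin linear_tensor_map B.map_word_bar
        tensor_map_neg linear_comp[OF _ linear_tensor_map] linear_comp[OF B.linear_map_word] linear_comp[OF A.linear_map_word]
        linear_comp[OF lin(1)])
  moreover have "koszul_bi (inner x) = - inner (koszul_bi x)"
    by (rule bword_eqI[of "\<lambda>x. koszul_bi (inner x)"])
      (intro linear_operators_comp linear_lifts, intro linear_compose_neg linear_lifts_comp linear_operators,
       simp add: inner_word_koszul koszul_bi_bword)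
  ultimately show ?thesis by (simp add: D_def linear_add[OF linear_operators(5)])
qed

text \<open>Induction over the letters of A: \<open>D_Cons\<close> and the left coaction both split
  off the same letter, and the extra terms match by \<open>left_coaction_map\<close>.\<close>

lemma left_coaction_D:
  "left_coaction (D x) = tensor_map (bar sA mA) id (left_coaction x) + tensor_map (map_word sA) D (left_coaction x)"
proof (rule bword_eqI[of "\<lambda>x. left_coaction (D x)"])
  fix as \<kappa> bs
  show "left_coaction (D (bword as \<kappa> bs)) =
     tensor_map (bar sA mA) id (left_coaction (bword as \<kappa> bs)) + tensor_map (map_word sA) D (left_coaction (bword as \<kappa> bs))"
  proof (induction as)
    case Nil
    obtain z where z: "D (bword [] \<kappa> bs) = 1 \<otimes> z" using D_Nil_left by blast
    have "left_coaction (bword [] \<kappa> bs) = 1 \<otimes> bword [] \<kappa> bs"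
      by (simp add: bword_def one_tens_def[symmetric] left_coaction_one)
    then show ?case by (simp add: z lin id_def linear_ident linear_lifts left_coaction_one)
  next
    case (Cons a as)
    let ?x = "bword as \<kappa> bs"
    have cons: "left_coaction (cons_left a y) = 1 \<otimes> cons_left a y + tensor_map (\<lambda>x. word [a] * x) id (left_coaction y)" for a y
      unfolding cons_left_def by (rule left_coaction_map) (rule linear_mult_right comult_Cons)+
    have head: "left_coaction (head_left a y) = 1 \<otimes> head_left a y + tensor_map (mult_head mA a) id (left_coaction y)" for a y
      unfolding head_left_def by (rule left_coaction_map) (rule lin A.comult_mult_head)+
    have 1: "tensor_map (bar sA mA) id (tensor_map (\<lambda>x. word [a] * x) id t) =
        tensor_map (\<lambda>x. word [sA a] * x) id (tensor_map (bar sA mA) id t) + tensor_map (mult_head mA a) id t"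
      for t :: "('a tens, ('a, 'k, 'b) bitens) tensor"
      by (simp add: tensor_map_comp lin linear_mult_right linear_id_map A.bar_Cons
        tensor_map_add_left linear_comp[OF _ linear_mult_right] id_def[symmetric])
    have 2: "tensor_map (map_word sA) D (tensor_map (\<lambda>x. word [a] * x) id t) =
        tensor_map (\<lambda>x. word [sA a] * x) id (tensor_map (map_word sA) D t)" for t
      by (simp add: tensor_map_comp lin linear_mult_right linear_id_map linear_lifts A.map_word_mult)
    have "tensor_map (bar sA mA) id (1 \<otimes> cons_left a ?x) = 0"
      "tensor_map (map_word sA) D (1 \<otimes> cons_left a ?x) = 1 \<otimes> D (cons_left a ?x)"
      using lin linear_lifts by (simp_all add: id_def linear_ident)
    then show ?case
      by (simp only: bword_Cons cons linear_add[OF linear_tensor_map] linear_add[OF linear_left_coaction]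
          lin linear_id_map linear_lifts 1 2 Cons head left_coaction_one D_Cons[unfolded bword_Cons] linear_mult_right tensor_simps)
       (simp add: algebra_simps)
  qed
qed (intro linear_compositions' linear_intros linear_lifts lin)+

lemma comult_mult_last:
  "comult (mult_last sB mB b y) = mult_last sB mB b y \<otimes> 1 + tensor_map (map_word sB) (mult_last sB mB b) (comult y)"
proof (rule tens_eqI[of "\<lambda>y. comult (mult_last sB mB b y)"])
  fix ys
  show "comult (mult_last sB mB b (word ys)) =
    mult_last sB mB b (word ys) \<otimes> 1 + tensor_map (map_word sB) (mult_last sB mB b) (comult (word ys))"
  proof (cases ys rule: rev_cases)
    case Nil
    then show ?thesis
      by (simp add: one_tens_def[symmetric] linear_0[OF linear_comult] comult_one lin)
  next
    case (snoc zs c)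
    have "comult (word (map sB zs)) = tensor_map (map_word sB) (map_word sB) (comult (word zs))"
      by (simp add: comult_word linear_sum[OF linear_tensor_map] lin take_map drop_map)
    then show ?thesis
      by (simp add: snoc word_snoc[of zs] B.mult_last_snoc comult_snoc linear_add[OF linear_tensor_map] lin
          linear_id_map tensor_map_comp linear_mult_left)
  qed
qed (intro linear_intros lin linear_comp[OF B.linear_mult_last])+

lemma right_coaction_D:
  "right_coaction (D x) = tensor_map D id (right_coaction x) + tensor_map koszul_bi (bar sB mB) (right_coaction x)"
proof (rule bword_eqI[of "\<lambda>x. right_coaction (D x)"])
  fix as \<kappa> bs
  show "right_coaction (D (bword as \<kappa> bs)) =
     tensor_map D id (right_coaction (bword as \<kappa> bs)) + tensor_map koszul_bi (bar sB mB) (right_coaction (bword as \<kappa> bs))"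
  proof (induction bs)
    case Nil
    obtain z where z: "D (bword as \<kappa> []) = assoc_right (z \<otimes> 1)" using D_Nil_right by blast
    have "right_coaction (bword as \<kappa> []) = bword as \<kappa> [] \<otimes> 1"
      using right_coaction_one[of "word as \<otimes> \<kappa>"] by (simp add: bword_def one_tens_def[symmetric])
    then show ?case
      by (simp add: z lin linear_operators id_def linear_ident linear_lifts right_coaction_one)
  next
    case (Cons b bs)
    let ?x = "bword as \<kappa> bs"
    have snoc: "right_coaction (snoc_right b y) = snoc_right b y \<otimes> 1 + tensor_map id (\<lambda>x. x * word [b]) (right_coaction y)" for y
    proof -
      have I: "tensor_map id id = (id :: ('u::real_vector, 'v::real_vector) tensor \<Rightarrow> _)"
      proof
        show "tensor_map id id t = (id t :: ('u, 'v) tensor)" for t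
          by (rule tensor_eqI[of "tensor_map id id" id]) (simp_all add: linear_tensor_map linear_id_map)
      qed
      show ?thesis
        unfolding snoc_right_def
        by (rule right_coaction_map[of id id id, unfolded I]) (rule linear_id_map linear_mult_left comult_snoc)+
    qed
    have last: "right_coaction (last_right b y) = last_right b y \<otimes> 1 + tensor_map koszul_bi (mult_last sB mB b) (right_coaction y)" for y
      unfolding last_right_def koszul_bi_def
      by (rule right_coaction_map) (rule lin comult_mult_last)+
    have 1: "tensor_map koszul_bi (bar sB mB) (tensor_map id (\<lambda>x. x * word [b]) t) =
        tensor_map id (\<lambda>x. x * word [b]) (tensor_map koszul_bi (bar sB mB) t) + tensor_map koszul_bi (mult_last sB mB b) t"
      for t
      by (simp add: tensor_map_comp lin linear_operators linear_mult_left linear_id_map B.bar_snoc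
        tensor_map_add_right linear_comp[OF _ linear_mult_left])
    have 2: "tensor_map D id (tensor_map id (\<lambda>x. x * word [b]) t) =
        tensor_map id (\<lambda>x. x * word [b]) (tensor_map D id t)" for t :: "(('a, 'k, 'b) bitens, 'b tens) tensor"
      by (simp add: tensor_map_comp lin linear_mult_left linear_id_map linear_lifts)
    have "tensor_map koszul_bi (bar sB mB) (snoc_right b ?x \<otimes> 1) = 0"
      "tensor_map D id (snoc_right b ?x \<otimes> 1) = D (snoc_right b ?x) \<otimes> 1"
      using lin linear_lifts linear_operators by (simp_all add: id_def linear_ident)
    note 3 = this[unfolded D_snoc[unfolded bword_snoc]]
    show ?case
      by (simp only: bword_snoc 3 snoc linear_add[OF linear_tensor_map] linear_add[OF linear_right_coaction]
          lin linear_operators linear_id_map linear_lifts 1 2 Cons last right_coaction_one col_def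
          D_snoc[unfolded bword_snoc] linear_mult_left tensor_simps)
       (simp add: algebra_simps)
  qed
qed (intro linear_compositions' linear_intros linear_lifts lin linear_operators)+

text \<open>The mixed terms in the coactions of the square cancel by oddness and the squares of the
  bar differentials vanish. What remains is a twisted morphism of bicomodules with zero component,
  to which \<open>bicomodule_morphism_zero\<close> applies.\<close>

lemma D_D: "D (D x) = 0"
proof (rule bicomodule_morphism_zero[of "\<lambda>x. D (D x)" "\<lambda>x. map_word sA (map_word sA x)"])
  note L = linear_lifts lin linear_operators
  show "linear (\<lambda>x. D (D x))" by (intro linear_lifts_comp linear_lifts)
  show "linear (\<lambda>x. map_word sA (map_word sA x))" by (intro linear_comp[OF A.linear_map_word A.linear_map_word])
  show "left_coaction (D (D x)) = tensor_map (\<lambda>x. map_word sA (map_word sA x)) (\<lambda>x. D (D x)) (left_coaction x)" for x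
    by (simp add: left_coaction_D linear_add[OF linear_tensor_map] L linear_id_map tensor_map_comp A.bar_bar
       tensor_map_zero tensor_map_zero(2)[OF linear_ident] A.map_word_bar tensor_map_neg linear_comp[OF A.linear_map_word A.linear_bar])
  show "right_coaction (D (D x)) = tensor_map (\<lambda>x. D (D x)) id (right_coaction x)" for x
    by (simp add: right_coaction_D linear_add[OF linear_tensor_map] L linear_id_map tensor_map_comp B.bar_bar
       tensor_map_zero koszul_bi_D tensor_map_neg linear_comp[OF linear_operators(5) linear_lifts(5)]
       linear_comp[OF linear_operators(5) linear_operators(5)] id_def[symmetric])
qed (rule co_proj_D_D)

lemma bitaylor_D: "bitaylor D as \<kappa> (rev bs) = phi as \<kappa> bs"
  using co_proj_D[of as \<kappa> bs] by (simp add: bitaylor_eq bword_def)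

end

section \<open>Gradings\<close>

text \<open>A character \<open>c\<close> of \<open>\<int>\<close> acts on a graded space by \<open>c i\<close> in degree \<open>i\<close>. The character \<open>2^i\<close>
  separates degrees, so it witnesses that a sum of subspaces is direct; the character \<open>(-1)^i\<close> is the
  Koszul sign. Unlike directness, the existence of these operators passes to tensor products and quotients
  by explicit formulas.\<close>

definition character :: "(int \<Rightarrow> real) \<Rightarrow> bool" where
  "character c \<longleftrightarrow> c 0 = 1 \<and> (\<forall>i j. c (i + j) = c i * c j)"

definition acts_by :: "(int \<Rightarrow> real) \<Rightarrow> (int \<Rightarrow> 'v::real_vector set) \<Rightarrow> ('v \<Rightarrow> 'v) \<Rightarrow> bool" where
  "acts_by c G f \<longleftrightarrow> linear f \<and> (\<forall>i. \<forall>x\<in>G i. f x = c i *\<^sub>R x)"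

definition graded_by_characters :: "(int \<Rightarrow> 'v::real_vector set) \<Rightarrow> bool" where
  "graded_by_characters G \<longleftrightarrow> (\<forall>i. subspace (G i)) \<and> (\<forall>c. character c \<longrightarrow> (\<exists>f. acts_by c G f))"

lemma character_sign: "character sign"
  by (auto simp: character_def sign_def)

lemma sign_simps: "sign (i + j) = sign i * sign j" "sign (i - j) = sign i * sign j" "sign 1 = -1" "sign (- i) = sign i"
  "sign i * sign i = 1" "sign 0 = 1"
  by (auto simp: sign_def)

lemma character_power2: "character (\<lambda>i. 2 powi i)"
  by (auto simp: character_def power_int_add)

lemma graded_space_of_characters:
  assumes "graded_by_characters G"
  shows "graded_space G"
proof -
  obtain f where f: "acts_by (\<lambda>i. 2 powi i) G f"
    using assms character_power2 by (auto simp: graded_by_characters_def)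
  then have lf: "linear f" and fG: "\<And>i x. x \<in> G i \<Longrightarrow> f x = (2 powi i) *\<^sub>R x"
    by (auto simp: acts_by_def)
  have sub: "subspace (G i)" for i
    using assms by (auto simp: graded_by_characters_def)
  have "\<forall>x. (\<forall>i\<in>I. x i \<in> G i) \<longrightarrow> (\<Sum>i\<in>I. x i) = 0 \<longrightarrow> (\<forall>i\<in>I. x i = 0)" if "finite I" for I :: "int set"
    using that
  proof (induction I rule: finite_induct)
    case (insert j I)
    show ?case
    proof (intro allI impI)
      fix x assume x: "\<forall>i\<in>insert j I. x i \<in> G i" and s: "(\<Sum>i\<in>insert j I. x i) = 0"
      \<comment> \<open>Applying \<open>f\<close> to the sum and subtracting \<open>2 powi j\<close>
        times the sum removes the summand with index \<open>j\<close> and rescales the others by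
        nonzero factors.\<close>
      define y where "y i = (2 powi i - 2 powi j) *\<^sub>R x i" for i
      have "(\<Sum>i\<in>insert j I. (2 powi i) *\<^sub>R x i) = f (\<Sum>i\<in>insert j I. x i)"
        unfolding linear_sum[OF lf] using x fG by (intro sum.cong) auto
      also have "\<dots> = 0" using s linear_0[OF lf] by simp
      finally have "(\<Sum>i\<in>insert j I. (2 powi i) *\<^sub>R x i) - (2 powi j) *\<^sub>R (\<Sum>i\<in>insert j I. x i) = 0"
        using s by simp
      then have "(\<Sum>i\<in>insert j I. y i) = 0"
        by (simp add: y_def scaleR_sum_right scaleR_diff_left sum_subtractf del: sum.insert)
      then have "(\<Sum>i\<in>I. y i) = 0" using insert.hyps by (simp add: y_def)
      moreover have "\<forall>i\<in>I. y i \<in> G i" using x sub by (auto simp: y_def subspace_scale)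
      ultimately have "\<forall>i\<in>I. y i = 0" using insert.IH by blast
      moreover have "2 powi i \<noteq> (2::real) powi j" if "i \<in> I" for i
      proof -
        have "i < j \<or> j < i" using that insert.hyps by (metis linorder_neqE)
        then show ?thesis
          using power_int_strict_increasing[of i j "2::real"] power_int_strict_increasing[of j i "2::real"] by auto
      qed
      ultimately have I: "\<forall>i\<in>I. x i = 0" by (simp add: y_def)
      with s insert.hyps have "x j = 0" by simp
      with I show "\<forall>i\<in>insert j I. x i = 0" by simp
    qed
  qed simp
  then show ?thesis using sub by (simp add: graded_space_def)
qed

lemma koszul:
  assumes "graded_by_characters G"
  shows "linear (koszul G)" "x \<in> G i \<Longrightarrow> koszul G x = sign i *\<^sub>R x"
proof -
  have "\<exists>f. linear f \<and> (\<forall>i. \<forall>x\<in>G i. f x = sign i *\<^sub>R x)"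
    using assms character_sign by (auto simp: graded_by_characters_def acts_by_def)
  from someI_ex[OF this, folded koszul_def]
  show "linear (koszul G)" "x \<in> G i \<Longrightarrow> koszul G x = sign i *\<^sub>R x" by auto
qed

lemma graded_by_characters_in_degree: "subspace C \<Longrightarrow> graded_by_characters (in_degree d C)"
  unfolding graded_by_characters_def
proof (intro conjI allI impI)
  show "\<exists>f. acts_by c (in_degree d C) f" for c
    by (rule exI[of _ "\<lambda>x. c d *\<^sub>R x"])
      (simp add: acts_by_def in_degree_def linear_compose_scale_right[OF linear_ident])
qed (auto simp: in_degree_def subspace_single_0)

lemma graded_by_characters_shift:
  assumes "graded_by_characters G"
  shows "graded_by_characters (shift1 G)"
proof -
  have "\<exists>f. acts_by c (shift1 G) f" if c: "character c" for c
  proof -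
    obtain f where f: "acts_by c G f" using assms c by (auto simp: graded_by_characters_def)
    have ci: "c (- 1) * c (i + 1) = c i" for i
      using c unfolding character_def by (metis add.left_commute add.right_inverse add.right_neutral)
    from f have "acts_by c (shift1 G) (\<lambda>x. c (- 1) *\<^sub>R f x)"
      by (auto simp: ci acts_by_def shift1_def intro!: linear_compose_scale_right)
    then show ?thesis by blast
  qed
  with assms show ?thesis by (auto simp: graded_by_characters_def shift1_def)
qed

lemma acts_by_span:
  assumes "linear f" "\<And>x. x \<in> X \<Longrightarrow> f x = c *\<^sub>R x" "y \<in> span X"
  shows "f y = c *\<^sub>R y"
  by (rule linear_eq_on_span[OF assms(1) linear_compose_scale_right[OF linear_ident] _ assms(3)]) (use assms(2) in auto)

lemma acts_by_tensor:
  assumes "character c" "acts_by c G f" "acts_by c H g"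
  shows "acts_by c (tensor_grading G H) (tensor_map f g)"
  unfolding acts_by_def tensor_grading_def
proof (intro conjI allI ballI)
  show L: "linear (tensor_map f g)"
    using assms by (intro linear_tensor_map) (auto simp: acts_by_def)
  show "tensor_map f g x = c n *\<^sub>R x" if "x \<in> span {x \<otimes> y |x y i j. x \<in> G i \<and> y \<in> H j \<and> i + j = n}" for n x
    by (rule acts_by_span[OF L _ that]) (use assms in \<open>auto simp: acts_by_def character_def tensor_simps\<close>)
qed

lemma subspace_tensor_grading: "subspace (tensor_grading G H n)"
  by (simp add: tensor_grading_def)

lemma subspace_tens_grading: "subspace (tens_grading G n)"
  by (simp add: tens_grading_def)

lemma graded_by_characters_tensor:
  "graded_by_characters G \<Longrightarrow> graded_by_characters H \<Longrightarrow> graded_by_characters (tensor_grading G H)"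
  unfolding graded_by_characters_def
  by (intro conjI allI impI; blast intro: acts_by_tensor subspace_tensor_grading)

text \<open>Only \<open>s\<close> matters for \<open>map_word\<close>, so its lemmas are taken from the locale with zero product.\<close>

lemma bar_algebra_zero: "linear s \<Longrightarrow> bar_algebra s (\<lambda>_ _. 0)"
  by (rule bar_algebra.intro) (simp_all add: bilinear_def linear_zero linear_0)

lemmas map_word_facts =
  bar_algebra.linear_map_word[OF bar_algebra_zero] bar_algebra.map_word_word[OF bar_algebra_zero]
  bar_algebra.map_word_mult[OF bar_algebra_zero] bar_algebra.map_word_one[OF bar_algebra_zero]

lemma word_scaled:
  assumes c: "character c" and "list_all2 (\<lambda>x d. f x = c d *\<^sub>R x) xs ds"
  shows "word (map f xs) = c (sum_list ds) *\<^sub>R word xs"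
  using assms(2)
proof (induction xs ds rule: list_all2_induct)
  case Nil
  show ?case using c by (simp add: character_def)
next
  case (Cons x xs d ds)
  have "word (map f (x # xs)) = c d *\<^sub>R (word [x] * word (map f xs))"
    using Cons.hyps linear_cmul[OF linear_word_Cons] by (simp add: word_mult)
  also have "\<dots> = c (sum_list (d # ds)) *\<^sub>R word (x # xs)"
    unfolding Cons.IH using c by (simp add: character_def word_mult)
  finally show ?case .
qed

lemma acts_by_tens:
  assumes "character c" "acts_by c G f"
  shows "acts_by c (tens_grading G) (map_word f)"
  unfolding acts_by_def tens_grading_def
proof (intro conjI allI ballI)
  have f: "linear f" using assms by (auto simp: acts_by_def)
  show L: "linear (map_word f)" by (rule map_word_facts[OF f])
  show "map_word f x = c n *\<^sub>R x" if "x \<in> span {word xs |xs ds. list_all2 (\<lambda>x d. x \<in> G d) xs ds \<and> sum_list ds = n}" for n x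
  proof (rule acts_by_span[OF L _ that])
    fix y assume "y \<in> {word xs |xs ds. list_all2 (\<lambda>x d. x \<in> G d) xs ds \<and> sum_list ds = n}"
    then obtain xs ds where y: "y = word xs" "list_all2 (\<lambda>x d. x \<in> G d) xs ds" "sum_list ds = n" by auto
    then have "list_all2 (\<lambda>x d. f x = c d *\<^sub>R x) xs ds"
      using assms(2) by (auto simp: acts_by_def elim!: list_all2_mono)
    from word_scaled[OF assms(1) this] show "map_word f y = c n *\<^sub>R y" using y f by (simp add: map_word_facts)
  qed
qed

lemma graded_by_characters_tens: "graded_by_characters G \<Longrightarrow> graded_by_characters (tens_grading G)"
  unfolding graded_by_characters_def
  by (intro conjI allI impI; blast intro: acts_by_tens subspace_tens_grading)

section \<open>Total spaces and suspended products\<close>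

lemma subspace_total: "subspace (total G)"
  by (simp add: total_def)

lemma homog_total: "x \<in> G i \<Longrightarrow> x \<in> total G"
  by (auto simp: total_def intro: span_base)

lemma total_eqI:
  assumes "linear f" "linear g" "\<And>i x. x \<in> G i \<Longrightarrow> f x = g x" "x \<in> total G"
  shows "f x = g x"
  by (rule linear_eq_on_span[OF assms(1,2) _ assms(4)[unfolded total_def]]) (use assms(3) in auto)

lemma total_closed:
  assumes "linear f" "subspace T" "\<And>i x. x \<in> G i \<Longrightarrow> f x \<in> T" "x \<in> total G"
  shows "f x \<in> T"
proof -
  have "f ` (\<Union>i. G i) \<subseteq> T" using assms by auto
  then have "f ` span (\<Union>i. G i) \<subseteq> T"
    using assms(1,2) by (simp add: linear_span_image[symmetric] span_minimal)
  then show ?thesis using assms(4) by (auto simp: total_def)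
qed

text \<open>\<open>quot (total G)\<close> is an idempotent with kernel \<open>total G\<close>, so
  its complement is a linear projection onto the total space.\<close>

definition grade_proj :: "(int \<Rightarrow> 'v::real_vector set) \<Rightarrow> 'v \<Rightarrow> 'v" where
  "grade_proj G x = x - quot (total G) x"

lemma grade_proj:
  shows linear_grade_proj: "linear (grade_proj G)"
    and grade_proj_total: "grade_proj G x \<in> total G"
    and grade_proj_id: "x \<in> total G \<Longrightarrow> grade_proj G x = x"
proof -
  note q = quot[OF subspace_total[of G]]
  show "linear (grade_proj G)"
    unfolding grade_proj_def by (intro linear_compose_sub linear_ident q)
  have "quot (total G) (grade_proj G x) = 0"
    by (simp add: grade_proj_def linear_diff[OF q(1)] q(2))
  then show "grade_proj G x \<in> total G" by (simp add: q(3))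
  show "x \<in> total G \<Longrightarrow> grade_proj G x = x" by (simp add: grade_proj_def q(3))
qed

lemma grade_proj_homog: "x \<in> G i \<Longrightarrow> grade_proj G x = x"
  by (rule grade_proj_id[OF homog_total])

lemma grade_proj_idem: "grade_proj G (grade_proj G x) = grade_proj G x"
  by (simp add: grade_proj_id grade_proj_total)

text \<open>For maps that factor through the projection, an identity on homogeneous elements is an
  identity on the whole type. This is how the axioms of \<open>bar_algebra\<close> and
  \<open>bimodule_transfer\<close> are obtained.\<close>

lemma grade_proj_eqI:
  assumes "linear f" "linear g" "\<And>x. f (grade_proj G x) = f x" "\<And>x. g (grade_proj G x) = g x"
    "\<And>i x. x \<in> G i \<Longrightarrow> f x = g x"
  shows "f x = g x"
proof -
  have "f (grade_proj G x) = g (grade_proj G x)"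
    by (rule total_eqI[OF assms(1,2,5) grade_proj_total])
  then show ?thesis using assms(3,4) by simp
qed

text \<open>The sign \<open>(-1)^(i-1)\<close> of the suspension of an element of degree \<open>i\<close>. Precomposed with the
  projection, identities of the algebra hold on the whole type and not only on the total space.\<close>

definition susp_sign :: "(int \<Rightarrow> 'v::real_vector set) \<Rightarrow> 'v \<Rightarrow> 'v" where
  "susp_sign G x = koszul (shift1 G) (grade_proj G x)"

lemma
  assumes G: "graded_by_characters G"
  shows linear_susp_sign: "linear (susp_sign G)"
    and susp_sign_homog: "x \<in> G i \<Longrightarrow> susp_sign G x = - sign i *\<^sub>R x"
    and susp_sign_proj: "susp_sign G (grade_proj G x) = susp_sign G x"
    and susp_sign_closed: "x \<in> G i \<Longrightarrow> susp_sign G x \<in> G i"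
proof -
  note k = koszul[OF graded_by_characters_shift[OF G]]
  show L: "linear (susp_sign G)"
    unfolding susp_sign_def by (rule linear_comp[OF linear_grade_proj k(1)])
  show h: "susp_sign G x = - sign i *\<^sub>R x" if "x \<in> G i" for x i
    using k(2)[of _ "i - 1"] that by (simp add: susp_sign_def grade_proj_homog[where i = i] shift1_def sign_simps)
  show p: "susp_sign G (grade_proj G x) = susp_sign G x" for x
    by (simp add: susp_sign_def grade_proj_idem)
  show c: "susp_sign G x \<in> G i" if "x \<in> G i" for x i
    using that G by (simp add: h[where i = i] graded_by_characters_def subspace_neg subspace_scale)
qed

definition graded_algebra :: "'a::real_vector galg \<Rightarrow> bool" where
  "graded_algebra A \<longleftrightarrow> graded_by_characters (homog A) \<and> bilinear (gmult A)
     \<and> (\<forall>i j. \<forall>a\<in>homog A i. \<forall>b\<in>homog A j. gmult A a b \<in> homog A (i + j))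
     \<and> (\<forall>a\<in>total (homog A). \<forall>b\<in>total (homog A). \<forall>c\<in>total (homog A).
           gmult A (gmult A a b) c = gmult A a (gmult A b c))"

text \<open>\<open>susp_sign\<close> supplies the sign (-1)^(|a|-1) of the suspension and contains
  the projection of \<open>a\<close>; with \<open>b\<close> projected as well, the product is
  associative up to sign on the whole type.\<close>

definition susp_mult :: "'a::real_vector galg \<Rightarrow> 'a \<Rightarrow> 'a \<Rightarrow> 'a" where
  "susp_mult A a b = gmult A (susp_sign (homog A) a) (grade_proj (homog A) b)"

lemma linear_bilinear: "bilinear m \<Longrightarrow> linear (m a)" "bilinear m \<Longrightarrow> linear (\<lambda>a. m a b)"
  by (auto simp: bilinear_def)

context
  fixes A :: "'a::real_vector galg"
  assumes A: "graded_algebra A"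
begin

lemma graded_algebra_facts:
  shows "graded_by_characters (homog A)" "bilinear (gmult A)"
    "a \<in> homog A i \<Longrightarrow> b \<in> homog A j \<Longrightarrow> gmult A a b \<in> homog A (i + j)"
    "a \<in> total (homog A) \<Longrightarrow> b \<in> total (homog A) \<Longrightarrow> c \<in> total (homog A) \<Longrightarrow>
       gmult A (gmult A a b) c = gmult A a (gmult A b c)"
  using A by (auto simp: graded_algebra_def)

lemma bilinear_susp_mult: "bilinear (susp_mult A)"
  unfolding bilinear_def susp_mult_def
  using linear_comp[OF linear_grade_proj linear_bilinear(1)[OF graded_algebra_facts(2)]]
    linear_comp[OF linear_susp_sign[OF graded_algebra_facts(1)] linear_bilinear(2)[OF graded_algebra_facts(2)]]
  by auto

lemma susp_mult_homog:
  assumes "a \<in> homog A i" "b \<in> total (homog A)"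
  shows "susp_mult A a b = - sign i *\<^sub>R gmult A a b"
  using assms linear_cmul[OF linear_bilinear(2)[OF graded_algebra_facts(2)], of "- sign i" a b]
  by (simp add: susp_mult_def susp_sign_homog[OF graded_algebra_facts(1)] grade_proj_id)

lemma susp_mult_closed:
  assumes "a \<in> homog A i" "b \<in> homog A j"
  shows "susp_mult A a b \<in> homog A (i + j)"
  using graded_algebra_facts(1) graded_algebra_facts(3)[OF assms]
  by (simp add: susp_mult_homog[OF assms(1) homog_total[of _ "homog A", OF assms(2)]] graded_by_characters_def subspace_neg subspace_scale)

lemma susp_mult_proj:
  "susp_mult A (grade_proj (homog A) a) b = susp_mult A a b"
  "susp_mult A a (grade_proj (homog A) b) = susp_mult A a b"
  by (simp_all add: susp_mult_def susp_sign_proj[OF graded_algebra_facts(1)] grade_proj_idem)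

text \<open>The arguments are reduced to homogeneous ones in turn by \<open>grade_proj_eqI\<close>;
  for homogeneous arguments each axiom is a computation with signs.\<close>

lemma bar_algebra_susp: "bar_algebra (susp_sign (homog A)) (susp_mult A)"
proof (rule bar_algebra.intro)
  let ?s = "susp_sign (homog A)" and ?m = "susp_mult A"
  note ls = linear_susp_sign[OF graded_algebra_facts(1)]
  note lm = linear_bilinear[OF bilinear_susp_mult]
  note sh = susp_sign_homog[OF graded_algebra_facts(1)]
  note sp = susp_sign_proj[OF graded_algebra_facts(1)]
  note mc = linear_cmul[OF lm(1)] linear_cmul[OF lm(2)] linear_neg[OF lm(1)] linear_neg[OF lm(2)]
  show "linear ?s" "bilinear ?m" by (rule ls bilinear_susp_mult)+
  note comps = linear_compose_neg linear_compose_add ls lm linear_comp[OF _ ls] linear_comp[OF _ lm(1)]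
    linear_comp[OF _ lm(2)]
  have 1: "?s (?m a b) = - ?m (?s a) (?s b)" if a: "a \<in> homog A i" and b: "b \<in> homog A j" for a b i j
    using sh[OF susp_mult_closed[OF a b]] sh[OF a] sh[OF b] by (simp add: mc sign_simps)
  have 2: "?s (?m a b) = - ?m (?s a) (?s b)" if "a \<in> homog A i" for a b i
    by (rule grade_proj_eqI[where G = "homog A" and f = "\<lambda>b. ?s (?m a b)"])
      (intro comps, intro comps, auto simp: susp_mult_proj sp intro: 1 that)
  show "?s (?m a b) = - ?m (?s a) (?s b)" for a b
    by (rule grade_proj_eqI[where G = "homog A" and f = "\<lambda>a. ?s (?m a b)"])
      (intro comps, intro comps, auto simp: susp_mult_proj sp intro: 2)
  note ht = homog_total[of _ "homog A"]
  have 3: "?m (?m a b) c + ?m (?s a) (?m b c) = 0"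
    if a: "a \<in> homog A i" and b: "b \<in> homog A j" and c: "c \<in> homog A k" for a b c i j k
  proof -
    note ab = graded_algebra_facts(3)[OF a b] and bc = graded_algebra_facts(3)[OF b c]
    have "?m (?m a b) c = (sign i * sign (i + j)) *\<^sub>R gmult A (gmult A a b) c"
      using susp_mult_homog[OF a ht[OF b]] susp_mult_homog[OF ab ht[OF c]] by (simp add: mc)
    moreover have "?m (?s a) (?m b c) = - (sign i * sign i * sign j) *\<^sub>R gmult A a (gmult A b c)"
      using sh[OF a] susp_mult_homog[OF b ht[OF c]] susp_mult_homog[OF a ht[OF bc]] by (simp add: mc)
    ultimately show ?thesis
      using graded_algebra_facts(4)[OF ht[OF a] ht[OF b] ht[OF c]] by (simp add: sign_simps)
  qed
  have 4: "?m (?m a b) c + ?m (?s a) (?m b c) = 0" if "a \<in> homog A i" "b \<in> homog A j" for a b c i j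
    by (rule grade_proj_eqI[where G = "homog A" and f = "\<lambda>c. ?m (?m a b) c + ?m (?s a) (?m b c)" and g = "\<lambda>_. 0"])
      (intro comps, intro linear_zero, auto simp: susp_mult_proj intro: 3 that)
  have 5: "?m (?m a b) c + ?m (?s a) (?m b c) = 0" if "a \<in> homog A i" for a b c i
    by (rule grade_proj_eqI[where G = "homog A" and f = "\<lambda>b. ?m (?m a b) c + ?m (?s a) (?m b c)" and g = "\<lambda>_. 0"])
      (intro comps, intro linear_zero, auto simp: susp_mult_proj intro: 4 that)
  show "?m (?m a b) c + ?m (?s a) (?m b c) = 0" for a b c
    by (rule grade_proj_eqI[where G = "homog A" and f = "\<lambda>a. ?m (?m a b) c + ?m (?s a) (?m b c)" and g = "\<lambda>_. 0"])
      (intro comps, intro linear_zero, auto simp: susp_mult_proj sp intro: 5)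
qed

end

section \<open>Homogeneous words and the bar construction of a graded algebra\<close>

definition homog_word :: "(int \<Rightarrow> 'v::real_vector set) \<Rightarrow> 'v list \<Rightarrow> int \<Rightarrow> bool" where
  "homog_word G xs n \<longleftrightarrow> (\<exists>ds. list_all2 (\<lambda>x d. x \<in> G d) xs ds \<and> sum_list ds = n)"

lemma tens_grading_eq: "tens_grading G n = span {word xs | xs. homog_word G xs n}"
  unfolding tens_grading_def homog_word_def by (rule arg_cong[of _ _ span]) auto

lemma homog_word_Nil [simp]: "homog_word G [] n \<longleftrightarrow> n = 0"
  by (auto simp: homog_word_def)

lemma homog_word_Cons: "homog_word G (x # xs) n \<longleftrightarrow> (\<exists>i. x \<in> G i \<and> homog_word G xs (n - i))"
  by (force simp: homog_word_def list_all2_Cons1)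

lemma homog_word_append:
  "homog_word G (xs @ ys) n \<longleftrightarrow> (\<exists>i. homog_word G xs i \<and> homog_word G ys (n - i))"
proof (induction xs arbitrary: n)
  case (Cons x xs)
  have "(\<exists>i. x \<in> G i \<and> (\<exists>j. homog_word G xs j \<and> homog_word G ys (n - i - j))) \<longleftrightarrow>
        (\<exists>k. (\<exists>i. x \<in> G i \<and> homog_word G xs (k - i)) \<and> homog_word G ys (n - k))" (is "?L \<longleftrightarrow> ?R")
  proof
    assume ?L
    then obtain i j where ij: "x \<in> G i" "homog_word G xs j" "homog_word G ys (n - i - j)" by blast
    then have "homog_word G xs (i + j - i)" "homog_word G ys (n - (i + j))" by (simp_all add: diff_diff_eq)
    with ij(1) show ?R by blast
  next
    assume ?R
    then obtain k i where ik: "x \<in> G i" "homog_word G xs (k - i)" "homog_word G ys (n - k)" by blast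
    then have "homog_word G ys (n - i - (k - i))" by simp
    with ik show ?L by blast
  qed
  then show ?case by (simp add: homog_word_Cons Cons)
qed simp

lemma homog_word_rev: "homog_word G (rev xs) n \<longleftrightarrow> homog_word G xs n"
  by (induction xs arbitrary: n) (auto simp: homog_word_append homog_word_Cons algebra_simps)

lemma word_tens_grading: "homog_word G xs n \<Longrightarrow> word xs \<in> tens_grading G n"
  unfolding tens_grading_eq by (auto intro: span_base)

lemma linear_span_subset:
  assumes "linear f" "subspace T" "\<And>x. x \<in> X \<Longrightarrow> f x \<in> T" "x \<in> span X"
  shows "f x \<in> T"
proof -
  have "f ` span X \<subseteq> T"
    unfolding linear_span_image[OF assms(1), symmetric] by (rule span_minimal) (use assms in auto)
  with assms(4) show ?thesis by auto
qed

lemma homog_word_ConsI: "a \<in> G i \<Longrightarrow> homog_word G xs n \<Longrightarrow> homog_word G (a # xs) (i + n)"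
  by (auto simp: homog_word_Cons intro!: exI[of _ i])

lemma homog_word_snocI: "homog_word G xs n \<Longrightarrow> b \<in> G i \<Longrightarrow> homog_word G (xs @ [b]) (n + i)"
  by (auto simp: homog_word_append homog_word_Cons intro!: exI[of _ n])

lemma tens_grading_mult_Cons:
  assumes "a \<in> G i" "x \<in> tens_grading G n"
  shows "word [a] * x \<in> tens_grading G (i + n)"
  by (rule linear_span_subset[OF linear_mult_right subspace_tens_grading _ assms(2)[unfolded tens_grading_eq]])
    (auto simp: word_mult intro!: word_tens_grading homog_word_ConsI assms(1))

lemma tens_grading_mult_snoc:
  assumes "x \<in> tens_grading G n" "b \<in> G i"
  shows "x * word [b] \<in> tens_grading G (n + i)"
  by (rule linear_span_subset[OF linear_mult_left subspace_tens_grading _ assms(1)[unfolded tens_grading_eq]])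
    (auto simp: word_mult intro!: word_tens_grading homog_word_snocI assms(2))

text \<open>\<open>koszul G\<close> is chosen by \<open>SOME\<close> and known only on homogeneous
  elements; there it may be exchanged for any explicit sign operator.\<close>

lemma koszul_agrees:
  assumes "graded_by_characters G" "acts_by sign G f" "x \<in> G i"
  shows "koszul G x = f x"
  using assms by (simp add: koszul(2)[OF assms(1,3)] acts_by_def)

context
  fixes A :: "'a::real_vector galg"
  assumes A: "graded_algebra A"
begin

interpretation bar_algebra "susp_sign (homog A)" "susp_mult A"
  by (rule bar_algebra_susp[OF A])

lemma acts_by_susp_sign: "acts_by sign (shift1 (homog A)) (susp_sign (homog A))"
  using linear_susp_sign[OF graded_algebra_facts(1)[OF A]] susp_sign_homog[OF graded_algebra_facts(1)[OF A]]
  by (auto simp: acts_by_def shift1_def sign_simps)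

lemma graded_bar: "graded_by_characters (tens_grading (shift1 (homog A)))"
  by (intro graded_by_characters_tens graded_by_characters_shift graded_algebra_facts A)

lemma acts_by_map_word: "acts_by sign (tens_grading (shift1 (homog A))) (map_word (susp_sign (homog A)))"
  by (rule acts_by_tens[OF character_sign acts_by_susp_sign])

lemma mult_head_degree:
  assumes "a \<in> shift1 (homog A) i" "homog_word (shift1 (homog A)) xs n"
  shows "mult_head (susp_mult A) a (word xs) \<in> tens_grading (shift1 (homog A)) (i + n + 1)"
proof (cases xs)
  case Nil
  then show ?thesis by (simp add: mult_head_word subspace_0 subspace_tens_grading)
next
  case (Cons b ys)
  with assms obtain j where b: "b \<in> shift1 (homog A) j" "homog_word (shift1 (homog A)) ys (n - j)"
    by (auto simp: homog_word_Cons)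
  have "susp_mult A a b \<in> shift1 (homog A) (i + j + 1)"
    using susp_mult_closed[OF A, of a "i + 1" b "j + 1"] assms b by (simp add: shift1_def algebra_simps)
  with b show ?thesis
    by (auto simp: Cons mult_head_word homog_word_Cons intro!: word_tens_grading exI[of _ "i + j + 1"])
qed

lemma bar_degree:
  assumes "x \<in> tens_grading (shift1 (homog A)) n"
  shows "bar (susp_sign (homog A)) (susp_mult A) x \<in> tens_grading (shift1 (homog A)) (n + 1)"
proof -
  have *: "bar_word (susp_sign (homog A)) (susp_mult A) xs \<in> tens_grading (shift1 (homog A)) (n + 1)"
    if "homog_word (shift1 (homog A)) xs n" for xs n
    using that
  proof (induction xs arbitrary: n)
    case (Cons a xs)
    then obtain i where a: "a \<in> shift1 (homog A) i" "homog_word (shift1 (homog A)) xs (n - i)"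
      by (auto simp: homog_word_Cons)
    have "susp_sign (homog A) a \<in> shift1 (homog A) i"
      using a susp_sign_closed[OF graded_algebra_facts(1)[OF A]] by (simp add: shift1_def)
    from tens_grading_mult_Cons[OF this Cons.IH[OF a(2)]] mult_head_degree[OF a]
    show ?case by (auto simp: algebra_simps intro!: subspace_add subspace_tens_grading)
  qed (simp add: subspace_0 subspace_tens_grading)
  show ?thesis
    by (rule linear_span_subset[OF linear_bar subspace_tens_grading _ assms[unfolded tens_grading_eq]])
      (auto simp: bar_word *)
qed

lemma ainf_of_graded_algebra: "ainf_of_algebra A (bar (susp_sign (homog A)) (susp_mult A))"
proof -
  let ?T = "tens_grading (shift1 (homog A))" and ?d = "bar (susp_sign (homog A)) (susp_mult A)"
  have k: "linear (koszul ?T)" by (rule koszul[OF graded_bar])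
  have c: "comult (?d x) = tensor_map ?d id (comult x) + tensor_map (koszul ?T) ?d (comult x)" if "x \<in> total ?T" for x
  proof (rule total_eqI[OF _ _ _ that, of "\<lambda>x. comult (?d x)"])
    fix n x assume "x \<in> ?T n"
    then have "x \<in> span {word xs | xs. homog_word (shift1 (homog A)) xs n}" by (simp add: tens_grading_eq)
    then show "comult (?d x) = tensor_map ?d id (comult x) + tensor_map (koszul ?T) ?d (comult x)"
    proof (rule linear_eq_on_span[rotated -1, of _ _ "\<lambda>x. comult (?d x)"])
      fix y assume "y \<in> {word xs | xs. homog_word (shift1 (homog A)) xs n}"
      then obtain xs where y: "y = word xs" "homog_word (shift1 (homog A)) xs n" by auto
      \<comment> \<open>Initial segments of a homogeneous word are homogeneous, so the chosen sign
        operator agrees with the explicit one on every left factor of the coproduct.\<close>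
      have "koszul ?T (word (take i xs)) = map_word (susp_sign (homog A)) (word (take i xs))" for i
      proof -
        obtain j where "homog_word (shift1 (homog A)) (take i xs) j"
          using y(2) homog_word_append[of _ "take i xs" "drop i xs" n] by auto
        then show ?thesis
          using koszul_agrees[OF graded_bar acts_by_map_word word_tens_grading] by blast
      qed
      then have "tensor_map (koszul ?T) ?d (comult y) = tensor_map (map_word (susp_sign (homog A))) ?d (comult y)"
        by (simp add: y comult_word linear_sum[OF linear_tensor_map] k linear_bar linear_map_word del: map_word_word)
      then show "comult (?d y) = tensor_map ?d id (comult y) + tensor_map (koszul ?T) ?d (comult y)"
        by (simp add: comult_bar)
    qed (intro linear_intros linear_bar linear_comp[OF linear_bar] k)+
  qed (intro linear_intros linear_bar linear_comp[OF linear_bar] k)+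
  have "ainf_structure (homog A) ?d"
    unfolding ainf_structure_def Let_def
    using graded_space_of_characters[OF graded_algebra_facts(1)[OF A]] linear_bar bar_degree c bar_bar counit_bar
    by auto
  moreover have "taylor ?d [a, b] = sign (i - 1) *\<^sub>R gmult A a b" if "a \<in> homog A i" "b \<in> total (homog A)" for a b i
    using that by (simp add: taylor_bar susp_mult_homog[OF A] sign_simps)
  ultimately show ?thesis
    by (auto simp: ainf_of_algebra_def taylor_bar split: list.split)
qed

end

section \<open>Transfer for bimodules over graded algebras\<close>

lemma pure_tensor_grading: "x \<in> G i \<Longrightarrow> y \<in> H j \<Longrightarrow> i + j = n \<Longrightarrow> x \<otimes> y \<in> tensor_grading G H n"
  unfolding tensor_grading_def by (rule span_base) blast

lemma tensor_map_degree:
  assumes "linear f" "linear g" "\<And>i x. x \<in> G i \<Longrightarrow> f x \<in> G' (i + k)" "\<And>j y. y \<in> H j \<Longrightarrow> g y \<in> H' (j + l)"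
    "t \<in> tensor_grading G H n"
  shows "tensor_map f g t \<in> tensor_grading G' H' (n + k + l)"
  by (rule linear_span_subset[OF linear_tensor_map[OF assms(1,2)] subspace_tensor_grading _ assms(5)[unfolded tensor_grading_def]])
    (auto simp: assms(1,2) intro!: pure_tensor_grading assms(3,4))

lemma one_grading: "1 \<in> tens_grading G 0"
  unfolding one_tens_def by (rule word_tens_grading) simp

lemma sign_cancel: "sign i * (sign i * c) = c"
  by (simp add: sign_def)

text \<open>A strict dg bimodule in unsuspended conventions: moving \<open>d\<close> or
  \<open>sM\<close> past a left action costs the sign of the acting element, the two actions commute
  plainly, and \<open>d\<close> commutes with the right action. \<open>M\<close> carries the
  suspended grading, hence \<open>K (n + 1)\<close> against \<open>M n\<close> and
  \<open>susp_sign K\<close> in \<open>sM_i\<close> and \<open>p_sM\<close>.\<close>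

locale graded_transfer =
  fixes A :: "'a::real_vector galg" and B :: "'b::real_vector galg" and K :: "int \<Rightarrow> 'k::real_vector set"
    and M :: "int \<Rightarrow> 'm::real_vector set" and S :: "'m set" and sM :: "'m \<Rightarrow> 'm"
    and L :: "'a \<Rightarrow> 'm \<Rightarrow> 'm" and R :: "'b \<Rightarrow> 'm \<Rightarrow> 'm"
    and d h :: "'m \<Rightarrow> 'm" and i :: "'k \<Rightarrow> 'm" and p :: "'m \<Rightarrow> 'k"
  assumes A: "graded_algebra A" and B: "graded_algebra B" and K: "graded_by_characters K"
    and linear_maps: "linear sM" "linear d" "linear h" "linear i" "linear p"
    and bilinear_LR: "bilinear L" "bilinear R"
    and L_mult: "a \<in> homog A j \<Longrightarrow> a' \<in> homog A j' \<Longrightarrow> L (gmult A a a') x = L a (L a' x)"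
    and R_mult: "b \<in> homog B j \<Longrightarrow> b' \<in> homog B j' \<Longrightarrow> R (gmult B b b') x = R b' (R b x)"
    and L_R: "a \<in> homog A j \<Longrightarrow> b \<in> homog B j' \<Longrightarrow> L a (R b x) = R b (L a x)"
    and d_L: "a \<in> homog A j \<Longrightarrow> d (L a x) = sign j *\<^sub>R L a (d x)"
    and d_R: "b \<in> homog B j \<Longrightarrow> d (R b x) = R b (d x)"
    and sM_L: "a \<in> homog A j \<Longrightarrow> sM (L a x) = sign j *\<^sub>R L a (sM x)"
    and sM_R: "b \<in> homog B j \<Longrightarrow> sM (R b x) = sign j *\<^sub>R R b (sM x)"
    and sM_d: "sM (d x) = - d (sM x)"
    and sM_h: "sM (h x) = - h (sM x)"
    and sM_i: "sM (i \<kappa>) = i (susp_sign K \<kappa>)"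
    and p_sM: "p (sM x) = susp_sign K (p x)"
    and d_i: "d (i \<kappa>) = 0" and p_d: "p (d x) = 0"
    and homotopy: "x \<in> S \<Longrightarrow> d (h x) + h (d x) = i (p x) - x"
    and carrier: "subspace S" "\<And>j a x. a \<in> homog A j \<Longrightarrow> x \<in> S \<Longrightarrow> L a x \<in> S"
      "\<And>j b x. b \<in> homog B j \<Longrightarrow> x \<in> S \<Longrightarrow> R b x \<in> S"
      "\<And>x. x \<in> S \<Longrightarrow> h x \<in> S" "\<And>\<kappa>. i \<kappa> \<in> S" "\<And>x. x \<in> S \<Longrightarrow> sM x \<in> S"
    and M: "\<And>n. subspace (M n)" "\<And>j n a x. a \<in> homog A j \<Longrightarrow> x \<in> M n \<Longrightarrow> L a x \<in> M (j + n)"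
      "\<And>j n b x. b \<in> homog B j \<Longrightarrow> x \<in> M n \<Longrightarrow> R b x \<in> M (n + j)"
      "\<And>n x. x \<in> M n \<Longrightarrow> h x \<in> M (n - 1)" "\<And>n \<kappa>. \<kappa> \<in> K (n + 1) \<Longrightarrow> i \<kappa> \<in> M n"
      "\<And>n x. x \<in> M n \<Longrightarrow> sM x \<in> M n" "\<And>n x. x \<in> M n \<Longrightarrow> p x \<in> K (n + 1)"
begin

abbreviation "sA \<equiv> susp_sign (homog A)"
abbreviation "sB \<equiv> susp_sign (homog B)"
abbreviation "sK \<equiv> susp_sign K"

text \<open>The suspended actions. As in the suspended product, the sign is that of the left-hand
  factor: the algebra element in \<open>lam\<close>, the module element in
  \<open>rho\<close>.\<close>

definition lam :: "'a \<Rightarrow> 'm \<Rightarrow> 'm" where "lam a x = L (sA a) x"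
definition rho :: "'b \<Rightarrow> 'm \<Rightarrow> 'm" where "rho b x = R (grade_proj (homog B) b) (sM x)"

lemmas gA = graded_algebra_facts(1)[OF A] and gB = graded_algebra_facts(1)[OF B]
lemmas linear_LR = linear_bilinear[OF bilinear_LR(1)] linear_bilinear[OF bilinear_LR(2)]
lemmas sA = linear_susp_sign[OF gA] susp_sign_homog[OF gA] susp_sign_proj[OF gA] susp_sign_closed[OF gA]
lemmas sB = linear_susp_sign[OF gB] susp_sign_homog[OF gB] susp_sign_proj[OF gB] susp_sign_closed[OF gB]
lemmas mA = linear_bilinear[OF bilinear_susp_mult[OF A]] and mB = linear_bilinear[OF bilinear_susp_mult[OF B]]

lemma lam_homog: "a \<in> homog A j \<Longrightarrow> lam a x = - sign j *\<^sub>R L a x"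
  using linear_cmul[OF linear_LR(2), of "- sign j" a x] by (simp add: lam_def sA)

lemma rho_homog: "b \<in> homog B j \<Longrightarrow> rho b x = R b (sM x)"
  by (simp add: rho_def grade_proj_homog)

lemma lam_proj: "lam (grade_proj (homog A) a) x = lam a x"
  by (simp add: lam_def sA)

lemma rho_proj: "rho (grade_proj (homog B) b) x = rho b x"
  by (simp add: rho_def grade_proj_idem)

lemma bilinear_lam: "bilinear lam" and bilinear_rho: "bilinear rho"
  unfolding bilinear_def lam_def rho_def
  by (intro conjI allI linear_LR linear_comp[OF sA(1) linear_LR(2)] linear_comp[OF linear_grade_proj linear_LR(4)]
     linear_comp[OF linear_maps(1) linear_LR(3)])+

lemmas linear_lam = linear_bilinear[OF bilinear_lam] and linear_rho = linear_bilinear[OF bilinear_rho]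

lemmas comps = linear_compose_neg linear_compose_add linear_zero linear_lam linear_rho mA mB sA(1) sB(1)
  linear_comp[OF _ linear_lam(1)] linear_comp[OF _ linear_lam(2)] linear_comp[OF _ linear_rho(1)] linear_comp[OF _ linear_rho(2)]
  linear_comp[OF _ linear_maps(1)] linear_comp[OF _ linear_maps(2)]

lemma homog_eqI_A:
  assumes "linear f" "linear g" "\<And>x. f (grade_proj (homog A) x) = f x" "\<And>x. g (grade_proj (homog A) x) = g x"
    "\<And>j x. x \<in> homog A j \<Longrightarrow> f x = g x"
  shows "f x = g x"
  by (rule grade_proj_eqI[where G = "homog A"]) (rule assms; assumption)+

lemma homog_eqI_B:
  assumes "linear f" "linear g" "\<And>x. f (grade_proj (homog B) x) = f x" "\<And>x. g (grade_proj (homog B) x) = g x"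
    "\<And>j x. x \<in> homog B j \<Longrightarrow> f x = g x"
  shows "f x = g x"
  by (rule grade_proj_eqI[where G = "homog B"]) (rule assms; assumption)+

lemmas LR_simps = linear_cmul[OF linear_LR(1)] linear_cmul[OF linear_LR(2)] linear_cmul[OF linear_LR(3)]
  linear_cmul[OF linear_LR(4)] linear_neg[OF linear_LR(1)] linear_neg[OF linear_LR(2)] linear_neg[OF linear_LR(3)]
  linear_neg[OF linear_LR(4)] linear_cmul[OF linear_maps(1)] linear_cmul[OF linear_maps(2)]
  linear_neg[OF linear_maps(1)] linear_neg[OF linear_maps(2)]
  linear_cmul[OF linear_lam(2)] linear_neg[OF linear_lam(2)] linear_cmul[OF linear_rho(2)] linear_neg[OF linear_rho(2)]

lemma d_lam: "d (lam a x) + lam (sA a) (d x) = 0"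
proof (rule homog_eqI_A[of "\<lambda>a. d (lam a x) + lam (sA a) (d x)" "\<lambda>_. 0"])
  fix j a assume a: "a \<in> homog A j"
  show "d (lam a x) + lam (sA a) (d x) = 0"
    by (simp add: lam_homog[OF a] sA(2)[OF a] d_L[OF a] LR_simps sign_simps)
qed (intro comps | simp add: lam_proj sA)+

lemma d_rho: "d (rho b x) + rho b (d x) = 0"
proof (rule homog_eqI_B[of "\<lambda>b. d (rho b x) + rho b (d x)" "\<lambda>_. 0"])
  fix j b assume b: "b \<in> homog B j"
  show "d (rho b x) + rho b (d x) = 0"
    by (simp add: rho_homog[OF b] d_R[OF b] LR_simps sM_d)
qed (intro comps | simp add: rho_proj)+

lemma lam_lam: "lam (susp_mult A a a') x + lam (sA a) (lam a' x) = 0"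
proof (rule homog_eqI_A[of "\<lambda>a. lam (susp_mult A a a') x + lam (sA a) (lam a' x)" "\<lambda>_. 0"])
  fix j a assume a: "a \<in> homog A j"
  show "lam (susp_mult A a a') x + lam (sA a) (lam a' x) = 0"
  proof (rule homog_eqI_A[of "\<lambda>a'. lam (susp_mult A a a') x + lam (sA a) (lam a' x)" "\<lambda>_. 0"])
    fix j' a' assume a': "a' \<in> homog A j'"
    have "susp_mult A a a' = - sign j *\<^sub>R gmult A a a'"
      by (rule susp_mult_homog[OF A a homog_total[of _ "homog A", OF a']])
    then show "lam (susp_mult A a a') x + lam (sA a) (lam a' x) = 0"
      by (simp add: lam_homog[OF graded_algebra_facts(3)[OF A a a']] lam_homog[OF a'] lam_homog[OF a] sA(2)[OF a]
         LR_simps L_mult[OF a a'] sign_simps sign_cancel)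
  qed (intro comps | simp add: lam_proj susp_mult_proj[OF A])+
qed (intro comps | simp add: lam_proj sA susp_mult_proj[OF A])+

lemma rho_rho: "rho b' (rho b x) + rho (susp_mult B b b') (sM x) = 0"
proof (rule homog_eqI_B[of "\<lambda>b. rho b' (rho b x) + rho (susp_mult B b b') (sM x)" "\<lambda>_. 0"])
  fix j b assume b: "b \<in> homog B j"
  show "rho b' (rho b x) + rho (susp_mult B b b') (sM x) = 0"
  proof (rule homog_eqI_B[of "\<lambda>b'. rho b' (rho b x) + rho (susp_mult B b b') (sM x)" "\<lambda>_. 0"])
    fix j' b' assume b': "b' \<in> homog B j'"
    have "susp_mult B b b' = - sign j *\<^sub>R gmult B b b'"
      by (rule susp_mult_homog[OF B b homog_total[of _ "homog B", OF b']])
    then show "rho b' (rho b x) + rho (susp_mult B b b') (sM x) = 0"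
      by (simp add: rho_homog[OF graded_algebra_facts(3)[OF B b b']] rho_homog[OF b'] rho_homog[OF b] sM_R[OF b]
         LR_simps R_mult[OF b b'] sign_simps)
  qed (intro comps | simp add: rho_proj susp_mult_proj[OF B])+
qed (intro comps | simp add: rho_proj susp_mult_proj[OF B])+

lemma rho_lam: "rho b (lam a x) + lam (sA a) (rho b x) = 0"
proof (rule homog_eqI_A[of "\<lambda>a. rho b (lam a x) + lam (sA a) (rho b x)" "\<lambda>_. 0"])
  fix j a assume a: "a \<in> homog A j"
  show "rho b (lam a x) + lam (sA a) (rho b x) = 0"
  proof (rule homog_eqI_B[of "\<lambda>b. rho b (lam a x) + lam (sA a) (rho b x)" "\<lambda>_. 0"])
    fix j' b assume b: "b \<in> homog B j'"
    show "rho b (lam a x) + lam (sA a) (rho b x) = 0"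
      by (simp add: rho_homog[OF b] lam_homog[OF a] sA(2)[OF a] sM_L[OF a]
         LR_simps L_R[OF a b] sign_simps)
  qed (intro comps | simp add: rho_proj)+
qed (intro comps | simp add: lam_proj sA)+

lemma sM_lam: "sM (lam a x) = - lam (sA a) (sM x)"
proof (rule homog_eqI_A[of "\<lambda>a. sM (lam a x)"])
  fix j a assume a: "a \<in> homog A j"
  show "sM (lam a x) = - lam (sA a) (sM x)"
    by (simp add: lam_homog[OF a] sA(2)[OF a] sM_L[OF a] LR_simps sign_simps)
qed (intro comps | simp add: lam_proj sA)+

lemma sM_rho: "sM (rho b x) = - rho (sB b) (sM x)"
proof (rule homog_eqI_B[of "\<lambda>b. sM (rho b x)"])
  fix j b assume b: "b \<in> homog B j"
  show "sM (rho b x) = - rho (sB b) (sM x)"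
    by (simp add: rho_homog[OF b] sB(2)[OF b] sM_R[OF b] LR_simps)
qed (intro comps | simp add: rho_proj sB)+

lemma lam_carrier: "x \<in> S \<Longrightarrow> lam a x \<in> S"
proof -
  assume x: "x \<in> S"
  have "lam (grade_proj (homog A) a) x \<in> S"
    by (rule total_closed[of "\<lambda>a. lam a x", OF linear_lam(2) carrier(1) _ grade_proj_total])
      (use carrier x in \<open>auto simp: lam_homog intro!: subspace_neg subspace_scale\<close>)
  then show ?thesis by (simp add: lam_proj)
qed

lemma rho_carrier: "x \<in> S \<Longrightarrow> rho b x \<in> S"
proof -
  assume x: "x \<in> S"
  have "rho (grade_proj (homog B) b) x \<in> S"
    by (rule total_closed[of "\<lambda>b. rho b x", OF linear_rho(2) carrier(1) _ grade_proj_total])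
      (use carrier x in \<open>auto simp: rho_homog\<close>)
  then show ?thesis by (simp add: rho_proj)
qed

sublocale bimodule_transfer sA "susp_mult A" sB "susp_mult B" sK sM lam rho d h i p S
  by (intro bimodule_transfer.intro bimodule_transfer_axioms.intro bar_algebra_susp A B)
    (fact linear_susp_sign[OF K] linear_maps bilinear_lam bilinear_rho carrier lam_carrier rho_carrier
      d_i p_d homotopy d_lam d_rho lam_lam rho_rho rho_lam sM_lam sM_rho sM_h sM_i p_sM)+

section \<open>Degrees, and the bimodule structure on graded subspaces\<close>

abbreviation "TA \<equiv> tens_grading (shift1 (homog A))"
abbreviation "TB \<equiv> tens_grading (shift1 (homog B))"
abbreviation "MB \<equiv> tensor_grading TA (tensor_grading (shift1 K) TB)"

abbreviation "hwA \<equiv> homog_word (shift1 (homog A))"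
abbreviation "hwB \<equiv> homog_word (shift1 (homog B))"

lemma lam_degree: "a \<in> shift1 (homog A) j \<Longrightarrow> x \<in> M n \<Longrightarrow> lam a x \<in> M (j + n + 1)"
  using M(2)[of a "j + 1" x n] M(1) by (simp add: lam_homog shift1_def algebra_simps subspace_neg subspace_scale)

lemma rho_degree: "b \<in> shift1 (homog B) j \<Longrightarrow> x \<in> M n \<Longrightarrow> rho b x \<in> M (n + j + 1)"
  using M(3)[of b "j + 1" "sM x" n] M(6) by (simp add: rho_homog shift1_def algebra_simps)

lemma psi_degree:
  assumes "hwA as m" "hwB bs l" "\<kappa> \<in> shift1 K k"
  shows psi_grading: "psi as \<kappa> bs \<in> M (m + k + l)"
    and theta_grading: "theta_left as \<kappa> bs + theta_right as \<kappa> bs \<in> M (m + k + l + 1)"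
proof -
  have "psi as \<kappa> bs \<in> M (m + k + l) \<and> theta_left as \<kappa> bs + theta_right as \<kappa> bs \<in> M (m + k + l + 1)"
    using assms(1,2)
  proof (induction "length as + length bs" arbitrary: as bs m l rule: less_induct)
    case less
    have "theta_left as \<kappa> bs \<in> M (m + k + l + 1)"
    proof (cases as)
      case (Cons a as')
      then obtain j where j: "a \<in> shift1 (homog A) j" "hwA as' (m - j)"
        using less.prems by (auto simp: homog_word_Cons)
      have "psi as' \<kappa> bs \<in> M (m - j + k + l)"
        using less.hyps[of as' bs] Cons j less.prems by simp
      from lam_degree[OF j(1) this] show ?thesis by (simp add: Cons algebra_simps)
    qed (simp add: M subspace_0)
    moreover have "theta_right as \<kappa> bs \<in> M (m + k + l + 1)"
    proof (cases bs)
      case (Cons b bs')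
      then obtain j where j: "b \<in> shift1 (homog B) j" "hwB bs' (l - j)"
        using less.prems by (auto simp: homog_word_Cons)
      have "psi as \<kappa> bs' \<in> M (m + k + (l - j))"
        using less.hyps[of as bs'] Cons j less.prems by simp
      from rho_degree[OF j(1) this] show ?thesis by (simp add: Cons algebra_simps)
    qed (simp add: M subspace_0)
    ultimately have *: "theta_left as \<kappa> bs + theta_right as \<kappa> bs \<in> M (m + k + l + 1)"
      by (intro subspace_add M)
    show ?case
    proof (cases "as = [] \<and> bs = []")
      case True
      then show ?thesis using less.prems assms(3) * M(5)[of \<kappa> k] by (simp add: shift1_def)
    next
      case False
      then show ?thesis using M(4)[OF *] * by (simp add: psi_theta)
    qed
  qed
  then show "psi as \<kappa> bs \<in> M (m + k + l)" "theta_left as \<kappa> bs + theta_right as \<kappa> bs \<in> M (m + k + l + 1)" by auto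
qed

lemma phi_degree:
  assumes "hwA as m" "hwB bs l" "\<kappa> \<in> shift1 K k"
  shows "phi as \<kappa> bs \<in> shift1 K (m + k + l + 1)"
  using M(7)[OF theta_grading[OF assms]] by (simp add: phi_def shift1_def)

lemma row_degree:
  assumes "hwA as m" "hwB bs l" "\<kappa> \<in> shift1 K k"
  shows "row_word as \<kappa> bs \<in> tensor_grading (shift1 K) TB (m + k + l + 1)"
  using assms(2)
proof (induction bs arbitrary: l)
  case Nil
  then show ?case
    using phi_degree[OF assms(1) Nil assms(3)] by (auto intro!: pure_tensor_grading one_grading)
next
  case (Cons b bs)
  then obtain j where j: "b \<in> shift1 (homog B) j" "hwB bs (l - j)"
    by (auto simp: homog_word_Cons)
  have "tensor_map id (\<lambda>y. y * word [b]) (row_word as \<kappa> bs) \<in> tensor_grading (shift1 K) TB (m + k + (l - j) + 1 + 0 + j)"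
    by (rule tensor_map_degree[OF linear_id_map linear_mult_left _ _ Cons.IH[OF j(2)]])
      (auto intro: tens_grading_mult_snoc j)
  moreover have "phi as \<kappa> (b # bs) \<otimes> 1 \<in> tensor_grading (shift1 K) TB (m + k + l + 1)"
    using phi_degree[OF assms(1) Cons.prems assms(3)] by (auto intro!: pure_tensor_grading one_grading)
  ultimately show ?case by (simp add: subspace_add subspace_tensor_grading algebra_simps)
qed

lemma inner_degree:
  assumes "hwA as m" "hwB bs l" "\<kappa> \<in> shift1 K k"
  shows "inner_word as \<kappa> bs \<in> MB (m + k + l + 1)"
  using assms(1)
proof (induction as arbitrary: m)
  case Nil
  then show ?case
    using row_degree[OF Nil assms(2,3)] by (auto intro!: pure_tensor_grading one_grading)
next
  case (Cons a as)
  then obtain j where j: "a \<in> shift1 (homog A) j" "hwA as (m - j)"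
    by (auto simp: homog_word_Cons)
  have sa: "sA a \<in> shift1 (homog A) j" using j(1) sA(4) by (simp add: shift1_def)
  have cons: "word [sA a] * x \<in> TA (i + j)" if "x \<in> TA i" for x i
    using tens_grading_mult_Cons[where G = "shift1 (homog A)", OF sa that] by (simp add: add.commute)
  have "cons_left (sA a) (inner_word as \<kappa> bs) \<in> MB (m - j + k + l + 1 + j + 0)"
    unfolding cons_left_def
    by (rule tensor_map_degree[OF linear_mult_right linear_id_map _ _ Cons.IH[OF j(2)]])
      (auto intro: cons)
  moreover have "1 \<otimes> row_word (a # as) \<kappa> bs \<in> MB (m + k + l + 1)"
    using row_degree[OF Cons.prems assms(2,3)] by (auto intro!: pure_tensor_grading one_grading)
  ultimately show ?case by (simp add: subspace_add subspace_tensor_grading algebra_simps)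
qed

lemma bword_span:
  "MB n = span {bword as \<kappa> bs | as \<kappa> bs m k l. hwA as m \<and> \<kappa> \<in> shift1 K k
     \<and> hwB bs l \<and> m + k + l = n}" (is "_ = span ?W")
proof
  show "span ?W \<subseteq> MB n"
  proof (rule span_minimal)
    show "?W \<subseteq> MB n"
      unfolding bword_def
      by (auto intro!: pure_tensor_grading word_tens_grading simp: homog_word_rev add.assoc)
  qed (rule subspace_tensor_grading)
  have 1: "word as \<otimes> (\<kappa> \<otimes> z) \<in> span ?W"
    if "hwA as m" "\<kappa> \<in> shift1 K k" "z \<in> TB l" "m + k + l = n" for as m \<kappa> k z l
    by (rule linear_span_subset[OF linear_comp[OF linear_pure_right linear_pure_right] subspace_span _ that(3)[unfolded tens_grading_eq]])
      (use that in \<open>force intro!: span_base simp: bword_def homog_word_rev intro: exI[of _ "rev xs" for xs]\<close>)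
  have 2: "word as \<otimes> y \<in> span ?W"
    if "hwA as m" "y \<in> tensor_grading (shift1 K) TB j" "m + j = n" for as m y j
    by (rule linear_span_subset[OF linear_pure_right subspace_span _ that(2)[unfolded tensor_grading_def]])
      (use 1 that in \<open>auto simp: add.assoc\<close>)
  have 3: "x \<otimes> y \<in> span ?W"
    if "x \<in> TA m" "y \<in> tensor_grading (shift1 K) TB j" "m + j = n" for x m y j
    by (rule linear_span_subset[OF linear_pure_left subspace_span _ that(1)[unfolded tens_grading_eq]])
      (use 2 that in auto)
  show "MB n \<subseteq> span ?W"
    unfolding tensor_grading_def[of TA] by (rule span_minimal) (use 3 in auto)
qed

lemma D_degree:
  assumes "x \<in> MB n"
  shows "D x \<in> MB (n + 1)"
proof (rule linear_span_subset[OF linear_lifts(5) subspace_tensor_grading _ assms[unfolded bword_span]])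
  fix y assume "y \<in> {bword as \<kappa> bs | as \<kappa> bs m k l. hwA as m \<and> \<kappa> \<in> shift1 K k
     \<and> hwB bs l \<and> m + k + l = n}"
  then obtain as \<kappa> bs m k l where y: "y = bword as \<kappa> bs" "hwA as m" "\<kappa> \<in> shift1 K k"
     "hwB bs l" "m + k + l = n" by auto
  have yM: "y \<in> MB n" unfolding bword_span by (rule span_base) (use y in blast)
  have "inner y \<in> MB (n + 1)"
    using inner_degree[OF y(2,4,3)] y(1,5) by simp
  moreover have "bar_left y \<in> MB (n + 1 + 0)"
    unfolding bar_left_def
    by (rule tensor_map_degree[OF lin(9) linear_id_map _ _ yM]) (auto intro: bar_degree[OF A])
  moreover have "bar_right y \<in> MB (n + 0 + 1)"
    unfolding bar_right_def
  proof (rule tensor_map_degree[OF _ _ _ _ yM])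
    show "linear (map_word sA)" "linear (tensor_map sK (bar sB (susp_mult B)))" by (intro lin linear_tensor_map)+
    show "map_word sA x \<in> TA (j + 0)" if "x \<in> TA j" for x j
      using acts_by_map_word[OF A] that by (simp add: acts_by_def subspace_scale subspace_tens_grading)
    have "tensor_map sK (bar sB (susp_mult B)) x \<in> tensor_grading (shift1 K) TB (j + 0 + 1)"
      if "x \<in> tensor_grading (shift1 K) TB j" for x j
    proof (rule tensor_map_degree[OF _ _ _ _ that])
      show "sK y \<in> shift1 K (i + 0)" if "y \<in> shift1 K i" for y i
        using that susp_sign_closed[OF K] by (simp add: shift1_def)
    qed (intro lin bar_degree[OF B]; assumption)+
    then show "tensor_map sK (bar sB (susp_mult B)) x \<in> tensor_grading (shift1 K) TB (j + 1)"
      if "x \<in> tensor_grading (shift1 K) TB j" for x j using that by simp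
  qed
  ultimately show "D y \<in> MB (n + 1)"
    unfolding D_def by (intro subspace_add subspace_tensor_grading) simp_all
qed

lemma acts_by_sK: "acts_by sign (shift1 K) sK"
  using linear_susp_sign[OF K] susp_sign_homog[OF K] by (auto simp: acts_by_def shift1_def sign_simps)

lemma graded_MB: "graded_by_characters MB"
  by (intro graded_by_characters_tensor graded_bar graded_by_characters_shift A B K)

lemma acts_by_koszul_bi: "acts_by sign MB koszul_bi"
  unfolding koszul_bi_def
  by (intro acts_by_tensor character_sign acts_by_map_word A B acts_by_sK)

lemma homog_word_take_drop:
  assumes "homog_word G xs n"
  obtains j where "homog_word G (take m xs) j" "homog_word G (drop m xs) (n - j)"
  using assms homog_word_append[of G "take m xs" "drop m xs" n] by auto

lemma MB_eqI:
  assumes "linear f" "linear g" "x \<in> total MB"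
    and "\<And>as \<kappa> bs m k l. hwA as m \<Longrightarrow> \<kappa> \<in> shift1 K k \<Longrightarrow>
      hwB bs l \<Longrightarrow> f (word as \<otimes> (\<kappa> \<otimes> word bs)) = g (word as \<otimes> (\<kappa> \<otimes> word bs))"
  shows "f x = g x"
proof (rule total_eqI[OF assms(1,2) _ assms(3)])
  fix n x assume "x \<in> MB n"
  then show "f x = g x"
    unfolding bword_span
    by (rule linear_eq_on_span[OF assms(1,2), rotated]) (auto simp: bword_def homog_word_rev intro!: assms(4))
qed

lemma ainf_bimodule:
  "ainf_bimodule_structure (homog A) (bar sA (susp_mult A)) (homog B) (bar sB (susp_mult B)) K D"
proof -
  note kA = koszul(1)[OF graded_bar[OF A]] and kM = koszul(1)[OF graded_MB]
  have left: "left_coaction (D x) =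
      tensor_map (bar sA (susp_mult A)) id (left_coaction x) + tensor_map (koszul TA) D (left_coaction x)"
    if "x \<in> total MB" for x
  proof (rule MB_eqI[OF _ _ that, of "\<lambda>x. left_coaction (D x)"])
    fix as \<kappa> bs m k l assume h: "hwA as m"
    have "koszul TA (word (take i as)) = map_word sA (word (take i as))" for i
      using koszul_agrees[OF graded_bar[OF A] acts_by_map_word[OF A] word_tens_grading] homog_word_take_drop[OF h]
      by metis
    then have "tensor_map (koszul TA) D (left_coaction (word as \<otimes> (\<kappa> \<otimes> word bs))) =
        tensor_map (map_word sA) D (left_coaction (word as \<otimes> (\<kappa> \<otimes> word bs)))"
      by (simp add: left_coaction_pure comult_word linear_sum[OF linear_tensor_map] kA lin linear_lifts tensor_sum
          linear_sum[OF linear_assoc_right] del: A.map_word_word)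
    then show "left_coaction (D (word as \<otimes> (\<kappa> \<otimes> word bs))) =
      tensor_map (bar sA (susp_mult A)) id (left_coaction (word as \<otimes> (\<kappa> \<otimes> word bs))) +
      tensor_map (koszul TA) D (left_coaction (word as \<otimes> (\<kappa> \<otimes> word bs)))"
      by (simp add: left_coaction_D)
  qed (intro linear_compositions' linear_intros linear_lifts lin kA)+
  have right: "right_coaction (D x) =
      tensor_map D id (right_coaction x) + tensor_map (koszul MB) (bar sB (susp_mult B)) (right_coaction x)"
    if "x \<in> total MB" for x
  proof (rule MB_eqI[OF _ _ that, of "\<lambda>x. right_coaction (D x)"])
    fix as \<kappa> bs m k l
    assume h: "hwA as m" "\<kappa> \<in> shift1 K k" "hwB bs l"
    \<comment> \<open>Every left factor in the right coaction of a homogeneous tensor is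
      homogeneous, where the chosen operator is \<open>koszul_bi\<close>.\<close>
    have "koszul MB (word as \<otimes> (\<kappa> \<otimes> word (take i bs))) = koszul_bi (word as \<otimes> (\<kappa> \<otimes> word (take i bs)))" for i
    proof -
      obtain j where "hwB (take i bs) j" using homog_word_take_drop[OF h(3)] by metis
      then have "word as \<otimes> (\<kappa> \<otimes> word (take i bs)) \<in> MB (m + (k + j))"
        by (intro pure_tensor_grading[OF _ _ refl] word_tens_grading h)
      then show ?thesis by (rule koszul_agrees[OF graded_MB acts_by_koszul_bi])
    qed
    then have "tensor_map (koszul MB) (bar sB (susp_mult B)) (right_coaction (word as \<otimes> (\<kappa> \<otimes> word bs))) =
        tensor_map koszul_bi (bar sB (susp_mult B)) (right_coaction (word as \<otimes> (\<kappa> \<otimes> word bs)))"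
      by (simp add: right_coaction_pure comult_word linear_sum[OF linear_tensor_map] kM lin linear_operators
          linear_sum[OF linear_rassoc])
    then show "right_coaction (D (word as \<otimes> (\<kappa> \<otimes> word bs))) =
      tensor_map D id (right_coaction (word as \<otimes> (\<kappa> \<otimes> word bs))) +
      tensor_map (koszul MB) (bar sB (susp_mult B)) (right_coaction (word as \<otimes> (\<kappa> \<otimes> word bs)))"
      by (simp add: right_coaction_D)
  qed (intro linear_compositions' linear_intros linear_lifts lin kM)+
  show ?thesis
    unfolding ainf_bimodule_structure_def Let_def
    using ainf_of_graded_algebra[OF A] ainf_of_graded_algebra[OF B] graded_space_of_characters[OF K]
      linear_lifts(5) D_degree left right D_D
    by (auto simp: ainf_of_algebra_def)
qed

text \<open>One summand for each order in which the two letters can act, with a single homotopy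
  between them.\<close>

lemma bitaylor_one_one:
  "bitaylor D [a] \<kappa> [b] = p (lam a (h (rho b (i \<kappa>)))) + p (rho b (h (lam a (i \<kappa>))))"
  using bitaylor_D[of "[a]" \<kappa> "[b]"] by (simp add: phi_def linear_add[OF lin(6)])

end

section \<open>Graded symmetric algebras\<close>

lemma subspace_sym_ideal: "subspace (sym_ideal G)"
  by (simp add: sym_ideal_def)

lemma tens_grading_mult:
  assumes "x \<in> tens_grading G m" "y \<in> tens_grading G n"
  shows "x * y \<in> tens_grading G (m + n)"
proof -
  have 1: "word xs * y \<in> tens_grading G (m + n)" if "homog_word G xs m" for xs m
    using that
  proof (induction xs arbitrary: m)
    case (Cons a xs)
    then obtain i where i: "a \<in> G i" "homog_word G xs (m - i)" by (auto simp: homog_word_Cons)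
    from tens_grading_mult_Cons[of a G, OF i(1) Cons.IH[OF i(2)]] show ?case
      by (simp add: word_Cons[of a xs] mult.assoc)
  qed (use assms(2) in \<open>simp flip: one_tens_def\<close>)
  show ?thesis
    by (rule linear_span_subset[OF linear_mult_left subspace_tens_grading _ assms(1)[unfolded tens_grading_eq]])
      (auto intro: 1)
qed

lemma total_tens_mult:
  assumes "x \<in> total (tens_grading G)" "y \<in> total (tens_grading G)"
  shows "x * y \<in> total (tens_grading G)"
proof -
  have "x * y \<in> total (tens_grading G)" if "x \<in> tens_grading G m" for x m
    by (rule total_closed[OF linear_mult_right subspace_total _ assms(2)])
      (rule homog_total[of _ "tens_grading G"], rule tens_grading_mult[OF that])
  then show ?thesis
    by (rule total_closed[OF linear_mult_left subspace_total _ assms(1)])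
qed

lemma sym_ideal_generator:
  assumes "s \<in> total (tens_grading G)" "t \<in> total (tens_grading G)" "v \<in> G i" "w \<in> G j"
  shows "s * (word [v, w] - sign (i * j) *\<^sub>R word [w, v]) * t \<in> sym_ideal G"
  unfolding sym_ideal_def by (rule span_base) (use assms in blast)

lemma sym_ideal_induct:
  assumes "x \<in> sym_ideal G" "linear f" "subspace T"
    and "\<And>s t v w i j. s \<in> total (tens_grading G) \<Longrightarrow> t \<in> total (tens_grading G) \<Longrightarrow> v \<in> G i \<Longrightarrow> w \<in> G j \<Longrightarrow>
      f (s * (word [v, w] - sign (i * j) *\<^sub>R word [w, v]) * t) \<in> T"
  shows "f x \<in> T"
  by (rule linear_span_subset[OF assms(2,3) _ assms(1)[unfolded sym_ideal_def]]) (use assms(4) in blast)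

lemma word_pair: "v \<in> G i \<Longrightarrow> w \<in> G j \<Longrightarrow> word [v, w] \<in> tens_grading G (i + j)"
  by (rule word_tens_grading) (auto simp: homog_word_Cons intro!: exI[of _ i])

lemma sym_ideal_total:
  assumes "x \<in> sym_ideal G"
  shows "x \<in> total (tens_grading G)"
  by (rule sym_ideal_induct[OF assms linear_ident subspace_total])
    (intro total_tens_mult subspace_diff subspace_scale subspace_total;
      (assumption | rule homog_total[of _ "tens_grading G"], rule word_pair; assumption))

lemma sym_ideal_mult:
  assumes "x \<in> sym_ideal G" "r \<in> total (tens_grading G)"
  shows "x * r \<in> sym_ideal G" "r * x \<in> sym_ideal G"
proof -
  show "x * r \<in> sym_ideal G"
    by (rule sym_ideal_induct[OF assms(1) linear_mult_left subspace_sym_ideal], unfold mult.assoc[of _ _ r])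
      (intro sym_ideal_generator total_tens_mult assms(2); assumption)
  show "r * x \<in> sym_ideal G"
    by (rule sym_ideal_induct[OF assms(1) linear_mult_right subspace_sym_ideal], unfold mult.assoc[of r, symmetric])
      (intro sym_ideal_generator total_tens_mult assms(2); assumption)
qed

lemma quot_diff: "subspace N \<Longrightarrow> x - quot N x \<in> N"
  using quot(3)[of N "x - quot N x"] by (simp add: linear_diff[OF quot(1)] quot(2))

lemma quot_eqI: "subspace N \<Longrightarrow> x - y \<in> N \<Longrightarrow> quot N x = quot N y"
  using quot(3)[of N "x - y"] by (simp add: linear_diff[OF quot(1)])

text \<open>\<open>quot\<close> is an arbitrary linear idempotent that knows nothing of the grading.
  But \<open>x\<close> and its image differ by an element of the ideal, and the ideal lies in the
  total space.\<close>

lemma quot_total: "x \<in> total (tens_grading G) \<Longrightarrow> quot (sym_ideal G) x \<in> total (tens_grading G)"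
  by (drule subspace_diff[OF subspace_total _ sym_ideal_total[OF quot_diff[OF subspace_sym_ideal, of x G]]]) simp

text \<open>The ideal absorbs products with elements of the total space, so the product descends to
  classes of such elements.\<close>

lemma quot_mult:
  assumes "x \<in> total (tens_grading G)" "y \<in> total (tens_grading G)"
  shows "quot (sym_ideal G) (quot (sym_ideal G) x * y) = quot (sym_ideal G) (x * y)"
    and "quot (sym_ideal G) (x * quot (sym_ideal G) y) = quot (sym_ideal G) (x * y)"
proof -
  let ?q = "quot (sym_ideal G)"
  have "x * y - ?q x * y = (x - ?q x) * y" "x * y - x * ?q y = x * (y - ?q y)"
    by (simp_all add: left_diff_distrib right_diff_distrib)
  then have "x * y - ?q x * y \<in> sym_ideal G" "x * y - x * ?q y \<in> sym_ideal G"
    using sym_ideal_mult[OF quot_diff[OF subspace_sym_ideal]] assms by auto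
  then show "?q (?q x * y) = ?q (x * y)" "?q (x * ?q y) = ?q (x * y)"
    by (simp_all add: quot_eqI[OF subspace_sym_ideal, symmetric])
qed

lemma homog_Sym: "homog (Sym G) n = quot (sym_ideal G) ` tens_grading G n"
  and gmult_Sym: "gmult (Sym G) a b = quot (sym_ideal G) (a * b)"
  and gone_Sym: "gone (Sym G) = quot (sym_ideal G) 1"
  by (simp_all add: Sym_def)

lemma total_Sym: "a \<in> total (homog (Sym G)) \<Longrightarrow> a \<in> total (tens_grading G)"
  by (rule total_closed[OF linear_ident subspace_total])
    (auto simp: homog_Sym intro: quot_total[OF homog_total[of _ "tens_grading G"]])

text \<open>The relators are homogeneous, so \<open>map_word f\<close> rescales them and preserves
  the ideal; the action therefore descends to the quotient.\<close>

lemma acts_by_Sym: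
  assumes c: "character c" and f: "acts_by c G f"
  shows "acts_by c (homog (Sym G)) (\<lambda>x. quot (sym_ideal G) (map_word f x))"
proof -
  let ?q = "quot (sym_ideal G)"
  note q = quot[OF subspace_sym_ideal[of G]]
  have lf: "linear f" using f by (simp add: acts_by_def)
  note mw = map_word_facts[OF lf]
  have T: "map_word f x = c n *\<^sub>R x" if "x \<in> tens_grading G n" for x n
    using acts_by_tens[OF c f] that by (simp add: acts_by_def)
  have tot: "map_word f x \<in> total (tens_grading G)" if "x \<in> total (tens_grading G)" for x
    by (rule total_closed[OF mw(1) subspace_total _ that])
      (simp add: T subspace_scale[OF subspace_total] homog_total[of _ "tens_grading G"])
  have I: "map_word f x \<in> sym_ideal G" if "x \<in> sym_ideal G" for x
  proof (rule sym_ideal_induct[OF that mw(1) subspace_sym_ideal])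
    fix s t v w i j
    assume st: "s \<in> total (tens_grading G)" "t \<in> total (tens_grading G)" and v: "v \<in> G i" and w: "w \<in> G j"
    let ?r = "word [v, w] - sign (i * j) *\<^sub>R word [w, v]"
    have "word [v, w] \<in> tens_grading G (i + j)" "word [w, v] \<in> tens_grading G (i + j)"
      using word_pair[of v G i w j] word_pair[of w G j v i] v w by (simp_all add: add.commute)
    then have "map_word f ?r = c (i + j) *\<^sub>R ?r"
      by (intro T subspace_diff subspace_scale subspace_tens_grading)
    then have "map_word f (s * ?r * t) = c (i + j) *\<^sub>R (map_word f s * ?r * map_word f t)"
      by (simp only: mw(3)) simp
    then show "map_word f (s * ?r * t) \<in> sym_ideal G"
      using sym_ideal_generator[OF tot[OF st(1)] tot[OF st(2)] v w] by (simp add: subspace_scale[OF subspace_sym_ideal])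
  qed
  have "?q (map_word f (?q x)) = c n *\<^sub>R ?q x" if x: "x \<in> tens_grading G n" for x n
  proof -
    have "map_word f x - map_word f (?q x) \<in> sym_ideal G"
      using I[OF quot_diff[OF subspace_sym_ideal]] by (simp add: linear_diff[OF mw(1)])
    then have "?q (map_word f (?q x)) = ?q (map_word f x)"
      using quot_eqI[OF subspace_sym_ideal] by metis
    then show ?thesis by (simp add: T[OF x] linear_cmul[OF q(1)])
  qed
  then show ?thesis
    using linear_comp[OF mw(1) q(1)] by (auto simp: acts_by_def homog_Sym)
qed

lemma graded_algebra_Sym:
  assumes "graded_by_characters G"
  shows "graded_algebra (Sym G)"
  unfolding graded_algebra_def
proof (intro conjI allI ballI)
  note q = quot[OF subspace_sym_ideal[of G]]
  show "graded_by_characters (homog (Sym G))"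
    unfolding graded_by_characters_def
  proof (intro conjI allI impI)
    show "subspace (homog (Sym G) i)" for i
      unfolding homog_Sym by (rule linear_subspace_image[OF q(1) subspace_tens_grading])
    show "\<exists>f. acts_by c (homog (Sym G)) f" if "character c" for c
      using assms that acts_by_Sym[OF that] unfolding graded_by_characters_def by blast
  qed
  show "bilinear (gmult (Sym G))"
    unfolding bilinear_def gmult_Sym
    by (intro conjI allI linear_comp[OF linear_mult_left q(1)] linear_comp[OF linear_mult_right q(1)])
  show "gmult (Sym G) a b \<in> homog (Sym G) (i + j)" if a: "a \<in> homog (Sym G) i" and b: "b \<in> homog (Sym G) j" for i j a b
  proof -
    obtain x y where xy: "a = quot (sym_ideal G) x" "b = quot (sym_ideal G) y" "x \<in> tens_grading G i" "y \<in> tens_grading G j"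
      using a b unfolding homog_Sym by blast
    have tot: "x \<in> total (tens_grading G)" "y \<in> total (tens_grading G)"
      using xy homog_total[of _ "tens_grading G"] by auto
    have "gmult (Sym G) a b = quot (sym_ideal G) (x * y)"
      by (simp add: gmult_Sym xy(1,2) quot_mult tot quot_total)
    then show ?thesis using tens_grading_mult[OF xy(3,4)] by (auto simp: homog_Sym)
  qed
  show "gmult (Sym G) (gmult (Sym G) a b) c = gmult (Sym G) a (gmult (Sym G) b c)"
    if "a \<in> total (homog (Sym G))" "b \<in> total (homog (Sym G))" "c \<in> total (homog (Sym G))" for a b c
    using total_Sym[OF that(1)] total_Sym[OF that(2)] total_Sym[OF that(3)]
    by (simp add: gmult_Sym quot_mult total_tens_mult mult.assoc)
qed

lemma graded_algebra_tensor:
  assumes P: "graded_algebra P" and Q: "graded_algebra Q"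
  shows "graded_algebra (galg_tensor P Q)"
    and gmult_tensor: "gmult (galg_tensor P Q) (a \<otimes> b) (a' \<otimes> b') = gmult P a a' \<otimes> gmult Q b b'"
proof -
  let ?m = "gmult (galg_tensor P Q)" and ?H = "tensor_grading (homog P) (homog Q)"
  have h: "homog (galg_tensor P Q) = ?H"
    and m: "?m s t = tensor_lift (\<lambda>a b. tensor_lift (\<lambda>a' b'. gmult P a a' \<otimes> gmult Q b b') t) s" for s t
    by (simp_all add: galg_tensor_def)
  note lin = linear_bilinear[OF graded_algebra_facts(2)[OF P]] linear_bilinear[OF graded_algebra_facts(2)[OF Q]]
  note comp = linear_comp[OF lin(1)] linear_comp[OF lin(2)] linear_comp[OF lin(3)] linear_comp[OF lin(4)]
  have 1: "bilinear (\<lambda>a' b'. gmult P a a' \<otimes> gmult Q b b')" for a b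
    by (intro bilinear_pure lin)
  have 2: "bilinear (\<lambda>a b. tensor_lift (\<lambda>a' b'. gmult P a a' \<otimes> gmult Q b b') t)" for t
    unfolding bilinear_def
    by (intro conjI allI linear_tensor_lift_param linear_comp[OF lin(2) linear_pure_left] linear_comp[OF lin(4) linear_pure_right])
  have B: "bilinear ?m"
    unfolding bilinear_def m
    by (intro conjI allI linear_tensor_lift[OF 2] linear_tensor_lift_param linear_tensor_lift[OF 1])
  show pure: "?m (a \<otimes> b) (a' \<otimes> b') = gmult P a a' \<otimes> gmult Q b b'" for a b a' b'
    unfolding m by (simp add: 1 2 bilinear_pure lin)
  note lm = linear_bilinear[OF B]
  have closed: "?m s t \<in> ?H (i + j)" if s: "s \<in> ?H i" and t: "t \<in> ?H j" for s t i j
  proof -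
    have "?m (a \<otimes> b) t \<in> ?H (k + l + j)" if "a \<in> homog P k" "b \<in> homog Q l" for a b k l
    proof (rule linear_span_subset[OF lm(1) subspace_tensor_grading _ t[unfolded tensor_grading_def]])
      fix x assume "x \<in> {x \<otimes> y |x y i j'. x \<in> homog P i \<and> y \<in> homog Q j' \<and> i + j' = j}"
      then obtain a' b' k' l' where x: "x = a' \<otimes> b'" "a' \<in> homog P k'" "b' \<in> homog Q l'" "k' + l' = j" by blast
      then show "?m (a \<otimes> b) x \<in> ?H (k + l + j)"
        using that by (auto simp: pure intro!: pure_tensor_grading[of _ _ "k + k'" _ _ "l + l'"] graded_algebra_facts(3) P Q)
    qed
    then show ?thesis
      by (intro linear_span_subset[OF lm(2) subspace_tensor_grading _ s[unfolded tensor_grading_def]]) blast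
  qed
  have H: "f x = g x" if "linear f" "linear g" "x \<in> total ?H"
      "\<And>a b i j. a \<in> homog P i \<Longrightarrow> b \<in> homog Q j \<Longrightarrow> f (a \<otimes> b) = g (a \<otimes> b)"
    for x and f g :: "_ \<Rightarrow> ('a, 'b) tensor"
    by (rule total_eqI[OF that(1,2) _ that(3)], unfold tensor_grading_def)
      (rule linear_eq_on_span[OF that(1,2)], use that(4) in auto)
  note lmc = linear_comp[OF _ lm(1)] linear_comp[OF _ lm(2)]
  have assoc: "?m (?m s t) u = ?m s (?m t u)"
    if s: "s \<in> total ?H" and t: "t \<in> total ?H" and u: "u \<in> total ?H" for s t u
  proof (rule H[of "\<lambda>s. ?m (?m s t) u", OF _ _ s])
    fix a b i j assume a: "a \<in> homog P i" and b: "b \<in> homog Q j"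
    show "?m (?m (a \<otimes> b) t) u = ?m (a \<otimes> b) (?m t u)"
    proof (rule H[of "\<lambda>t. ?m (?m (a \<otimes> b) t) u", OF _ _ t])
      fix a' b' i' j' assume a': "a' \<in> homog P i'" and b': "b' \<in> homog Q j'"
      show "?m (?m (a \<otimes> b) (a' \<otimes> b')) u = ?m (a \<otimes> b) (?m (a' \<otimes> b') u)"
      proof (rule H[OF _ _ u])
        fix a'' b'' i'' j'' assume "a'' \<in> homog P i''" "b'' \<in> homog Q j''"
        then show "?m (?m (a \<otimes> b) (a' \<otimes> b')) (a'' \<otimes> b'') = ?m (a \<otimes> b) (?m (a' \<otimes> b') (a'' \<otimes> b''))"
          using a b a' b' graded_algebra_facts(4)[OF P] graded_algebra_facts(4)[OF Q]
            homog_total[of _ "homog P"] homog_total[of _ "homog Q"] by (simp add: pure)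
      qed (intro lm lmc)+
    qed (intro lm lmc)+
  qed (intro lm lmc)+
  show "graded_algebra (galg_tensor P Q)"
    unfolding graded_algebra_def h
    using B closed assoc graded_by_characters_tensor[OF graded_algebra_facts(1)[OF P] graded_algebra_facts(1)[OF Q]]
    by blast
qed

section \<open>Operators representing a graded algebra\<close>

text \<open>Left actions compose in the order of multiplication, right actions in the opposite order.\<close>

definition comp_op :: "bool \<Rightarrow> ('m \<Rightarrow> 'm) \<Rightarrow> ('m \<Rightarrow> 'm) \<Rightarrow> 'm \<Rightarrow> 'm" where
  "comp_op left f g = (if left then f \<circ> g else g \<circ> f)"

definition op_graded :: "(int \<Rightarrow> ('m::real_vector \<Rightarrow> 'm) set) \<Rightarrow> bool" where
  "op_graded P \<longleftrightarrow> (\<forall>i. subspace (P i)) \<and> (\<lambda>x. x) \<in> P 0 \<and> (\<forall>i j. \<forall>f\<in>P i. \<forall>g\<in>P j. f \<circ> g \<in> P (i + j))"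

text \<open>The last clause is an induction principle. An \<open>op_graded\<close> family is a
  property of operators, given degree by degree, that is stable under linear combinations and
  composition; if the generating operators \<open>Ops\<close> have it, then so do the operators of
  all homogeneous elements.\<close>

definition represents ::
    "bool \<Rightarrow> 'a::real_vector galg \<Rightarrow> (int \<Rightarrow> ('m::real_vector \<Rightarrow> 'm) set) \<Rightarrow> ('a \<Rightarrow> 'm \<Rightarrow> 'm) \<Rightarrow> bool" where
  "represents left A Ops L \<longleftrightarrow> bilinear L
     \<and> (\<forall>j j'. \<forall>a\<in>homog A j. \<forall>a'\<in>homog A j'. L (gmult A a a') = comp_op left (L a) (L a'))
     \<and> (\<forall>P j. op_graded P \<longrightarrow> (\<forall>i. Ops i \<subseteq> P i) \<longrightarrow> L ` homog A j \<subseteq> P j)"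

definition rep :: "bool \<Rightarrow> ('v::real_vector \<Rightarrow> 'm::real_vector \<Rightarrow> 'm) \<Rightarrow> 'v tens \<Rightarrow> 'm \<Rightarrow> 'm" where
  "rep left l = tens_lift (\<lambda>xs. foldr (\<lambda>v. comp_op left (l v)) xs (\<lambda>x. x))"

lemma comp_op_assoc: "comp_op left (comp_op left f g) k = comp_op left f (comp_op left g k)"
  and comp_op_id [simp]: "comp_op left (\<lambda>x. x) f = f" "comp_op left f (\<lambda>x. x) = f"
  by (simp_all add: comp_op_def o_def)

lemma linear_comp_op: "linear f \<Longrightarrow> linear g \<Longrightarrow> linear (comp_op left f g)"
  by (auto simp: comp_op_def intro: linear_compose)

lemma linear_comp_op_right: "linear f \<Longrightarrow> linear (\<lambda>g. comp_op left f g)"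
  by (auto simp: comp_op_def linear_iff fun_eq_iff scaleR_fun_def)

lemma linear_comp_op_left: "linear g \<Longrightarrow> linear (\<lambda>f. comp_op left f g)"
  by (auto simp: comp_op_def linear_iff fun_eq_iff scaleR_fun_def)

lemma linear_fun_param: "(\<And>x. linear (\<lambda>z. F z x)) \<Longrightarrow> linear F"
  by (auto simp: linear_iff fun_eq_iff scaleR_fun_def)

lemma linear_fun_apply: "linear F \<Longrightarrow> linear (\<lambda>z. F z x)"
  by (auto simp: linear_iff fun_eq_iff scaleR_fun_def)

lemma subspace_linear: "subspace {f. linear f}"
  by (auto simp: subspace_def linear_iff scaleR_fun_def algebra_simps)

lemma op_graded_comp_op: "op_graded P \<Longrightarrow> f \<in> P i \<Longrightarrow> g \<in> P j \<Longrightarrow> comp_op left f g \<in> P (i + j)"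
  by (auto simp: op_graded_def comp_op_def) (metis add.commute)

context
  fixes l :: "'v::real_vector \<Rightarrow> 'm::real_vector \<Rightarrow> 'm" and left :: bool
  assumes l: "bilinear l"
begin

lemma linear_fold: "linear (foldr (\<lambda>v. comp_op left (l v)) xs (\<lambda>x. x))"
  by (induction xs) (auto intro: linear_comp_op linear_bilinear[OF l] simp: linear_ident)

lemma multilinear_fold: "multilinear (\<lambda>xs. foldr (\<lambda>v. comp_op left (l v)) xs (\<lambda>x. x))"
proof -
  have "linear (\<lambda>x. foldr (\<lambda>v. comp_op left (l v)) (us @ x # vs) (\<lambda>x. x))" for us vs
  proof (induction us)
    case Nil
    have "linear l" by (intro linear_fun_param linear_bilinear[OF l])
    then show ?case by (simp add: linear_comp[OF _ linear_comp_op_left[OF linear_fold]])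
  qed (simp add: linear_comp[OF _ linear_comp_op_right[OF linear_bilinear(1)[OF l]]])
  then show ?thesis by (simp add: multilinear_def)
qed

lemma linear_rep: "linear (rep left l)"
  unfolding rep_def by (rule linear_tens_lift[OF multilinear_fold])

lemma rep_word: "rep left l (word xs) = foldr (\<lambda>v. comp_op left (l v)) xs (\<lambda>x. x)"
  unfolding rep_def by (rule tens_lift_word[OF multilinear_fold])

lemma linear_rep_apply: "linear (rep left l t)"
proof -
  have "rep left l t \<in> {f. linear f}"
    by (rule linear_span_subset[OF linear_rep subspace_linear _ span_words]) (auto simp: rep_word linear_fold)
  then show ?thesis by simp
qed

lemma bilinear_rep: "bilinear (rep left l)"
  unfolding bilinear_def using linear_rep_apply linear_fun_apply[OF linear_rep] by auto

lemma rep_one: "rep left l 1 = (\<lambda>x. x)"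
  by (simp add: one_tens_def rep_word)

lemma rep_letter: "rep left l (word [v]) = l v"
  by (simp add: rep_word)

lemma rep_mult: "rep left l (s * t) = comp_op left (rep left l s) (rep left l t)"
proof -
  have 1: "rep left l (word xs * word ys) = comp_op left (rep left l (word xs)) (rep left l (word ys))" for xs ys
    unfolding word_mult by (induction xs) (simp_all add: rep_word comp_op_assoc)
  have 2: "rep left l (word xs * t) = comp_op left (rep left l (word xs)) (rep left l t)" for xs
    by (rule tens_eqI[of "\<lambda>t. rep left l (word xs * t)"])
      (intro linear_comp[OF linear_mult_right linear_rep] linear_comp[OF linear_rep linear_comp_op_right[OF linear_rep_apply]] 1)+
  show ?thesis
    by (rule tens_eqI[of "\<lambda>s. rep left l (s * t)"])
      (intro linear_comp[OF linear_mult_left linear_rep] linear_comp[OF linear_rep linear_comp_op_left[OF linear_rep_apply]] 2)+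
qed

lemma rep_graded:
  assumes P: "op_graded P" and G: "\<And>i v. v \<in> G i \<Longrightarrow> l v \<in> P i" and x: "x \<in> tens_grading G n"
  shows "rep left l x \<in> P n"
proof (rule linear_span_subset[OF linear_rep _ _ x[unfolded tens_grading_eq]])
  show "subspace (P n)" using P by (simp add: op_graded_def)
  have "rep left l (word xs) \<in> P n" if "homog_word G xs n" for xs n
    using that
  proof (induction xs arbitrary: n)
    case Nil
    then show ?case using P by (simp add: rep_word op_graded_def)
  next
    case (Cons v xs)
    then obtain i where i: "v \<in> G i" "homog_word G xs (n - i)" by (auto simp: homog_word_Cons)
    from op_graded_comp_op[OF P G[OF i(1)] Cons.IH[OF i(2)], of left] show ?case by (simp add: rep_word)
  qed
  then show "rep left l y \<in> P n" if "y \<in> {word xs |xs. homog_word G xs n}" for y using that by auto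
qed

lemma rep_closed:
  assumes "subspace Q" "(\<lambda>x. x) \<in> Q" "\<And>f g. f \<in> Q \<Longrightarrow> g \<in> Q \<Longrightarrow> f \<circ> g \<in> Q" "\<And>v. l v \<in> Q"
  shows "rep left l t \<in> Q"
proof (rule linear_span_subset[OF linear_rep assms(1) _ span_words])
  have "rep left l (word xs) \<in> Q" for xs
    by (induction xs) (auto simp: rep_word comp_op_def assms)
  then show "rep left l y \<in> Q" if "y \<in> range word" for y using that by auto
qed

context
  fixes G :: "int \<Rightarrow> 'v set"
  assumes rel: "\<And>i j v w. v \<in> G i \<Longrightarrow> w \<in> G j \<Longrightarrow> l v \<circ> l w = sign (i * j) *\<^sub>R (l w \<circ> l v)"
begin

lemma rep_sym_ideal: "x \<in> sym_ideal G \<Longrightarrow> rep left l x = 0"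
proof -
  assume x: "x \<in> sym_ideal G"
  have "rep left l x \<in> {0}"
  proof (rule sym_ideal_induct[OF x linear_rep subspace_single_0])
    fix s t v w i j assume v: "v \<in> G i" and w: "w \<in> G j"
    have "rep left l (word [v, w] - sign (i * j) *\<^sub>R word [w, v]) = 0"
      using rel[OF v w] rel[OF w v]
      by (simp add: linear_diff[OF linear_rep] linear_cmul[OF linear_rep] rep_word comp_op_def mult.commute)
    then show "rep left l (s * (word [v, w] - sign (i * j) *\<^sub>R word [w, v]) * t) \<in> {0}"
      by (simp add: rep_mult linear_0[OF linear_comp_op_right] linear_0[OF linear_comp_op_left] linear_rep_apply)
  qed
  then show ?thesis by simp
qed

lemma rep_quot: "rep left l (quot (sym_ideal G) x) = rep left l x"
  using rep_sym_ideal[OF quot_diff[OF subspace_sym_ideal, of x G]] by (simp add: linear_diff[OF linear_rep])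

lemma represents_Sym: "represents left (Sym G) (\<lambda>i. l ` G i) (rep left l)"
  unfolding represents_def
proof (intro conjI allI impI ballI)
  show "rep left l ` homog (Sym G) j \<subseteq> P j" if "op_graded P" "\<forall>i. l ` G i \<subseteq> P i" for P j
    using rep_graded[where G = G, OF that(1)] that(2) by (auto simp: homog_Sym rep_quot image_subset_iff)
qed (simp_all add: bilinear_rep gmult_Sym rep_quot rep_mult)

lemma rep_sym_gen: "rep left l (sym_gen G v) = l v"
  by (simp add: sym_gen_def rep_quot rep_letter)

lemma rep_gone: "rep left l (gone (Sym G)) = (\<lambda>x. x)"
  by (simp add: gone_Sym rep_quot rep_one)

end

end

lemma rep_commute:
  assumes l: "bilinear l" and T: "linear T" and c: "\<And>v. l v \<circ> T = T \<circ> l v"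
  shows "rep left l t \<circ> T = T \<circ> rep left l t"
proof -
  have "rep left l t \<in> {f. f \<circ> T = T \<circ> f}"
  proof (rule rep_closed[OF l])
    show "subspace {f. f \<circ> T = T \<circ> f}"
      using T by (auto simp: subspace_def linear_iff scaleR_fun_def fun_eq_iff linear_0)
    show "f \<circ> g \<in> {f. f \<circ> T = T \<circ> f}" if "f \<in> {f. f \<circ> T = T \<circ> f}" "g \<in> {f. f \<circ> T = T \<circ> f}" for f g
      using that by (simp add: fun_eq_iff)
  qed (use c in auto)
  then show ?thesis by simp
qed

definition tensor_rep :: "bool \<Rightarrow> ('a::real_vector \<Rightarrow> 'm::real_vector \<Rightarrow> 'm) \<Rightarrow> ('b::real_vector \<Rightarrow> 'm \<Rightarrow> 'm) \<Rightarrow>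
    ('a, 'b) tensor \<Rightarrow> 'm \<Rightarrow> 'm" where
  "tensor_rep left L1 L2 = tensor_lift (\<lambda>x y. comp_op left (L1 x) (L2 y))"

lemma
  assumes L1: "bilinear L1" and L2: "bilinear L2"
  shows linear_tensor_rep: "linear (tensor_rep left L1 L2)"
    and tensor_rep_pure: "tensor_rep left L1 L2 (a \<otimes> b) = comp_op left (L1 a) (L2 b)"
    and bilinear_tensor_rep: "bilinear (tensor_rep left L1 L2)"
proof -
  have l: "linear L1" "linear L2" by (intro linear_fun_param linear_bilinear L1 L2)+
  have B: "bilinear (\<lambda>x y. comp_op left (L1 x) (L2 y))"
    unfolding bilinear_def
    by (intro conjI allI linear_comp[OF l(1) linear_comp_op_left] linear_comp[OF l(2) linear_comp_op_right]
        linear_bilinear L1 L2)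
  show L: "linear (tensor_rep left L1 L2)"
    unfolding tensor_rep_def by (rule linear_tensor_lift[OF B])
  show pure: "tensor_rep left L1 L2 (a \<otimes> b) = comp_op left (L1 a) (L2 b)" for a b
    by (simp add: tensor_rep_def B)
  have *: "tensor_rep left L1 L2 t \<in> {f. linear f}" for t
    by (rule linear_span_subset[OF L subspace_linear _ span_pure_tensors])
      (auto simp: pure intro!: linear_comp_op linear_bilinear(1)[OF L1] linear_bilinear(1)[OF L2])
  then show "bilinear (tensor_rep left L1 L2)"
    unfolding bilinear_def by (intro conjI allI linear_fun_apply[OF L] CollectD[OF *])
qed

text \<open>The product of \<open>galg_tensor\<close> has no Koszul sign, so the operator of
  \<open>a'\<close> must move past that of \<open>b\<close> without a sign, which
  \<open>comm\<close> provides.\<close>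

lemma represents_tensor:
  assumes P: "graded_algebra P" and Q: "graded_algebra Q"
    and L1: "represents left P Ops1 L1" and L2: "represents left Q Ops2 L2"
    and comm: "\<And>a b. L1 a \<circ> L2 b = L2 b \<circ> L1 a"
  shows "represents left (galg_tensor P Q) (\<lambda>i. Ops1 i \<union> Ops2 i) (tensor_rep left L1 L2)"
proof -
  let ?L = "tensor_rep left L1 L2" and ?m = "gmult (galg_tensor P Q)"
  have h: "homog (galg_tensor P Q) = tensor_grading (homog P) (homog Q)" by (simp add: galg_tensor_def)
  have B: "bilinear L1" "bilinear L2" using L1 L2 by (auto simp: represents_def)
  note L = linear_tensor_rep[OF B] and pure = tensor_rep_pure[OF B]
  note la = linear_bilinear(1)[OF bilinear_tensor_rep[OF B]]
  note lm = linear_bilinear[OF graded_algebra_facts(2)[OF graded_algebra_tensor(1)[OF P Q]]]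
  have 1: "?L (?m (a \<otimes> b) (a' \<otimes> b')) = comp_op left (?L (a \<otimes> b)) (?L (a' \<otimes> b'))"
    if "a \<in> homog P i" "a' \<in> homog P i'" "b \<in> homog Q j" "b' \<in> homog Q j'" for a a' b b' i i' j j'
  proof -
    have "L1 (gmult P a a') = comp_op left (L1 a) (L1 a')" "L2 (gmult Q b b') = comp_op left (L2 b) (L2 b')"
      using L1 L2 that by (auto simp: represents_def)
    moreover have "comp_op left (L1 a') (L2 b) = comp_op left (L2 b) (L1 a')"
      using comm by (auto simp: comp_op_def)
    ultimately show ?thesis
      by (simp add: gmult_tensor[OF P Q] pure) (metis comp_op_assoc)
  qed
  have 2: "?L (?m (a \<otimes> b) t) = comp_op left (?L (a \<otimes> b)) (?L t)"
    if "a \<in> homog P i" "b \<in> homog Q j" "t \<in> tensor_grading (homog P) (homog Q) n" for a b t i j n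
    by (rule linear_eq_on_span[OF _ _ _ that(3)[unfolded tensor_grading_def], of "\<lambda>t. ?L (?m (a \<otimes> b) t)"])
      (intro linear_comp[OF lm(1) L] linear_comp[OF L linear_comp_op_right[OF la]], 
        intro linear_comp[OF L linear_comp_op_right[OF la]], use 1 that in blast)
  have 3: "?L (?m s t) = comp_op left (?L s) (?L t)"
    if "s \<in> tensor_grading (homog P) (homog Q) n" "t \<in> tensor_grading (homog P) (homog Q) n'" for s t n n'
    by (rule linear_eq_on_span[OF _ _ _ that(1)[unfolded tensor_grading_def], of "\<lambda>s. ?L (?m s t)"])
      (intro linear_comp[OF lm(2) L] linear_comp[OF L linear_comp_op_left[OF la]], 
        intro linear_comp[OF L linear_comp_op_left[OF la]], use 2 that in blast)
  show ?thesis
    unfolding represents_def h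
  proof (intro conjI allI impI ballI)
    fix R j assume R: "op_graded R" "\<forall>i. Ops1 i \<union> Ops2 i \<subseteq> R i"
    have in12: "L1 a \<in> R i" "L2 b \<in> R j" if "a \<in> homog P i" "b \<in> homog Q j" for a b i j
      using L1 L2 R that unfolding represents_def by (meson image_subset_iff le_sup_iff)+
    have "?L t \<in> R j" if "t \<in> tensor_grading (homog P) (homog Q) j" for t
    proof (rule linear_span_subset[OF L _ _ that[unfolded tensor_grading_def]])
      show "subspace (R j)" using R by (simp add: op_graded_def)
    qed (auto simp: pure intro!: op_graded_comp_op[OF R(1)] in12)
    then show "?L ` tensor_grading (homog P) (homog Q) j \<subseteq> R j" by auto
  qed (auto intro: 3 bilinear_tensor_rep[OF B])
qed

text \<open>Applied with \<open>e\<close> the differential, the sign operator or an operator of the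
  other action: commutation with \<open>e\<close> up to a sign passes from generators to all
  homogeneous elements.\<close>

lemma op_graded_twisted:
  assumes "linear e" "character c"
  shows "op_graded (\<lambda>j. {T. linear T \<and> (\<forall>x. e (T x) = c j *\<^sub>R T (e x))})"
  unfolding op_graded_def
proof (intro conjI allI ballI)
  show "subspace {T. linear T \<and> (\<forall>x. e (T x) = c i *\<^sub>R T (e x))}" for i
    unfolding subspace_def using assms(1)
    by (auto simp: linear_0 linear_add linear_cmul scaleR_fun_def linear_compose_add linear_compose_scale_right
        scaleR_add_right linear_zero plus_fun_def zero_fun_def)
  fix i j T T'
  assume T: "T \<in> {T. linear T \<and> (\<forall>x. e (T x) = c i *\<^sub>R T (e x))}" "T' \<in> {T. linear T \<and> (\<forall>x. e (T x) = c j *\<^sub>R T (e x))}"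
  then show "T \<circ> T' \<in> {T. linear T \<and> (\<forall>x. e (T x) = c (i + j) *\<^sub>R T (e x))}"
    using assms(2) by (auto simp: character_def linear_compose linear_cmul)
qed (use assms(2) in \<open>auto simp: character_def linear_ident\<close>)

text \<open>With a constant family this expresses invariance of one subspace, which is how stability
  of \<open>S\<close> is obtained.\<close>

lemma op_graded_degree:
  assumes "\<And>n. subspace (M n)"
  shows "op_graded (\<lambda>j. {T. \<forall>n. \<forall>x\<in>M n. T x \<in> M (n + j)})"
  unfolding op_graded_def
proof (intro conjI allI ballI)
  show "subspace {T. \<forall>n. \<forall>x\<in>M n. T x \<in> M (n + i)}" for i
    unfolding subspace_def using assms
    by (auto simp: scaleR_fun_def subspace_0 subspace_add subspace_scale)
  show "T \<circ> T' \<in> {T. \<forall>n. \<forall>x\<in>M n. T x \<in> M (n + (i + j))}"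
    if "T \<in> {T. \<forall>n. \<forall>x\<in>M n. T x \<in> M (n + i)}" "T' \<in> {T. \<forall>n. \<forall>x\<in>M n. T x \<in> M (n + j)}" for T T' i j
    using that by (auto simp: add.assoc[symmetric] add.commute[of i])
qed auto

lemma represents_op_graded:
  assumes "represents left A Ops L" "op_graded P" "\<And>i T. T \<in> Ops i \<Longrightarrow> T \<in> P i" "a \<in> homog A j"
  shows "L a \<in> P j"
  using assms unfolding represents_def by (meson image_subset_iff subsetI)

lemma graded_transfer_of_operators:
  fixes A :: "'a::real_vector galg" and B :: "'b::real_vector galg" and K :: "int \<Rightarrow> 'k::real_vector set"
    and M :: "int \<Rightarrow> 'm::real_vector set"
  assumes A: "graded_algebra A" and B: "graded_algebra B" and K: "graded_by_characters K"
    and L: "represents True A GA L" and R: "represents False B GB R"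
    and linear_maps: "linear sM" "linear d" "linear h" "linear i" "linear p"
    and GA: "\<And>j T. T \<in> GA j \<Longrightarrow> linear T" "\<And>j T x. T \<in> GA j \<Longrightarrow> d (T x) = sign j *\<^sub>R T (d x)"
      "\<And>j T x. T \<in> GA j \<Longrightarrow> sM (T x) = sign j *\<^sub>R T (sM x)" "\<And>j T x. T \<in> GA j \<Longrightarrow> x \<in> S \<Longrightarrow> T x \<in> S"
      "\<And>j T n x. T \<in> GA j \<Longrightarrow> x \<in> M n \<Longrightarrow> T x \<in> M (n + j)"
    and GB: "\<And>j T. T \<in> GB j \<Longrightarrow> linear T" "\<And>j T x. T \<in> GB j \<Longrightarrow> d (T x) = T (d x)"
      "\<And>j T x. T \<in> GB j \<Longrightarrow> sM (T x) = sign j *\<^sub>R T (sM x)" "\<And>j T x. T \<in> GB j \<Longrightarrow> x \<in> S \<Longrightarrow> T x \<in> S"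
      "\<And>j T n x. T \<in> GB j \<Longrightarrow> x \<in> M n \<Longrightarrow> T x \<in> M (n + j)"
    and GA_GB: "\<And>j j' T T' x. T \<in> GA j \<Longrightarrow> T' \<in> GB j' \<Longrightarrow> T (T' x) = T' (T x)"
    and retract: "\<And>x. sM (d x) = - d (sM x)" "\<And>x. sM (h x) = - h (sM x)" "\<And>\<kappa>. sM (i \<kappa>) = i (susp_sign K \<kappa>)"
      "\<And>x. p (sM x) = susp_sign K (p x)" "\<And>\<kappa>. d (i \<kappa>) = 0" "\<And>x. p (d x) = 0"
      "\<And>x. x \<in> S \<Longrightarrow> d (h x) + h (d x) = i (p x) - x"
    and S: "subspace S" "\<And>x. x \<in> S \<Longrightarrow> h x \<in> S" "\<And>\<kappa>. i \<kappa> \<in> S" "\<And>x. x \<in> S \<Longrightarrow> sM x \<in> S"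
    and M: "\<And>n. subspace (M n)" "\<And>n x. x \<in> M n \<Longrightarrow> h x \<in> M (n - 1)"
      "\<And>n \<kappa>. \<kappa> \<in> K (n + 1) \<Longrightarrow> i \<kappa> \<in> M n" "\<And>n x. x \<in> M n \<Longrightarrow> sM x \<in> M n" "\<And>n x. x \<in> M n \<Longrightarrow> p x \<in> K (n + 1)"
  shows "graded_transfer A B K M S sM L R d h i p"
proof -
  note rA = represents_op_graded[OF L] and rB = represents_op_graded[OF R]
  have one: "character (\<lambda>_. 1)" by (simp add: character_def)
  have BL: "bilinear L" "bilinear R" using L R by (auto simp: represents_def)
  have dL: "d (L a x) = sign j *\<^sub>R L a (d x)" and sL: "sM (L a x) = sign j *\<^sub>R L a (sM x)"
    and SL: "y \<in> S \<Longrightarrow> L a y \<in> S" and GL: "z \<in> M n \<Longrightarrow> L a z \<in> M (j + n)"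
    if "a \<in> homog A j" for a j x y z n
    using rA[OF op_graded_twisted[OF linear_maps(2) character_sign] _ that] rA[OF op_graded_twisted[OF linear_maps(1) character_sign] _ that]
      rA[OF op_graded_degree[of "\<lambda>_. S"] _ that] rA[OF op_graded_degree[of M] _ that] GA S(1) M(1)
    by (auto simp: add.commute[of j n])
  have dR: "d (R b x) = R b (d x)" and sR: "sM (R b x) = sign j *\<^sub>R R b (sM x)"
    and SR: "y \<in> S \<Longrightarrow> R b y \<in> S" and GR: "z \<in> M n \<Longrightarrow> R b z \<in> M (n + j)"
    if "b \<in> homog B j" for b j x y z n
    using rB[OF op_graded_twisted[OF linear_maps(2) one] _ that] rB[OF op_graded_twisted[OF linear_maps(1) character_sign] _ that]
      rB[OF op_graded_degree[of "\<lambda>_. S"] _ that] rB[OF op_graded_degree[of M] _ that] GB S(1) M(1)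
    by auto
  \<comment> \<open>Commutation of the two actions is extended in two stages: over A with a
    generating operator of B fixed, then over B with an element of A fixed.\<close>
  have LT: "L a (T x) = T (L a x)" if "a \<in> homog A j" "T \<in> GB j'" for a j T j' x
    using rA[OF op_graded_twisted[OF GB(1)[OF that(2)] one] _ that(1)] GA(1) GA_GB[OF _ that(2)] by auto
  have LR: "L a (R b x) = R b (L a x)" if "a \<in> homog A j" "b \<in> homog B j'" for a j b j' x
    using rB[OF op_graded_twisted[OF linear_bilinear(1)[OF BL(1)] one] _ that(2), of a] GB(1) LT[OF that(1)] by auto
  show ?thesis
  proof (rule graded_transfer.intro)
    show "L (gmult A a a') x = L a (L a' x)" if "a \<in> homog A j" "a' \<in> homog A j'" for a j a' j' x
      using L that by (simp add: represents_def comp_op_def)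
    show "R (gmult B b b') x = R b' (R b x)" if "b \<in> homog B j" "b' \<in> homog B j'" for b j b' j' x
      using R that by (simp add: represents_def comp_op_def)
  qed (fact A B K linear_maps BL dL sL SL GL dR sR SR GR LR retract S M)+
qed

section \<open>The Koszul complex\<close>

type_synonym 'k koszul_fun = "(nat \<Rightarrow> nat) \<Rightarrow> nat set \<Rightarrow> 'k"

text \<open>This is -1 to the number of elements of \<open>T\<close> below \<open>j\<close>, the
  sign of moving \<eta>_j past the factors of smaller index.\<close>

definition esign :: "nat \<Rightarrow> nat set \<Rightarrow> real" where
  "esign j T = (\<Prod>i<j. if i \<in> T then -1 else 1)"

text \<open>The function \<open>m\<close> stands for the sum of \<open>m e T \<cdot> x^e \<cdot> \<Prod>\<^sub>i\<^sub>\<in>\<^sub>T \<eta>\<^sub>i\<close>, a formal power series in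
  commuting variables \<open>x\<^sub>i\<close> and anticommuting \<open>\<eta>\<^sub>i\<close>. In order, these are multiplication by \<open>x\<^sub>i\<close>, the
  derivative by \<open>x\<^sub>i\<close>, the derivative by \<open>\<eta>\<^sub>i\<close> and multiplication by \<open>\<eta>\<^sub>i\<close>.\<close>

definition mul_x :: "nat \<Rightarrow> 'k::real_vector koszul_fun \<Rightarrow> 'k koszul_fun" where
  "mul_x i m = (\<lambda>e T. if e i = 0 then 0 else m (e(i := e i - 1)) T)"

definition der_x :: "nat \<Rightarrow> 'k::real_vector koszul_fun \<Rightarrow> 'k koszul_fun" where
  "der_x i m = (\<lambda>e T. real (Suc (e i)) *\<^sub>R m (e(i := Suc (e i))) T)"

definition der_eta :: "nat \<Rightarrow> 'k::real_vector koszul_fun \<Rightarrow> 'k koszul_fun" where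
  "der_eta i m = (\<lambda>e T. if i \<in> T then 0 else esign i T *\<^sub>R m e (insert i T))"

definition mul_eta :: "nat \<Rightarrow> 'k::real_vector koszul_fun \<Rightarrow> 'k koszul_fun" where
  "mul_eta i m = (\<lambda>e T. if i \<in> T then esign i T *\<^sub>R m e (T - {i}) else 0)"

section \<open>Weyl and Clifford relations\<close>

lemma esign_insert: "esign j (insert i T) = (if i < j \<and> i \<notin> T then - esign j T else esign j T)"
proof (cases "i < j \<and> i \<notin> T")
  case True
  have "esign j (insert i T) = (if i \<in> insert i T then -1 else 1) * (\<Prod>l\<in>{..<j} - {i}. if l \<in> insert i T then -1 else 1)"
    unfolding esign_def by (rule prod.remove) (use True in auto)
  also have "(\<Prod>l\<in>{..<j} - {i}. if l \<in> insert i T then -1 else 1 :: real) = (\<Prod>l\<in>{..<j} - {i}. if l \<in> T then -1 else 1)"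
    by (rule prod.cong) auto
  also have "esign j T = (if i \<in> T then -1 else 1) * (\<Prod>l\<in>{..<j} - {i}. if l \<in> T then -1 else 1)"
    unfolding esign_def by (rule prod.remove) (use True in auto)
  ultimately show ?thesis using True by simp
qed (auto simp: esign_def insert_absorb intro!: prod.cong)

lemma esign_remove: "esign j (T - {i}) = (if i < j \<and> i \<in> T then - esign j T else esign j T)"
  using esign_insert[of j i "T - {i}"] by (cases "i \<in> T") (auto simp: insert_absorb)

lemma esign_square: "esign j T * esign j T = 1"
  unfolding esign_def prod.distrib[symmetric] by (rule prod.neutral) auto

lemmas fun_algebra = scaleR_fun_def plus_fun_def zero_fun_def fun_Compl_def minus_apply

lemmas koszul_operators = mul_x_def der_x_def der_eta_def mul_eta_def

lemma linear_koszul_operators: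
  "linear (mul_x i)" "linear (der_x i)" "linear (der_eta i)" "linear (mul_eta i)"
  by (auto simp: linear_iff koszul_operators fun_algebra fun_eq_iff scaleR_add_right mult.commute)

lemma mul_x_mul_x: "mul_x i (mul_x j m) = mul_x j (mul_x i m)"
  by (cases "i = j") (auto simp: koszul_operators fun_eq_iff fun_upd_twist)

lemma der_x_mul_x: "der_x j (mul_x i m) = mul_x i (der_x j m) + (if i = j then m else 0)"
  by (cases "i = j") (auto simp: koszul_operators fun_eq_iff fun_upd_twist fun_algebra scaleR_add_left gr0_conv_Suc)

lemma mul_x_eta: "mul_x i (der_eta j m) = der_eta j (mul_x i m)" "mul_x i (mul_eta j m) = mul_eta j (mul_x i m)"
  "der_x i (der_eta j m) = der_eta j (der_x i m)" "der_x i (mul_eta j m) = mul_eta j (der_x i m)"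
  by (auto simp: koszul_operators fun_eq_iff)

lemma der_eta_der_eta: "der_eta i (der_eta j m) = - der_eta j (der_eta i m)"
  by (cases i j rule: linorder_cases)
    (auto simp: koszul_operators fun_eq_iff fun_algebra esign_insert insert_commute)

lemma der_eta_mul_eta: "der_eta i (mul_eta j m) + mul_eta j (der_eta i m) = (if i = j then m else 0)"
proof (cases "i = j")
  case True
  then show ?thesis
    by (auto simp: koszul_operators fun_eq_iff fun_algebra esign_insert esign_remove esign_square insert_absorb)
next
  case False
  then have "insert i (T - {j}) = insert i T - {j}" for T by auto
  with False show ?thesis
    by (auto simp: koszul_operators fun_eq_iff fun_algebra esign_insert esign_remove)
qed

lemma mul_x_der_x: "mul_x i (der_x i m) e T = real (e i) *\<^sub>R m e T"
  by (auto simp: koszul_operators)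

lemma mul_eta_der_eta: "mul_eta i (der_eta i m) e T = (if i \<in> T then m e T else 0)"
  by (auto simp: koszul_operators esign_remove esign_square insert_absorb)

lemma sum_fun2: "(\<Sum>i\<in>I. f i) e T = (\<Sum>i\<in>I. f i e T)"
  for f :: "'i \<Rightarrow> 'a \<Rightarrow> 'b \<Rightarrow> 'c::comm_monoid_add"
  by (induction I rule: infinite_finite_induct) (auto simp: zero_fun_def plus_fun_def)

section \<open>The contraction and the sign operators\<close>

locale koszul_complex =
  fixes n :: nat and K :: "int \<Rightarrow> 'k::real_vector set"
  assumes K: "graded_by_characters K"
begin

abbreviation "sK \<equiv> susp_sign K"

lemmas linear_sK = linear_susp_sign[OF K]

definition diff :: "'k koszul_fun \<Rightarrow> 'k koszul_fun" where
  "diff m = (\<Sum>i<n. mul_x i (der_eta i m))"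

definition codiff :: "'k koszul_fun \<Rightarrow> 'k koszul_fun" where
  "codiff m = (\<Sum>i<n. mul_eta i (der_x i m))"

definition weight :: "(nat \<Rightarrow> nat) \<Rightarrow> nat set \<Rightarrow> real" where
  "weight e T = (\<Sum>i<n. real (e i) + (if i \<in> T then 1 else 0))"

text \<open>As \<open>inverse 0 = 0\<close>, the part of weight zero is dropped; this is the source
  of the term \<open>const (augment m)\<close> in the homotopy identity.\<close>

definition unweight :: "'k koszul_fun \<Rightarrow> 'k koszul_fun" where
  "unweight m = (\<lambda>e T. inverse (weight e T) *\<^sub>R m e T)"

definition contract :: "'k koszul_fun \<Rightarrow> 'k koszul_fun" where
  "contract m = - unweight (codiff m)"

definition const :: "'k \<Rightarrow> 'k koszul_fun" where
  "const \<kappa> = (\<lambda>e T. if e = (\<lambda>_. 0) \<and> T = {} then \<kappa> else 0)"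

definition augment :: "'k koszul_fun \<Rightarrow> 'k" where
  "augment m = m (\<lambda>_. 0) {}"

text \<open>Indices from \<open>n\<close> on are invisible to \<open>weight\<close>, so a monomial
  in such variables alone has weight zero without being constant. Here these are excluded.\<close>

definition supported :: "'k koszul_fun set" where
  "supported = {m. \<forall>e T. (\<exists>j\<ge>n. e j \<noteq> 0 \<or> j \<in> T) \<longrightarrow> m e T = 0}"

definition sgn_op :: "'k koszul_fun \<Rightarrow> 'k koszul_fun" where
  "sgn_op m = (\<lambda>e T. esign n T *\<^sub>R sK (m e T))"

text \<open>\<open>susp_sign\<close> carries the sign of the shifted degree; the minus turns it into
  (-1)^i on values in \<open>K i\<close>.\<close>

definition val_sgn :: "'k koszul_fun \<Rightarrow> 'k koszul_fun" where
  "val_sgn m = (\<lambda>e T. - sK (m e T))"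

text \<open>Each \<eta> has degree -1, each x degree 0, and the summand 1 is the suspension. Cutting
  \<open>T\<close> down to indices below \<open>n\<close> keeps the cardinality finite.\<close>

definition grade :: "int \<Rightarrow> 'k koszul_fun set" where
  "grade N = {m. \<forall>e T. m e T \<in> K (N + 1 + int (card (T \<inter> {..<n})))}"

lemma linear_ops: "linear diff" "linear codiff" "linear unweight" "linear contract" "linear const" "linear augment"
  "linear sgn_op" "linear val_sgn"
proof -
  show d: "linear diff" "linear codiff"
    unfolding diff_def codiff_def
    by (intro linear_compose_sum ballI linear_comp[OF linear_koszul_operators(3)] linear_comp[OF linear_koszul_operators(2)]
        linear_koszul_operators)+
  show u: "linear unweight"
    by (auto simp: linear_iff unweight_def fun_algebra fun_eq_iff scaleR_add_right mult.commute)
  show "linear contract"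
    unfolding contract_def by (intro linear_compose_neg linear_comp[OF d(2) u])
  show "linear const" "linear augment"
    by (auto simp: linear_iff const_def augment_def fun_algebra fun_eq_iff)
  show "linear sgn_op" "linear val_sgn"
    by (auto simp: linear_iff sgn_op_def val_sgn_def fun_algebra fun_eq_iff linear_add[OF linear_sK] linear_cmul[OF linear_sK]
        scaleR_add_right mult.commute)
qed

text \<open>Terms with two different indices cancel. For equal indices the Clifford relation leaves
  \<open>mul_x i (der_x i m)\<close> and the Weyl relation leaves
  \<open>mul_eta i (der_eta i m)\<close>; both act diagonally on monomials and together count the
  weight.\<close>

lemma diff_codiff: "diff (codiff m) + codiff (diff m) = (\<lambda>e T. weight e T *\<^sub>R m e T)"
proof -
  note L = linear_koszul_operators
  have "diff (codiff m) + codiff (diff m) =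
      (\<Sum>i<n. \<Sum>j<n. mul_x i (der_eta i (mul_eta j (der_x j m))) + mul_eta j (der_x j (mul_x i (der_eta i m))))"
    unfolding diff_def codiff_def
    by (simp add: linear_sum[OF L(1)] linear_sum[OF L(2)] linear_sum[OF L(3)] linear_sum[OF L(4)] sum.distrib)
      (subst sum.swap, simp)
  also have "\<dots> = (\<Sum>i<n. \<Sum>j<n. if i = j then mul_x i (der_x j m) + mul_eta j (der_eta i m) else 0)"
  proof (intro sum.cong refl)
    fix i j
    have "mul_x i (der_eta i (mul_eta j (der_x j m))) + mul_eta j (der_x j (mul_x i (der_eta i m))) =
       mul_x i (der_eta i (mul_eta j (der_x j m)) + mul_eta j (der_eta i (der_x j m)))
       + (if i = j then mul_eta j (der_eta i m) else 0)"
      by (simp add: der_x_mul_x linear_add[OF L(1)] linear_add[OF L(3)] linear_add[OF L(4)] mul_x_eta linear_0[OF L(3)] linear_0[OF L(4)])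
    also have "\<dots> = (if i = j then mul_x i (der_x j m) + mul_eta j (der_eta i m) else 0)"
      by (simp add: der_eta_mul_eta linear_0[OF L(1)])
    finally show "mul_x i (der_eta i (mul_eta j (der_x j m))) + mul_eta j (der_x j (mul_x i (der_eta i m))) =
      (if i = j then mul_x i (der_x j m) + mul_eta j (der_eta i m) else 0)" .
  qed
  also have "\<dots> = (\<Sum>i<n. mul_x i (der_x i m) + mul_eta i (der_eta i m))"
    by simp
  also have "\<dots> = (\<lambda>e T. weight e T *\<^sub>R m e T)"
    by (intro ext) (auto simp: sum_fun2 plus_fun_def mul_x_der_x mul_eta_der_eta weight_def scaleR_sum_left
        scaleR_add_left intro!: sum.cong)
  finally show ?thesis .
qed

text \<open>\<open>diff\<close> trades one \<eta>_i for one x_i and so preserves the weight.\<close>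

lemma unweight_diff: "unweight (diff m) = diff (unweight m)"
proof (intro ext)
  fix e T
  have "inverse (weight e T) *\<^sub>R mul_x i (der_eta i m) e T = mul_x i (der_eta i (unweight m)) e T" if "i < n" for i
  proof (cases "e i \<noteq> 0 \<and> i \<notin> T")
    case True
    have "weight (e(i := e i - 1)) (insert i T) = weight e T"
      unfolding weight_def sum.remove[OF finite_lessThan, of i n, unfolded lessThan_iff, OF that]
      using True by simp
    with True show ?thesis by (simp add: mul_x_def der_eta_def unweight_def mult.commute)
  qed (auto simp: mul_x_def der_eta_def)
  moreover have "unweight (diff m) e T = inverse (weight e T) *\<^sub>R diff m e T"
    by (simp only: unweight_def)
  ultimately show "unweight (diff m) e T = diff (unweight m) e T"
    by (simp add: diff_def sum_fun2 scaleR_sum_right)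
qed

lemma homotopy:
  assumes "m \<in> supported"
  shows "diff (contract m) + contract (diff m) = const (augment m) - m"
proof -
  have "diff (contract m) + contract (diff m) = - unweight (diff (codiff m) + codiff (diff m))"
    by (simp add: contract_def linear_neg[OF linear_ops(1)] unweight_diff linear_add[OF linear_ops(3)])
  also have "\<dots> = const (augment m) - m"
  proof (intro ext)
    fix e T
    have w: "weight e T = 0 \<longleftrightarrow> (\<forall>i<n. e i = 0 \<and> i \<notin> T)"
      unfolding weight_def by (subst sum_nonneg_eq_0_iff) (auto simp: add_nonneg_eq_0_iff)
    show "(- unweight (diff (codiff m) + codiff (diff m))) e T = (const (augment m) - m) e T"
    proof (cases "weight e T = 0")
      \<comment> \<open>Weight zero leaves two kinds of monomials: those with an index outside the
        range, where \<open>m\<close> vanishes by support, and the constant one.\<close>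
      case True
      show ?thesis
      proof (cases "\<exists>j\<ge>n. e j \<noteq> 0 \<or> j \<in> T")
        case True
        then have "m e T = 0" using assms unfolding supported_def by blast
        moreover have "\<not> (e = (\<lambda>_. 0) \<and> T = {})" using True by auto
        ultimately show ?thesis
          unfolding diff_codiff by (auto simp: unweight_def const_def fun_Compl_def)
      next
        case False
        then have "e j = 0 \<and> j \<notin> T" for j
          using \<open>weight e T = 0\<close> w by (cases "j < n") auto
        then have "e = (\<lambda>_. 0)" "T = {}" by auto
        with \<open>weight e T = 0\<close> show ?thesis
          unfolding diff_codiff by (simp add: unweight_def const_def augment_def fun_Compl_def)
      qed
    next
      case False
      moreover have "\<not> (e = (\<lambda>_. 0) \<and> T = {})" using False w by auto
      ultimately show ?thesis
        unfolding diff_codiff by (auto simp: unweight_def const_def fun_Compl_def)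
    qed
  qed
  finally show ?thesis .
qed

lemma diff_const: "diff (const \<kappa>) = 0"
  unfolding diff_def by (intro sum.neutral) (auto simp: mul_x_def der_eta_def const_def fun_eq_iff)

lemma augment_mul_x: "augment (mul_x i m) = 0"
  by (simp add: augment_def mul_x_def)

lemma augment_diff: "augment (diff m) = 0"
  by (simp add: diff_def linear_sum[OF linear_ops(6)] augment_mul_x)

lemma sgn_op_x: "sgn_op (mul_x i m) = mul_x i (sgn_op m)" "sgn_op (der_x i m) = der_x i (sgn_op m)"
  by (auto simp: sgn_op_def mul_x_def der_x_def fun_eq_iff linear_0[OF linear_sK] linear_cmul[OF linear_sK] mult.commute)

text \<open>Adding or removing one index below \<open>n\<close> flips \<open>esign n\<close>; larger
  indices are not counted by it.\<close>

lemma sgn_op_eta: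
  "i < n \<Longrightarrow> sgn_op (der_eta i m) = - der_eta i (sgn_op m)" "i < n \<Longrightarrow> sgn_op (mul_eta i m) = - mul_eta i (sgn_op m)"
  by (auto simp: sgn_op_def der_eta_def mul_eta_def fun_eq_iff fun_algebra linear_0[OF linear_sK]
     linear_cmul[OF linear_sK] mult.commute esign_insert esign_remove)

lemma sgn_op_diff: "sgn_op (diff m) = - diff (sgn_op m)"
  by (simp add: diff_def linear_sum[OF linear_ops(7)] sgn_op_x sgn_op_eta linear_neg[OF linear_koszul_operators(1)] sum_negf)

lemma sgn_op_contract: "sgn_op (contract m) = - contract (sgn_op m)"
proof -
  have "sgn_op (codiff m) = - codiff (sgn_op m)"
    by (simp add: codiff_def linear_sum[OF linear_ops(7)] sgn_op_x sgn_op_eta sum_negf)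
  moreover have "sgn_op (unweight m) = unweight (sgn_op m)" for m
    by (auto simp: sgn_op_def unweight_def fun_eq_iff linear_cmul[OF linear_sK] mult.commute)
  ultimately show ?thesis
    by (simp add: contract_def linear_neg[OF linear_ops(7)] linear_neg[OF linear_ops(3)])
qed

lemma sgn_op_const: "sgn_op (const \<kappa>) = const (sK \<kappa>)"
  by (auto simp: sgn_op_def const_def fun_eq_iff linear_0[OF linear_sK] esign_def)

lemma augment_sgn_op: "augment (sgn_op m) = sK (augment m)"
  by (simp add: augment_def sgn_op_def esign_def)

lemma val_sgn_commute:
  "val_sgn (mul_x i m) = mul_x i (val_sgn m)" "val_sgn (der_eta i m) = der_eta i (val_sgn m)"
  "val_sgn (sgn_op m) = sgn_op (val_sgn m)"
  by (auto simp: val_sgn_def mul_x_def der_eta_def sgn_op_def fun_eq_iff linear_0[OF linear_sK] linear_cmul[OF linear_sK]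
    linear_neg[OF linear_sK])

lemma val_sgn_diff: "val_sgn (diff m) = diff (val_sgn m)"
  by (simp add: diff_def linear_sum[OF linear_ops(8)] val_sgn_commute)

definition lin_x :: "(nat \<Rightarrow> real) \<Rightarrow> 'k koszul_fun \<Rightarrow> 'k koszul_fun" where
  "lin_x c m = (\<Sum>i<n. c i *\<^sub>R mul_x i m)"

definition lin_eta :: "(nat \<Rightarrow> real) \<Rightarrow> 'k koszul_fun \<Rightarrow> 'k koszul_fun" where
  "lin_eta c m = (\<Sum>i<n. c i *\<^sub>R der_eta i m)"

lemma linear_lin: "linear (lin_x c)" "linear (lin_eta c)"
  unfolding lin_x_def lin_eta_def
  by (intro linear_compose_sum ballI linear_compose_scale_right linear_koszul_operators)+

lemma lin_commute:
  "lin_x c (lin_x c' m) = lin_x c' (lin_x c m)"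
  "lin_x c (lin_eta c' m) = lin_eta c' (lin_x c m)"
  "lin_eta c (lin_eta c' m) = - lin_eta c' (lin_eta c m)"
  "diff (lin_x c m) = lin_x c (diff m)"
  "diff (lin_eta c m) = - lin_eta c (diff m)"
  "sgn_op (lin_x c m) = lin_x c (sgn_op m)"
  "sgn_op (lin_eta c m) = - lin_eta c (sgn_op m)"
  "val_sgn (lin_x c m) = lin_x c (val_sgn m)"
  "val_sgn (lin_eta c m) = lin_eta c (val_sgn m)"
proof -
  note L = linear_koszul_operators
  note S = linear_sum[OF L(1)] linear_sum[OF L(3)] linear_cmul[OF L(1)] linear_cmul[OF L(3)] linear_neg[OF L(1)]
     scaleR_sum_right sum_negf[symmetric]
  show "lin_x c (lin_x c' m) = lin_x c' (lin_x c m)"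
    unfolding lin_x_def S by (subst sum.swap) (simp add: mult.commute mul_x_mul_x)
  show "lin_x c (lin_eta c' m) = lin_eta c' (lin_x c m)"
    unfolding lin_x_def lin_eta_def S by (subst sum.swap) (simp add: mult.commute mul_x_eta)
  show "lin_eta c (lin_eta c' m) = - lin_eta c' (lin_eta c m)"
    unfolding lin_eta_def S
    by (subst sum.swap, intro sum.cong refl) (subst der_eta_der_eta, simp add: mult.commute)
  show "diff (lin_x c m) = lin_x c (diff m)"
    unfolding lin_x_def diff_def S by (subst sum.swap) (simp add: mul_x_mul_x mul_x_eta[symmetric])
  show "diff (lin_eta c m) = - lin_eta c (diff m)"
    unfolding lin_eta_def diff_def S
    by (subst sum.swap, intro sum.cong refl) (subst der_eta_der_eta, simp add: mul_x_eta S)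
  show "sgn_op (lin_x c m) = lin_x c (sgn_op m)" "sgn_op (lin_eta c m) = - lin_eta c (sgn_op m)"
    "val_sgn (lin_x c m) = lin_x c (val_sgn m)" "val_sgn (lin_eta c m) = lin_eta c (val_sgn m)"
    by (simp_all add: lin_x_def lin_eta_def linear_sum[OF linear_ops(7)] linear_cmul[OF linear_ops(7)] sgn_op_x sgn_op_eta
      linear_sum[OF linear_ops(8)] linear_cmul[OF linear_ops(8)] val_sgn_commute sum_negf)
qed

end

lemma represents_mono:
  "represents left A Ops L \<Longrightarrow> (\<And>i. Ops i \<subseteq> Ops' i) \<Longrightarrow> represents left A Ops' L"
  unfolding represents_def by (meson subset_trans)

context koszul_complex
begin

lemma subspace_K: "subspace (K N)"
  using K by (simp add: graded_by_characters_def)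

lemma susp_sign_K: "\<kappa> \<in> K N \<Longrightarrow> sK \<kappa> \<in> K N"
  by (rule susp_sign_closed[OF K])

lemma susp_sign_square: "\<kappa> \<in> total K \<Longrightarrow> sK (sK \<kappa>) = \<kappa>"
  by (rule total_eqI[OF linear_comp[OF linear_sK linear_sK] linear_ident])
    (auto simp: susp_sign_homog[OF K] linear_neg[OF linear_sK] linear_cmul[OF linear_sK] sign_simps)

lemma subspace_supported: "subspace supported"
  by (auto simp: subspace_def supported_def fun_algebra)

lemma supported_koszul:
  assumes "m \<in> supported" "i < n"
  shows "mul_x i m \<in> supported" "der_x i m \<in> supported" "der_eta i m \<in> supported" "mul_eta i m \<in> supported"
proof -
  have z: "m e T = 0" if "n \<le> j" "e j \<noteq> 0 \<or> j \<in> T" for e T j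
    using assms(1) that unfolding supported_def by blast
  have "mul_x i m e T = 0 \<and> der_x i m e T = 0 \<and> der_eta i m e T = 0 \<and> mul_eta i m e T = 0"
    if j: "n \<le> j" "e j \<noteq> 0 \<or> j \<in> T" for e T j
    using z[OF j(1), of "e(i := e i - 1)" T] z[OF j(1), of "e(i := Suc (e i))" T] z[OF j(1), of e "insert i T"]
      z[OF j(1), of e "T - {i}"] j assms(2) by (auto simp: koszul_operators)
  then show "mul_x i m \<in> supported" "der_x i m \<in> supported" "der_eta i m \<in> supported" "mul_eta i m \<in> supported"
    unfolding supported_def by blast+
qed

lemma supported_ops:
  assumes "m \<in> supported"
  shows "contract m \<in> supported" "lin_x c m \<in> supported" "lin_eta c m \<in> supported" "sgn_op m \<in> supported" "val_sgn m \<in> supported"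
proof -
  have "codiff m \<in> supported"
    unfolding codiff_def using assms by (intro subspace_sum[OF subspace_supported] supported_koszul) auto
  then show "contract m \<in> supported"
    by (auto simp: contract_def unweight_def supported_def fun_Compl_def)
  show "lin_x c m \<in> supported" "lin_eta c m \<in> supported"
    unfolding lin_x_def lin_eta_def
    using assms by (intro subspace_sum[OF subspace_supported] subspace_scale[OF subspace_supported] supported_koszul; simp)+
  show "sgn_op m \<in> supported" "val_sgn m \<in> supported"
    using assms by (auto simp: supported_def sgn_op_def val_sgn_def linear_0[OF linear_sK])
qed

lemma const_supported: "const \<kappa> \<in> supported"
  by (auto simp: const_def supported_def)

lemma subspace_grade: "subspace (grade N)"
  using subspace_K by (auto simp: subspace_def grade_def fun_algebra)

lemma card_insert_range: "i < n \<Longrightarrow> i \<notin> T \<Longrightarrow> card (insert i T \<inter> {..<n}) = Suc (card (T \<inter> {..<n}))"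
  by (simp add: Int_insert_left)

lemma grade_koszul:
  assumes "m \<in> grade N" "i < n"
  shows "mul_x i m \<in> grade N" "der_x i m \<in> grade N" "der_eta i m \<in> grade (N + 1)" "mul_eta i m \<in> grade (N - 1)"
proof -
  have m: "m e T \<in> K (N + 1 + int (card (T \<inter> {..<n})))" for e T
    using assms by (simp add: grade_def)
  show "mul_x i m \<in> grade N" "der_x i m \<in> grade N"
    using m by (auto simp: grade_def mul_x_def der_x_def subspace_0[OF subspace_K] subspace_scale[OF subspace_K])
  have "der_eta i m e T \<in> K (N + 1 + 1 + int (card (T \<inter> {..<n})))" for e T
    using m[of e "insert i T"] card_insert_range[OF assms(2), of T]
    by (auto simp: der_eta_def subspace_0[OF subspace_K] algebra_simps intro!: subspace_scale[OF subspace_K])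
  then show "der_eta i m \<in> grade (N + 1)" by (simp add: grade_def)
  have "mul_eta i m e T \<in> K (N - 1 + 1 + int (card (T \<inter> {..<n})))" for e T
  proof (cases "i \<in> T")
    case True
    then have "card (T \<inter> {..<n}) = Suc (card ((T - {i}) \<inter> {..<n}))"
      using card_insert_range[OF assms(2), of "T - {i}"] by (simp add: insert_absorb)
    with m[of e "T - {i}"] True show ?thesis
      by (auto simp: mul_eta_def algebra_simps intro!: subspace_scale[OF subspace_K])
  qed (simp add: mul_eta_def subspace_0[OF subspace_K])
  then show "mul_eta i m \<in> grade (N - 1)" by (simp add: grade_def)
qed

lemma grade_ops:
  assumes "m \<in> grade N"
  shows "contract m \<in> grade (N - 1)" "lin_x c m \<in> grade N" "lin_eta c m \<in> grade (N + 1)" "sgn_op m \<in> grade N" "val_sgn m \<in> grade N"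
proof -
  have "codiff m \<in> grade (N - 1)"
    unfolding codiff_def using assms by (intro subspace_sum[OF subspace_grade] grade_koszul) auto
  then show "contract m \<in> grade (N - 1)"
    by (auto simp: contract_def unweight_def grade_def fun_Compl_def subspace_neg[OF subspace_K] subspace_scale[OF subspace_K])
  show "lin_x c m \<in> grade N" "lin_eta c m \<in> grade (N + 1)"
    unfolding lin_x_def lin_eta_def
    using assms by (intro subspace_sum[OF subspace_grade] subspace_scale[OF subspace_grade] grade_koszul; simp)+
  show "sgn_op m \<in> grade N" "val_sgn m \<in> grade N"
    using assms by (auto simp: grade_def sgn_op_def val_sgn_def subspace_neg[OF subspace_K] subspace_scale[OF subspace_K] susp_sign_K)
qed

lemma const_grade: "\<kappa> \<in> K (N + 1) \<Longrightarrow> const \<kappa> \<in> grade N"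
  by (auto simp: const_def grade_def subspace_0[OF subspace_K])

lemma augment_grade: "m \<in> grade N \<Longrightarrow> augment m \<in> K (N + 1)"
proof -
  assume "m \<in> grade N"
  then have "m (\<lambda>_. 0) {} \<in> K (N + 1 + int (card ({} \<inter> {..<n})))" unfolding grade_def by blast
  then show ?thesis by (simp add: augment_def)
qed

text \<open>The generators of \<open>A\<close> of degree 1 act with the sign \<open>(-1)^|\<kappa>|\<close> on values of degree
  \<open>|\<kappa>|\<close>, to cancel the sign that appears in \<open>d\<^sup>1\<^sup>,\<^sup>1\<close> otherwise. Those of \<open>B\<close> act from the right.\<close>

definition left_ops :: "int \<Rightarrow> ('k koszul_fun \<Rightarrow> 'k koszul_fun) set" where
  "left_ops j = {T. T = 0 \<or> j = 0 \<and> T \<in> range lin_x \<or> j = 1 \<and> (\<exists>c. T = (\<lambda>m. val_sgn (lin_eta c m)))}"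

definition right_ops :: "int \<Rightarrow> ('k koszul_fun \<Rightarrow> 'k koszul_fun) set" where
  "right_ops j = {T. T = 0 \<or> j = 0 \<and> T \<in> range lin_x \<or> j = 1 \<and> (\<exists>c. T = (\<lambda>m. lin_eta c (sgn_op m)))}"

lemma left_ops_cases:
  assumes "T \<in> left_ops j"
  obtains "T = (\<lambda>_. 0)" | c where "j = 0" "T = lin_x c" | c where "j = 1" "T = (\<lambda>m. val_sgn (lin_eta c m))"
  using assms by (auto simp: left_ops_def zero_fun_def)

lemma right_ops_cases:
  assumes "T \<in> right_ops j"
  obtains "T = (\<lambda>_. 0)" | c where "j = 0" "T = lin_x c" | c where "j = 1" "T = (\<lambda>m. lin_eta c (sgn_op m))"
  using assms by (auto simp: right_ops_def zero_fun_def)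

lemmas neg_simps = linear_neg[OF linear_lin(1)] linear_neg[OF linear_lin(2)] linear_neg[OF linear_ops(7)] linear_neg[OF linear_ops(8)]
  linear_0[OF linear_ops(1)] linear_0[OF linear_ops(7)] linear_0[OF linear_ops(8)] linear_0[OF linear_lin(1)] linear_0[OF linear_lin(2)]

lemma koszul_transfer:
  assumes A: "graded_algebra A" and B: "graded_algebra B"
    and L: "represents True A left_ops L" and R: "represents False B right_ops R"
  shows "graded_transfer A B K grade supported sgn_op L R diff contract const augment"
proof (rule graded_transfer_of_operators[OF A B K L R])
  show "linear T" if "T \<in> left_ops j" for T j
    using that by (cases rule: left_ops_cases) (auto intro: linear_zero linear_lin linear_comp[OF linear_lin(2) linear_ops(8)])
  show "linear T" if "T \<in> right_ops j" for T j
    using that by (cases rule: right_ops_cases) (auto intro: linear_zero linear_lin linear_comp[OF linear_ops(7) linear_lin(2)])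
  show "diff (T x) = sign j *\<^sub>R T (diff x)" "sgn_op (T x) = sign j *\<^sub>R T (sgn_op x)" if "T \<in> left_ops j" for T j x
    using that by (cases rule: left_ops_cases; simp add: neg_simps lin_commute sign_simps val_sgn_diff[symmetric]
       val_sgn_commute(3)[symmetric])+
  show "diff (T x) = T (diff x)" "sgn_op (T x) = sign j *\<^sub>R T (sgn_op x)" if "T \<in> right_ops j" for T j x
    using that by (cases rule: right_ops_cases; simp add: neg_simps lin_commute sign_simps sgn_op_diff)+
  show "T x \<in> supported" if "T \<in> left_ops j" "x \<in> supported" for T j x
    using that(1) by (cases rule: left_ops_cases) (simp_all add: that supported_ops subspace_0[OF subspace_supported])
  show "T x \<in> supported" if "T \<in> right_ops j" "x \<in> supported" for T j x
    using that(1) by (cases rule: right_ops_cases) (simp_all add: that supported_ops subspace_0[OF subspace_supported])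
  show "T x \<in> grade (N + j)" if "T \<in> left_ops j" "x \<in> grade N" for T j x N
    using that(1) by (cases rule: left_ops_cases) (simp_all add: that grade_ops subspace_0[OF subspace_grade])
  show "T x \<in> grade (N + j)" if "T \<in> right_ops j" "x \<in> grade N" for T j x N
    using that(1) by (cases rule: right_ops_cases) (simp_all add: that grade_ops subspace_0[OF subspace_grade])
  show "T (T' x) = T' (T x)" if T: "T \<in> left_ops j" and T': "T' \<in> right_ops j'" for T T' x j j'
  proof -
    \<comment> \<open>Two minus signs cancel: the derivatives anticommute with one another, and
      \<open>sgn_op\<close> anticommutes with the derivative it passes.\<close>
    have e: "lin_eta c (lin_eta c' (sgn_op m)) = lin_eta c' (sgn_op (lin_eta c m))" for c c' m
      unfolding lin_commute(7) linear_neg[OF linear_lin(2)] by (rule lin_commute)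
    show ?thesis
      by (rule left_ops_cases[OF T]; rule right_ops_cases[OF T'])
        (simp_all add: neg_simps lin_commute(1,2,6,8,9) e val_sgn_commute(3))
  qed
qed (fact linear_ops sgn_op_diff sgn_op_contract sgn_op_const augment_sgn_op diff_const augment_diff homotopy
   subspace_supported supported_ops const_supported subspace_grade grade_ops const_grade augment_grade)+

lemma der_x_const: "der_x i (const \<kappa>) = 0" and der_eta_const: "der_eta i (const \<kappa>) = 0"
  by (auto simp: koszul_operators const_def fun_eq_iff)

text \<open>On monomials of weight one \<open>unweight\<close> is the identity, so the contraction
  merely replaces x_j by -\<eta>_j.\<close>

lemma contract_lin_x_const: "contract (lin_x c (const \<kappa>)) = - (\<Sum>j<n. c j *\<^sub>R mul_eta j (const \<kappa>))"
proof -
  note L = linear_koszul_operators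
  have "codiff (mul_x j (const \<kappa>)) = mul_eta j (const \<kappa>)" if "j < n" for j
    unfolding codiff_def using that
    by (simp add: der_x_mul_x der_x_const linear_0[OF L(1)] linear_0[OF L(4)] if_distrib[of "mul_eta _"] cong: if_cong)
  moreover have "unweight (mul_eta j (const \<kappa>)) = mul_eta j (const \<kappa>)" if "j < n" for j
  proof (intro ext)
    fix e T
    show "unweight (mul_eta j (const \<kappa>)) e T = mul_eta j (const \<kappa>) e T"
    proof (cases "e = (\<lambda>_. 0) \<and> T = {j}")
      case True
      then have "weight e T = 1" using that by (simp add: weight_def)
      then show ?thesis by (simp add: unweight_def)
    next
      case False
      then have "mul_eta j (const \<kappa>) e T = 0" by (auto simp: mul_eta_def const_def)
      then show ?thesis by (simp add: unweight_def)
    qed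
  qed
  ultimately show ?thesis
    by (simp add: contract_def lin_x_def linear_sum[OF linear_ops(2)] linear_sum[OF linear_ops(3)] linear_cmul[OF linear_ops(2)]
      linear_cmul[OF linear_ops(3)])
qed

lemma augment_pairing:
  "augment (lin_eta c (\<Sum>j<n. c' j *\<^sub>R mul_eta j (const \<kappa>))) = (\<Sum>i<n. c i * c' i) *\<^sub>R \<kappa>"
proof -
  note L = linear_koszul_operators
  have *: "der_eta i (mul_eta j (const \<kappa>)) = (if i = j then const \<kappa> else 0)" for i j
    using der_eta_mul_eta[of i j "const \<kappa>"] by (simp add: der_eta_const linear_0[OF L(4)])
  have "lin_eta c (\<Sum>j<n. c' j *\<^sub>R mul_eta j (const \<kappa>)) = (\<Sum>i<n. (c i * c' i) *\<^sub>R const \<kappa>)"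
    by (simp add: lin_eta_def linear_sum[OF L(3)] linear_cmul[OF L(3)] * scaleR_sum_right if_distrib[of "scaleR _"] cong: if_cong)
  then show ?thesis
    by (simp add: scaleR_sum_left[symmetric] linear_cmul[OF linear_ops(6)]) (simp add: augment_def const_def)
qed

text \<open>A generator is given by its parts of degree 0 and 1, because the signs of the actions
  depend on the degree. The equations for the operators of these parts read off the coordinates that
  enter the pairing.\<close>

theorem koszul_bimodule:
  assumes A: "graded_algebra A" and B: "graded_algebra B"
    and L: "represents True A left_ops L" and R: "represents False B right_ops R"
  shows "\<exists>dA dB dK. ainf_of_algebra A dA \<and> ainf_of_algebra B dB
    \<and> ainf_bimodule_structure (homog A) dA (homog B) dB K dK
    \<and> (\<forall>a0\<in>homog A 0. \<forall>a1\<in>homog A 1. \<forall>b0\<in>homog B 0. \<forall>b1\<in>homog B 1. \<forall>\<alpha> \<alpha>' \<beta> \<beta>'. \<forall>\<kappa>\<in>total K.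
         L a0 = lin_x \<alpha> \<longrightarrow> L a1 = (\<lambda>m. val_sgn (lin_eta \<alpha>' m)) \<longrightarrow>
         R b0 = lin_x \<beta> \<longrightarrow> R b1 = (\<lambda>m. lin_eta \<beta>' (sgn_op m)) \<longrightarrow>
         bitaylor dK [a0 + a1] \<kappa> [b0 + b1] = (\<Sum>i<n. \<alpha> i * \<beta>' i + \<alpha>' i * \<beta> i) *\<^sub>R \<kappa>)"
proof -
  interpret T: graded_transfer A B K grade supported sgn_op L R diff contract const augment
    by (rule koszul_transfer[OF assms])
  have "bitaylor T.D [a0 + a1] \<kappa> [b0 + b1] = (\<Sum>i<n. \<alpha> i * \<beta>' i + \<alpha>' i * \<beta> i) *\<^sub>R \<kappa>"
    if h: "a0 \<in> homog A 0" "a1 \<in> homog A 1" "b0 \<in> homog B 0" "b1 \<in> homog B 1"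
      and op: "L a0 = lin_x \<alpha>" "L a1 = (\<lambda>m. val_sgn (lin_eta \<alpha>' m))" "R b0 = lin_x \<beta>" "R b1 = (\<lambda>m. lin_eta \<beta>' (sgn_op m))"
      and \<kappa>: "\<kappa> \<in> total K"
    for a0 a1 b0 b1 \<alpha> \<alpha>' \<beta> \<beta>' \<kappa>
  proof -
    have lam: "T.lam (a0 + a1) m = - lin_x \<alpha> m + val_sgn (lin_eta \<alpha>' m)" for m
      using linear_add[OF T.linear_lam(2)] by (simp add: T.lam_homog[OF h(1)] T.lam_homog[OF h(2)] op sign_simps)
    have rho: "T.rho (b0 + b1) m = lin_x \<beta> (sgn_op m) + lin_eta \<beta>' (sgn_op (sgn_op m))" for m
      using linear_add[OF T.linear_rho(2)] by (simp add: T.rho_homog[OF h(3)] T.rho_homog[OF h(4)] op)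
    have eta0: "lin_eta c (const k) = 0" for c k
      by (simp add: lin_eta_def der_eta_const)
    have ax: "augment (lin_x c m) = 0" for c m
      by (simp add: lin_x_def linear_sum[OF linear_ops(6)] linear_cmul[OF linear_ops(6)] augment_mul_x)
    have av: "augment (val_sgn m) = - sK (augment m)" for m
      by (simp add: augment_def val_sgn_def)
    \<comment> \<open>Constants are killed by the derivatives, so only the functional part of the
      inner letter survives; multiples of the x_i are killed by the augmentation, so only the
      exterior part of the outer one does. The two signs on \<kappa>, from \<open>sgn_op\<close> and
      \<open>val_sgn\<close>, cancel.\<close>
    have 1: "augment (T.lam (a0 + a1) (contract (T.rho (b0 + b1) (const \<kappa>)))) = (\<Sum>i<n. \<alpha>' i * \<beta> i) *\<^sub>R \<kappa>"
      by (simp add: rho lam sgn_op_const eta0 contract_lin_x_const linear_add[OF linear_ops(6)] linear_neg[OF linear_ops(6)]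
        linear_diff[OF linear_ops(6)] ax av augment_pairing neg_simps linear_neg[OF linear_sK] linear_cmul[OF linear_sK] susp_sign_square[OF \<kappa>])
    have sg: "sgn_op (\<Sum>j<n. c j *\<^sub>R mul_eta j m) = - (\<Sum>j<n. c j *\<^sub>R mul_eta j (sgn_op m))" for c m
      by (simp add: linear_sum[OF linear_ops(7)] linear_cmul[OF linear_ops(7)] sgn_op_eta sum_negf)
    \<comment> \<open>With the sides exchanged: the minus signs of \<open>lam\<close> in degree 0
      and of \<open>contract\<close> cancel, as do those of the two applications of
      \<open>sgn_op\<close>.\<close>
    have 2: "augment (T.rho (b0 + b1) (contract (T.lam (a0 + a1) (const \<kappa>)))) = (\<Sum>i<n. \<alpha> i * \<beta>' i) *\<^sub>R \<kappa>"
      by (simp add: rho lam eta0 neg_simps linear_neg[OF linear_ops(4)] contract_lin_x_const linear_add[OF linear_ops(6)]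
        linear_neg[OF linear_ops(6)] linear_diff[OF linear_ops(6)] ax sg sgn_op_const augment_pairing susp_sign_square[OF \<kappa>] mult.commute)
    show ?thesis
      by (simp add: T.bitaylor_one_one 1 2 sum.distrib scaleR_add_left)
  qed
  then show ?thesis
    using ainf_of_graded_algebra[OF A] ainf_of_graded_algebra[OF B] T.ainf_bimodule by blast
qed

end

text \<open>Outside degree \<open>d\<close> the grading contains only 0, so the relations reduce to
  pairs of degree \<open>d\<close>, where they ask the operators to commute for even
  \<open>d\<close> and to anticommute for odd \<open>d\<close>.\<close>

lemma represents_in_degree:
  assumes l: "bilinear l" and rel: "\<And>v w m. l v (l w m) = sign (d * d) *\<^sub>R l w (l v m)"
    and ops: "\<And>v. l v \<in> Ops d" "\<And>i. 0 \<in> Ops i"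
  shows "represents left (Sym (in_degree d C)) Ops (rep left l)"
    and "rep left l (sym_gen (in_degree d C) v) = l v"
    and "rep left l (gone (Sym (in_degree d C))) = (\<lambda>m. m)"
proof -
  have l0: "l 0 = 0" "l v 0 = 0" for v
    using linear_0[OF linear_bilinear(1)[OF l]] linear_0[OF linear_bilinear(2)[OF l]] by (auto simp: fun_eq_iff)
  have r: "l v \<circ> l w = sign (i * j) *\<^sub>R (l w \<circ> l v)" if "v \<in> in_degree d C i" "w \<in> in_degree d C j" for v w i j
  proof (cases "i = d \<and> j = d")
    case True
    have "(l v \<circ> l w) m = (sign (i * j) *\<^sub>R (l w \<circ> l v)) m" for m
      unfolding scaleR_fun_def o_def using True rel[of v w m] by simp
    then show ?thesis by (rule ext)
  next
    case False
    with that have "v = 0 \<or> w = 0" by (auto simp: in_degree_def split: if_splits)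
    then show ?thesis by (auto simp: fun_eq_iff scaleR_fun_def l0)
  qed
  have "l ` in_degree d C i \<subseteq> Ops i" for i
    using ops by (auto simp: in_degree_def l0)
  with represents_Sym[OF l r] show "represents left (Sym (in_degree d C)) Ops (rep left l)"
    by (rule represents_mono)
  show "rep left l (sym_gen (in_degree d C) v) = l v" by (rule rep_sym_gen[OF l r])
  show "rep left l (gone (Sym (in_degree d C))) = (\<lambda>m. m)" by (rule rep_gone[OF l r])
qed

section \<open>Actions of generators on the Koszul complex\<close>

context koszul_complex
begin

definition x_act :: "(nat \<Rightarrow> 'v::real_vector \<Rightarrow> real) \<Rightarrow> 'v \<Rightarrow> 'k koszul_fun \<Rightarrow> 'k koszul_fun" where
  "x_act c v = lin_x (\<lambda>i. c i v)"

definition eta_act :: "bool \<Rightarrow> (nat \<Rightarrow> 'v::real_vector \<Rightarrow> real) \<Rightarrow> 'v \<Rightarrow> 'k koszul_fun \<Rightarrow> 'k koszul_fun" where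
  "eta_act left c v m = (if left then val_sgn (lin_eta (\<lambda>i. c i v) m) else lin_eta (\<lambda>i. c i v) (sgn_op m))"

lemma linear_lin_coeff:
  assumes "\<And>i. linear (c i)"
  shows "linear (\<lambda>v. lin_x (\<lambda>i. c i v) m)" "linear (\<lambda>v. lin_eta (\<lambda>i. c i v) m)"
proof -
  have "linear (\<lambda>v. c i v *\<^sub>R y)" for i and y :: "'k koszul_fun"
    using assms[of i] by (simp add: linear_iff scaleR_add_left)
  then show "linear (\<lambda>v. lin_x (\<lambda>i. c i v) m)" "linear (\<lambda>v. lin_eta (\<lambda>i. c i v) m)"
    unfolding lin_x_def lin_eta_def by (auto intro: linear_compose_sum)
qed

lemma bilinear_act:
  assumes "\<And>i. linear (c i)"
  shows "bilinear (x_act c)" "bilinear (eta_act left c)"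
proof -
  show "bilinear (x_act c)"
    unfolding bilinear_def x_act_def by (auto intro: linear_lin linear_lin_coeff assms)
  show "bilinear (eta_act left c)"
    unfolding bilinear_def eta_act_def
  by (cases left; auto intro: linear_lin linear_lin_coeff assms linear_comp[OF linear_lin(2) linear_ops(8)]
      linear_comp[OF linear_ops(7) linear_lin(2)] linear_comp[OF linear_lin_coeff(2) linear_ops(8)])
qed

abbreviation "ops left \<equiv> (if left then left_ops else right_ops)"

lemma act_relations:
  "x_act c v (x_act c' w m) = x_act c' w (x_act c v m)"
  "eta_act left b u (eta_act left b u' m) = - eta_act left b u' (eta_act left b u m)"
  "x_act c v (eta_act left c' w m) = eta_act left c' w (x_act c v m)"
proof -
  show "x_act c v (x_act c' w m) = x_act c' w (x_act c v m)"
    unfolding x_act_def by (rule lin_commute)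
  show "eta_act left b u (eta_act left b u' m) = - eta_act left b u' (eta_act left b u m)"
  proof (cases left)
    case True
    then show ?thesis
      unfolding eta_act_def if_P[OF True] lin_commute(9) by (intro lin_commute(3))
  next
    case False
    show ?thesis
      unfolding eta_act_def if_not_P[OF False] lin_commute(7) linear_neg[OF linear_lin(2)]
      by (rule arg_cong[of _ _ uminus], rule lin_commute(3))
  qed
  show "x_act c v (eta_act left c' w m) = eta_act left c' w (x_act c v m)"
    by (simp add: x_act_def eta_act_def lin_commute(2,6,8,9))
qed

lemma act_ops: "x_act c v \<in> ops left 0" "eta_act left c v \<in> ops left 1" "0 \<in> ops left i"
  by (auto simp: x_act_def eta_act_def[abs_def] left_ops_def right_ops_def)

lemma represents_x:
  assumes "\<And>i. linear (c i)"
  shows "represents left (SymAlg C) (ops left) (rep left (x_act c))"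
    and "rep left (x_act c) (sym_gen (in_degree 0 C) v) = x_act c v"
    and "rep left (x_act c) (gone (SymAlg C)) = (\<lambda>m. m)"
proof -
  have r: "x_act c v (x_act c w m) = sign (0 * 0) *\<^sub>R x_act c w (x_act c v m)" for v w m
    using act_relations(1)[of c v c w m] by (simp add: sign_simps(6))
  note R = represents_in_degree[of "x_act c" 0 "ops left", OF bilinear_act(1)[OF assms] r act_ops(1,3)]
  show "represents left (SymAlg C) (ops left) (rep left (x_act c))"
    "rep left (x_act c) (sym_gen (in_degree 0 C) v) = x_act c v"
    "rep left (x_act c) (gone (SymAlg C)) = (\<lambda>m. m)"
    by (rule R)+
qed

lemma represents_eta:
  assumes "\<And>i. linear (c i)"
  shows "represents left (ExtAlg C) (ops left) (rep left (eta_act left c))"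
    and "rep left (eta_act left c) (sym_gen (in_degree 1 C) v) = eta_act left c v"
    and "rep left (eta_act left c) (gone (ExtAlg C)) = (\<lambda>m. m)"
proof -
  have r: "eta_act left c v (eta_act left c w m) = sign (1 * 1) *\<^sub>R eta_act left c w (eta_act left c v m)" for v w m
    using act_relations(2)[of left c v w m] by (simp add: sign_simps(3))
  note R = represents_in_degree[of "eta_act left c" 1 "ops left", OF bilinear_act(2)[OF assms] r act_ops(2,3)]
  show "represents left (ExtAlg C) (ops left) (rep left (eta_act left c))"
    "rep left (eta_act left c) (sym_gen (in_degree 1 C) v) = eta_act left c v"
    "rep left (eta_act left c) (gone (ExtAlg C)) = (\<lambda>m. m)"
    by (rule R)+
qed

definition brane_act where
  "brane_act left c c' = tensor_rep left (rep left (x_act c)) (rep left (eta_act left c'))"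

lemma represents_brane:
  assumes c: "\<And>i. linear (c i)" and c': "\<And>i. linear (c' i)" and "subspace C" "subspace C'"
  shows "represents left (galg_tensor (SymAlg C) (ExtAlg C')) (ops left) (brane_act left c c')"
    and "brane_act left c c' (sym_gen (in_degree 0 C) f \<otimes> gone (ExtAlg C')) = x_act c f"
    and "brane_act left c c' (gone (SymAlg C) \<otimes> sym_gen (in_degree 1 C') q) = eta_act left c' q"
proof -
  note Bx = bilinear_act(1)[of c, OF c] and Be = bilinear_act(2)[of c', OF c']
  have 1: "x_act c v \<circ> eta_act left c' w = eta_act left c' w \<circ> x_act c v" for v w
    by (rule ext) (simp add: act_relations(3))
  have 2: "rep left (x_act c) s \<circ> eta_act left c' w = eta_act left c' w \<circ> rep left (x_act c) s" for s w
    by (rule rep_commute[OF Bx linear_bilinear(1)[OF Be] 1])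
  have 3: "rep left (x_act c) s \<circ> rep left (eta_act left c') t = rep left (eta_act left c') t \<circ> rep left (x_act c) s" for s t
    by (rule rep_commute[OF Be linear_rep_apply[OF Bx] 2[symmetric], symmetric])
  show "represents left (galg_tensor (SymAlg C) (ExtAlg C')) (ops left) (brane_act left c c')"
    unfolding brane_act_def
    by (rule represents_mono[OF represents_tensor[OF _ _ represents_x(1)[of c, OF c] represents_eta(1)[of c', OF c'] 3]])
      (simp_all add: graded_algebra_Sym graded_by_characters_in_degree assms)
  show "brane_act left c c' (sym_gen (in_degree 0 C) f \<otimes> gone (ExtAlg C')) = x_act c f"
    "brane_act left c c' (gone (SymAlg C) \<otimes> sym_gen (in_degree 1 C') q) = eta_act left c' q"
    unfolding brane_act_def tensor_rep_pure[OF bilinear_rep[OF Bx] bilinear_rep[OF Be]]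
    using represents_x[of c, OF c] represents_eta[of c', OF c'] by simp_all
qed

end

lemma sym_gen_homog: "v \<in> C \<Longrightarrow> sym_gen (in_degree d C) v \<in> homog (Sym (in_degree d C)) d"
  unfolding sym_gen_def homog_Sym
  by (intro imageI word_tens_grading) (simp add: homog_word_Cons in_degree_def)

lemma gone_homog: "gone (Sym G) \<in> homog (Sym G) 0"
  unfolding gone_Sym homog_Sym by (intro imageI one_grading)

lemma subspace_dual: "subspace (dual U)"
  by (auto simp: subspace_def dual_def scaleR_fun_def algebra_simps)

section \<open>Coordinates of a pairing\<close>

text \<open>The \<open>w i\<close> are preimages in \<open>U\<close> of a basis of the image, and
  the \<open>c i\<close> extend the dual basis to linear functionals on the whole space.\<close>

lemma image_coordinates:
  fixes P :: "'x::real_vector \<Rightarrow> 'x"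
  assumes fin: "\<exists>S :: 'x set. finite S \<and> span S = UNIV" and P: "linear P" and U: "subspace U"
  shows "\<exists>(n :: nat) w c. (\<forall>i. linear (c i :: 'x \<Rightarrow> real)) \<and> (\<forall>i<n. w i \<in> U)
    \<and> (\<forall>z\<in>U. P z = (\<Sum>i<n. c i (P z) *\<^sub>R P (w i)))"
proof -
  obtain S :: "'x set" where S: "finite S" "span S = UNIV" using fin by blast
  obtain B where B: "B \<subseteq> P ` U" "independent B" "P ` U \<subseteq> span B"
    using maximal_independent_subset by metis
  have "finite B" using independent_span_bound[OF S(1) B(2)] S(2) by auto
  then obtain n :: nat and b where b: "bij_betw b {..<n} B"
    using finite_same_card_bij[of "{..<card B}" B] by auto
  have bB: "b i \<in> B" if "i < n" for i using b that by (auto simp: bij_betw_def)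
  have "\<exists>w. w \<in> U \<and> P w = b i" if "i < n" for i using bB[OF that] B(1) by force
  then obtain w where w: "\<And>i. i < n \<Longrightarrow> w i \<in> U \<and> P (w i) = b i" by metis
  have "\<exists>c. linear c \<and> (\<forall>x\<in>B. c x = (if x = b i then 1 else 0 :: real))" for i
    using linear_independent_extend[OF B(2), of "\<lambda>x. if x = b i then 1 else 0 :: real"] by blast
  then obtain c where c: "\<And>i. linear (c i)" "\<And>i x. x \<in> B \<Longrightarrow> c i x = (if x = b i then 1 else 0 :: real)"
    by metis
  have "P z = (\<Sum>i<n. c i (P z) *\<^sub>R P (w i))" if "z \<in> U" for z
  proof -
    have "linear (\<lambda>t. \<Sum>i<n. c i t *\<^sub>R b i)"
    proof (intro linear_compose_sum ballI)
      show "linear (\<lambda>t. c i t *\<^sub>R b i)" for i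
        using c(1)[of i] by (simp add: linear_iff scaleR_add_left)
    qed
    moreover have "x = (\<Sum>i<n. c i x *\<^sub>R b i)" if "x \<in> B" for x
    proof -
      obtain j where j: "j < n" "x = b j" using b \<open>x \<in> B\<close> by (auto simp: bij_betw_def)
      have "(\<Sum>i<n. c i x *\<^sub>R b i) = (\<Sum>i<n. if i = j then b i else 0)"
      proof (rule sum.cong[OF refl])
        fix i assume "i \<in> {..<n}"
        then have "b j = b i \<longleftrightarrow> i = j" using b j by (auto simp: bij_betw_def inj_on_def)
        then show "c i x *\<^sub>R b i = (if i = j then b i else 0)"
          using c(2)[OF \<open>x \<in> B\<close>, of i] j by auto
      qed
      then show ?thesis using j by simp
    qed
    ultimately have "P z = (\<Sum>i<n. c i (P z) *\<^sub>R b i)"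
      using linear_eq_on_span[of "\<lambda>t. t" "\<lambda>t. \<Sum>i<n. c i t *\<^sub>R b i" B "P z"] linear_ident B(3) \<open>z \<in> U\<close> by blast
    then show ?thesis using w by simp
  qed
  with c(1) w show ?thesis by blast
qed

text \<open>An element of \<open>dual U\<close> is zero outside \<open>U\<close> and linear only on
  \<open>U\<close>, so the partial sums have to be kept inside \<open>U\<close>.\<close>

lemma dual_sum:
  assumes "f \<in> dual U" "subspace U" "\<And>i. i \<in> I \<Longrightarrow> w i \<in> U"
  shows "f (\<Sum>i\<in>I. a i *\<^sub>R w i) = (\<Sum>i\<in>I. a i * f (w i))"
  using assms(3)
proof (induction I rule: infinite_finite_induct)
  case (insert i I)
  have "(\<Sum>i\<in>I. a i *\<^sub>R w i) \<in> U" "a i *\<^sub>R w i \<in> U"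
    using insert.prems assms(2) by (auto intro!: subspace_sum subspace_scale)
  then show ?case using insert assms(1) by (simp add: dual_def)
next
  have "f (0 *\<^sub>R 0) = 0" using assms(1) subspace_0[OF assms(2)] unfolding dual_def by fastforce
  { case (infinite A) then show ?case using \<open>f (0 *\<^sub>R 0) = 0\<close> by simp
  next case empty then show ?case using \<open>f (0 *\<^sub>R 0) = 0\<close> by simp }
qed

text \<open>On \<open>U\<close> the class \<open>quot V z\<close> determines \<open>z\<close> up to
  \<open>U \<inter> V\<close>, where \<open>f\<close> vanishes; so \<open>f z\<close> is a
  combination of the coordinates of that class. This is the pairing of (U/(U \<inter> V))* with U/(U
  \<inter> V) inside X/V.\<close>

lemma pairing_coordinates:
  fixes U V :: "'x::real_vector set"
  assumes fin: "\<exists>S :: 'x set. finite S \<and> span S = UNIV" and U: "subspace U" and V: "subspace V"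
  shows "\<exists>(n :: nat) (w :: nat \<Rightarrow> 'x) c. (\<forall>i. linear (c i :: 'x \<Rightarrow> real))
    \<and> (\<forall>f\<in>dual U. \<forall>z\<in>U. (\<forall>x\<in>U \<inter> V. f x = 0) \<longrightarrow> f z = (\<Sum>i<n. f (w i) * c i (quot V z)))"
proof -
  note q = quot[OF V]
  obtain n :: nat and w c where c: "\<forall>i. linear (c i :: 'x \<Rightarrow> real)" and w: "\<forall>i<n. w i \<in> U"
    and e: "\<forall>z\<in>U. quot V z = (\<Sum>i<n. c i (quot V z) *\<^sub>R quot V (w i))"
    using image_coordinates[OF fin q(1) U] by blast
  have "f z = (\<Sum>i<n. f (w i) * c i (quot V z))"
    if f: "f \<in> dual U" "\<forall>x\<in>U \<inter> V. f x = 0" and z: "z \<in> U" for f z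
  proof -
    \<comment> \<open>A representative in \<open>U\<close> of the class of \<open>z\<close>, built
      from the chosen preimages.\<close>
    let ?y = "\<Sum>i<n. c i (quot V z) *\<^sub>R w i"
    have y: "?y \<in> U" using w by (auto intro!: subspace_sum[OF U] subspace_scale[OF U])
    have "quot V (z - ?y) = quot V z - (\<Sum>i<n. c i (quot V z) *\<^sub>R quot V (w i))"
      by (simp add: linear_diff[OF q(1)] linear_sum[OF q(1)] linear_cmul[OF q(1)])
    then have "quot V (z - ?y) = 0"
      by (simp only: e[rule_format, OF z, symmetric] diff_self)
    then have "z - ?y \<in> U \<inter> V" using q(3) subspace_diff[OF U z y] by simp
    then have "f (?y + (z - ?y)) = f ?y + f (z - ?y)" "f (z - ?y) = 0"
      using f y unfolding dual_def by blast+
    then have "f z = f ?y" by simp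
    then show ?thesis using dual_sum[OF f(1) U, of "{..<n}" w] w by (simp add: mult.commute)
  qed
  with c show ?thesis by blast
qed

lemma sum_lessThan_add: "(\<Sum>i<m + n. f i) = (\<Sum>i<m. f i) + (\<Sum>i<n. f (m + i))"
  for f :: "nat \<Rightarrow> real"
  by (induction n) (simp_all add: add.assoc)

theorem proposition1p1:
  assumes "\<exists>S :: 'x::real_vector set. finite S \<and> span S = UNIV"
  shows
    "(\<exists>dA dB dK.
        ainf_of_algebra (ExtAlg (UNIV :: 'x set)) dA \<and>
        ainf_of_algebra (SymAlg (dual (UNIV :: 'x set))) dB \<and>
        ainf_bimodule_structure
          (homog (ExtAlg (UNIV :: 'x set))) dA
          (homog (SymAlg (dual (UNIV :: 'x set)))) dB
          (in_degree 0 (UNIV :: real set)) dK \<and>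
        (\<forall>\<kappa>. \<forall>v. \<forall>u\<in>dual (UNIV :: 'x set).
           bitaylor dK [sym_gen (in_degree 1 UNIV) v] \<kappa> [sym_gen (in_degree 0 (dual UNIV)) u]
             = u v *\<^sub>R \<kappa>))
     \<and>
     (\<forall>U V :: 'x set. subspace U \<and> subspace V \<longrightarrow>
       (\<exists>dA dB dK.
          ainf_of_algebra (brane_alg U) dA \<and>
          ainf_of_algebra (brane_alg V) dB \<and>
          ainf_bimodule_structure (homog (brane_alg U)) dA (homog (brane_alg V)) dB
            (brane_space U V) dK \<and>
          (\<forall>\<kappa> \<in> total (brane_space U V).
           \<forall>f \<in> dual U. \<forall>y \<in> V. \<forall>g \<in> dual V. \<forall>z \<in> U.
             (\<forall>x \<in> U \<inter> V. f x = 0) \<longrightarrow> (\<forall>x \<in> U \<inter> V. g x = 0) \<longrightarrow>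
             bitaylor dK [brane_gen U (f, quot U y)] \<kappa> [brane_gen V (g, quot V z)]
               = (f z + g y) *\<^sub>R \<kappa>)))"
proof (intro conjI allI impI, goal_cases)
  case 1
  \<comment> \<open>This is not literally the second part with U = {0} and V = X, as the algebras
    there carry further tensor factors on the zero space.\<close>
  let ?A = "ExtAlg (UNIV :: 'x set)" and ?B = "SymAlg (dual (UNIV :: 'x set))" and ?K = "in_degree 0 (UNIV :: real set)"
  have K: "graded_by_characters ?K" by (rule graded_by_characters_in_degree) simp
  have A: "graded_algebra ?A" and B: "graded_algebra ?B"
    by (intro graded_algebra_Sym graded_by_characters_in_degree subspace_UNIV subspace_dual)+
  \<comment> \<open>Modulo {0} nothing is identified, so these are coordinates of X itself.\<close>
  obtain n :: nat and w :: "nat \<Rightarrow> 'x" and c where c': "\<forall>i. linear (c i :: 'x \<Rightarrow> real)"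
    and pair0: "\<forall>f\<in>dual UNIV. \<forall>z\<in>UNIV. (\<forall>x\<in>UNIV \<inter> {0}. f x = 0) \<longrightarrow> f z = (\<Sum>i<n. f (w i) * c i (quot {0} z))"
    using pairing_coordinates[OF assms subspace_UNIV subspace_single_0] by blast
  note c = c'[rule_format]
  have pair: "u v = (\<Sum>i<n. u (w i) * c i v)" if u: "u \<in> dual UNIV" for u v
  proof -
    have "u (0 *\<^sub>R 0) = 0 * u 0" using u unfolding dual_def by blast
    then have "\<forall>x\<in>UNIV \<inter> {0}. u x = 0" by simp
    then have "u v = (\<Sum>i<n. u (w i) * c i (quot {0} v))" using pair0 u by blast
    moreover have "quot {0} v = v" using quot_diff[OF subspace_single_0, of v] by simp
    ultimately show ?thesis by simp
  qed
  interpret koszul_complex n ?K by unfold_locales (rule K)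
  have w: "\<And>i. linear (\<lambda>u :: 'x \<Rightarrow> real. u (w i))" by (simp add: linear_iff scaleR_fun_def)
  note rA = represents_eta[of c True "UNIV :: 'x set", OF c] and rB = represents_x[of "\<lambda>i u. u (w i)" False "dual UNIV", OF w]
  note BA = bilinear_rep[OF bilinear_act(2)[of c, OF c], of True] and BB = bilinear_rep[OF bilinear_act(1)[of "\<lambda>i u. u (w i)", OF w], of False]
  obtain dA dB dK where d: "ainf_of_algebra ?A dA" "ainf_of_algebra ?B dB"
    "ainf_bimodule_structure (homog ?A) dA (homog ?B) dB ?K dK"
    and val: "\<forall>a0\<in>homog ?A 0. \<forall>a1\<in>homog ?A 1. \<forall>b0\<in>homog ?B 0. \<forall>b1\<in>homog ?B 1. \<forall>\<alpha> \<alpha>' \<beta> \<beta>'. \<forall>\<kappa>\<in>total ?K.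
         rep True (eta_act True c) a0 = lin_x \<alpha> \<longrightarrow> rep True (eta_act True c) a1 = (\<lambda>m. val_sgn (lin_eta \<alpha>' m)) \<longrightarrow>
         rep False (x_act (\<lambda>i u. u (w i))) b0 = lin_x \<beta> \<longrightarrow>
         rep False (x_act (\<lambda>i u. u (w i))) b1 = (\<lambda>m. lin_eta \<beta>' (sgn_op m)) \<longrightarrow>
         bitaylor dK [a0 + a1] \<kappa> [b0 + b1] = (\<Sum>i<n. \<alpha> i * \<beta>' i + \<alpha>' i * \<beta> i) *\<^sub>R \<kappa>"
    using koszul_bimodule[OF A B rA(1)[unfolded if_True] rB(1)[unfolded if_False]] by blast
  have "bitaylor dK [sym_gen (in_degree 1 UNIV) v] \<kappa> [sym_gen (in_degree 0 (dual UNIV)) u] = u v *\<^sub>R \<kappa>"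
    if u: "u \<in> dual UNIV" for \<kappa> v u
  proof -
    \<comment> \<open>A has no functionals and B no exterior generators; the missing parts are
      filled with 0, which acts with zero coefficients.\<close>
    have z: "0 \<in> homog ?A 0" "0 \<in> homog ?B 1"
      using graded_algebra_facts(1)[OF A] graded_algebra_facts(1)[OF B] by (auto simp: graded_by_characters_def subspace_0)
    have g: "sym_gen (in_degree 1 UNIV) v \<in> homog ?A 1" "sym_gen (in_degree 0 (dual UNIV)) u \<in> homog ?B 0"
      by (intro sym_gen_homog u UNIV_I)+
    have t: "\<kappa> \<in> total ?K" by (rule homog_total[of _ ?K 0]) (simp add: in_degree_def)
    have "rep True (eta_act True c) 0 = lin_x (\<lambda>_. 0)"
      using linear_0[OF linear_bilinear(2)[OF BA]] by (auto simp: lin_x_def fun_eq_iff)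
    moreover have "rep True (eta_act True c) (sym_gen (in_degree 1 UNIV) v) = (\<lambda>m. val_sgn (lin_eta (\<lambda>i. c i v) m))"
      unfolding rA(2) by (rule ext) (simp add: eta_act_def)
    moreover have "rep False (x_act (\<lambda>i u. u (w i))) (sym_gen (in_degree 0 (dual UNIV)) u) = lin_x (\<lambda>i. u (w i))"
      unfolding rB(2) x_act_def ..
    moreover have "rep False (x_act (\<lambda>i u. u (w i))) 0 = (\<lambda>m. lin_eta (\<lambda>_. 0) (sgn_op m))"
      using linear_0[OF linear_bilinear(2)[OF BB]] by (auto simp: lin_eta_def fun_eq_iff)
    ultimately have "bitaylor dK [0 + sym_gen (in_degree 1 UNIV) v] \<kappa> [sym_gen (in_degree 0 (dual UNIV)) u + 0] =
        (\<Sum>i<n. 0 * 0 + c i v * u (w i)) *\<^sub>R \<kappa>"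
      using val z g t by blast
    then show ?thesis using pair[OF u, of v] by (simp add: mult.commute)
  qed
  with d show ?case
    by blast
next
  case (2 U V)
  then have U: "subspace U" and V: "subspace V" by auto
  have VU: "V \<inter> U = U \<inter> V" by auto
  have W: "subspace {x + y |x y. x \<in> U \<and> y \<in> V}" using U V by (rule subspace_sums)
  have r: "subspace (range (quot N))" if "subspace N" for N :: "'x set"
    by (rule linear_subspace_image[OF quot(1)[OF that] subspace_UNIV])
  have galg: "graded_algebra (galg_tensor (SymAlg (dual N)) (ExtAlg (range (quot N'))))" if "subspace N'" for N N' :: "'x set"
    by (intro graded_algebra_tensor(1) graded_algebra_Sym graded_by_characters_in_degree subspace_dual r that)
  have A: "graded_algebra (brane_alg U)" and B: "graded_algebra (brane_alg V)" and K: "graded_by_characters (brane_space U V)"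
    using galg[OF U] galg[OF V] graded_algebra_facts(1)[OF galg[OF W]] by (simp_all add: brane_alg_def brane_space_def)
  obtain n1 :: nat and w1 :: "nat \<Rightarrow> 'x" and c1 where c1: "\<forall>i. linear (c1 i :: 'x \<Rightarrow> real)"
    and pair1: "\<forall>f\<in>dual U. \<forall>z\<in>U. (\<forall>x\<in>U \<inter> V. f x = 0) \<longrightarrow> f z = (\<Sum>i<n1. f (w1 i) * c1 i (quot V z))"
    using pairing_coordinates[OF assms U V] by blast
  obtain n2 :: nat and w2 :: "nat \<Rightarrow> 'x" and c2 where c2: "\<forall>i. linear (c2 i :: 'x \<Rightarrow> real)"
    and pair2: "\<forall>g\<in>dual V. \<forall>y\<in>V. (\<forall>x\<in>V \<inter> U. g x = 0) \<longrightarrow> g y = (\<Sum>i<n2. g (w2 i) * c2 i (quot U y))"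
    using pairing_coordinates[OF assms V U] by blast
  \<comment> \<open>The first \<open>n1\<close> variables belong to U/(U \<inter> V), where A
    multiplies by x_i and B differentiates by \<eta>_i; the next \<open>n2\<close> belong to V/(U
    \<inter> V), with the roles exchanged. Each of the two pairings thus has its own block of
    variables.\<close>
  define a where "a i f = (if i < n1 then f (w1 i) else 0)" for i and f :: "'x \<Rightarrow> real"
  define a' where "a' i q = (if i < n1 then 0 else c2 (i - n1) q)" for i and q :: 'x
  define b where "b i g = (if i < n1 then 0 else g (w2 (i - n1)))" for i and g :: "'x \<Rightarrow> real"
  define b' where "b' i q = (if i < n1 then c1 i q else 0)" for i and q :: 'x
  have lin: "\<And>i. linear (a i)" "\<And>i. linear (a' i)" "\<And>i. linear (b i)" "\<And>i. linear (b' i)"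
    using c1 c2 by (simp_all add: a_def[abs_def] a'_def[abs_def] b_def[abs_def] b'_def[abs_def] linear_iff scaleR_fun_def)
  interpret koszul_complex "n1 + n2" "brane_space U V" by unfold_locales (rule K)
  note rA = represents_brane[of a a' "dual U" "range (quot U)" True, OF lin(1,2) subspace_dual r[OF U], folded brane_alg_def]
    and rB = represents_brane[of b b' "dual V" "range (quot V)" False, OF lin(3,4) subspace_dual r[OF V], folded brane_alg_def]
  let ?L = "brane_act True a a'" and ?R = "brane_act False b b'"
  obtain dA dB dK where d: "ainf_of_algebra (brane_alg U) dA" "ainf_of_algebra (brane_alg V) dB"
    "ainf_bimodule_structure (homog (brane_alg U)) dA (homog (brane_alg V)) dB (brane_space U V) dK"
    and val: "\<forall>a0\<in>homog (brane_alg U) 0. \<forall>a1\<in>homog (brane_alg U) 1. \<forall>b0\<in>homog (brane_alg V) 0. \<forall>b1\<in>homog (brane_alg V) 1.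
         \<forall>\<alpha> \<alpha>' \<beta> \<beta>'. \<forall>\<kappa>\<in>total (brane_space U V).
         ?L a0 = lin_x \<alpha> \<longrightarrow> ?L a1 = (\<lambda>m. val_sgn (lin_eta \<alpha>' m)) \<longrightarrow>
         ?R b0 = lin_x \<beta> \<longrightarrow> ?R b1 = (\<lambda>m. lin_eta \<beta>' (sgn_op m)) \<longrightarrow>
         bitaylor dK [a0 + a1] \<kappa> [b0 + b1] = (\<Sum>i<n1 + n2. \<alpha> i * \<beta>' i + \<alpha>' i * \<beta> i) *\<^sub>R \<kappa>"
    using koszul_bimodule[OF A B rA(1)[unfolded if_True] rB(1)[unfolded if_False]] by blast
  have "bitaylor dK [brane_gen U (f, quot U y)] \<kappa> [brane_gen V (g, quot V z)] = (f z + g y) *\<^sub>R \<kappa>"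
    if \<kappa>: "\<kappa> \<in> total (brane_space U V)" and f: "f \<in> dual U" "\<forall>x\<in>U \<inter> V. f x = 0" and g: "g \<in> dual V" "\<forall>x\<in>U \<inter> V. g x = 0"
      and y: "y \<in> V" and z: "z \<in> U" for \<kappa> f g y z
  proof -
    have hom: "sym_gen (in_degree 0 (dual N)) h \<otimes> gone (ExtAlg (range (quot N))) \<in> homog (brane_alg N) 0"
      "gone (SymAlg (dual N)) \<otimes> sym_gen (in_degree 1 (range (quot N))) (quot N x) \<in> homog (brane_alg N) 1"
      if "h \<in> dual N" for h x and N :: "'x set"
      unfolding brane_alg_def galg_tensor_def galg.simps using that
      by (auto intro!: pure_tensor_grading sym_gen_homog gone_homog)
    have e: "eta_act True a' q = (\<lambda>m. val_sgn (lin_eta (\<lambda>i. a' i q) m))" "eta_act False b' q = (\<lambda>m. lin_eta (\<lambda>i. b' i q) (sgn_op m))" for q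
      by (simp_all add: eta_act_def fun_eq_iff)
    have "bitaylor dK [brane_gen U (f, quot U y)] \<kappa> [brane_gen V (g, quot V z)] =
       (\<Sum>i<n1 + n2. a i f * b' i (quot V z) + a' i (quot U y) * b i g) *\<^sub>R \<kappa>"
      using val hom(1)[OF f(1)] hom(2)[OF f(1), of y] hom(1)[OF g(1)] hom(2)[OF g(1), of z] \<kappa> rA(2)[of f, unfolded x_act_def] rA(3)[of "quot U y", unfolded e]
        rB(2)[of g, unfolded x_act_def] rB(3)[of "quot V z", unfolded e]
      unfolding brane_gen_def split by blast
    also have "(\<Sum>i<n1 + n2. a i f * b' i (quot V z) + a' i (quot U y) * b i g) = f z + g y"
      using pair1[rule_format, OF f(1) z] pair2[rule_format, OF g(1) y] f(2) g(2)
      by (simp add: sum_lessThan_add a_def a'_def b_def b'_def VU mult.commute)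
    finally show ?thesis .
  qed
  with d show ?case
    by blast
qed

end
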